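(* Let $R$ be a one-dimensional Gorenstein local domain and let $M$ and $N$ be finitely generated torsion-free $R$-modules. Then $M\otimes_R N$ is torsion-free if and only if $\widehat{\operatorname{Tor}}_0^R(M,N)=0$.
   Context: Rings are commutative Noetherian. A complex $\mathbf{T}$ of (finitely generated) free $R$-modules is totally acyclic if $\operatorname{H}_n(\mathbf{T})=0=\operatorname{H}_n(\operatorname{Hom}_R(\mathbf{T},R))$ for all $n\in\mathbb{Z}$. A complete resolution of $M$ is a diagram $\mathbf{T}\xrightarrow{\vartheta}\mathbf{P}\xrightarrow{\pi}M$, where $\mathbf{P}$ is a projective resolution of $M$, $\mathbf{T}$ is totally acyclic, and $\vartheta$ is a morphism of complexes with $\vartheta_i$ an isomorphism for all $i\gg 0$. Such a resolution exists if and only if $M$ has finite Gorenstein dimension (in particular, for every finitely generated module over a Gorenstein local ring). The Tate homology of $M$ and $N$ is $\widehat{\operatorname{Tor}}_i^R(M,N)=\operatorname{H}_i(\mathbf{T}\otimes_R N)$ for $i\in\mathbb{Z}$. *)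

theory Defs
  imports
    "HOL-Library.Extended_Nat"
    "HOL-Algebra.Ring_Divisibility"
    "Jordan_Normal_Form.Missing_VectorSpace"
begin

text \<open>
  Modules are those of HOL-Algebra: records with an explicit carrier, over a commutative ring
  that is itself a record. Homomorphisms, spans and linear independence are the notions
  \<open>module_hom\<close>, \<open>module.span\<close> and \<open>module.lin_dep\<close> of the theory \<open>LinearCombinations\<close>. The
  record type of modules extends that of rings, so it has fields \<open>mult\<close> and \<open>one\<close>, which carry no
  meaning for a module and are left unspecified in the constructions below.
\<close>

section \<open>Rings\<close>

definition local_ring :: "('a, 'r) ring_scheme \<Rightarrow> bool" where
  "local_ring R \<longleftrightarrow> cring R \<and> (\<exists>!\<mm>. maximalideal \<mm> R)"

definition krull_dim :: "('a, 'r) ring_scheme \<Rightarrow> enat" where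
  "krull_dim R = Sup {enat n | n. \<exists>\<pp> :: nat \<Rightarrow> 'a set.
     (\<forall>i\<le>n. primeideal (\<pp> i) R) \<and> (\<forall>i<n. \<pp> i \<subset> \<pp> (Suc i))}"

section \<open>Modules\<close>

definition ring_module :: "('a, 'r) ring_scheme \<Rightarrow> ('a, 'a) module" where
  "ring_module R = \<lparr>carrier = carrier R, mult = undefined, one = undefined,
     zero = \<zero>\<^bsub>R\<^esub>, add = add R, smult = mult R\<rparr>"

definition zero_module :: "('a, 'm) module \<Rightarrow> bool" where
  "zero_module M \<longleftrightarrow> carrier M = {\<zero>\<^bsub>M\<^esub>}"

definition fin_gen :: "('a, 'r) ring_scheme \<Rightarrow> ('a, 'm) module \<Rightarrow> bool" where
  "fin_gen R M \<longleftrightarrow> (\<exists>S. finite S \<and> S \<subseteq> carrier M \<and> module.span R M S = carrier M)"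

definition fin_gen_free :: "('a, 'r) ring_scheme \<Rightarrow> ('a, 'm) module \<Rightarrow> bool" where
  "fin_gen_free R M \<longleftrightarrow> (\<exists>B. finite B \<and> B \<subseteq> carrier M \<and>
     \<not> module.lin_dep R M B \<and> module.span R M B = carrier M)"

text \<open>Torsion-freeness is meant for modules over a domain.\<close>

definition torsion_free :: "('a, 'r) ring_scheme \<Rightarrow> ('a, 'm) module \<Rightarrow> bool" where
  "torsion_free R M \<longleftrightarrow> (\<forall>r\<in>carrier R. \<forall>x\<in>carrier M.
     r \<odot>\<^bsub>M\<^esub> x = \<zero>\<^bsub>M\<^esub> \<longrightarrow> r = \<zero>\<^bsub>R\<^esub> \<or> x = \<zero>\<^bsub>M\<^esub>)"

definition quot_module :: "('a, 'm) module \<Rightarrow> 'm set \<Rightarrow> ('a, 'm set) module" where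
  "quot_module M K = \<lparr>carrier = a_rcosets\<^bsub>M\<^esub> K, mult = undefined, one = undefined,
     zero = K, add = set_add M, smult = (\<lambda>r X. \<Union>x\<in>X. K +>\<^bsub>M\<^esub> (r \<odot>\<^bsub>M\<^esub> x))\<rparr>"

text \<open>
  Maps are total functions, so for the homomorphisms to form a module they have to be normalised
  outside the carrier of their source.
\<close>

definition hom_module ::
  "('a, 'r) ring_scheme \<Rightarrow> ('a, 'm) module \<Rightarrow> ('a, 'n) module \<Rightarrow> ('a, 'm \<Rightarrow> 'n) module" where
  "hom_module R M N = \<lparr>carrier = module_hom R M N \<inter> extensional (carrier M),
     mult = undefined, one = undefined,
     zero = (\<lambda>x\<in>carrier M. \<zero>\<^bsub>N\<^esub>),
     add = (\<lambda>f g. \<lambda>x\<in>carrier M. f x \<oplus>\<^bsub>N\<^esub> g x),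
     smult = (\<lambda>r f. \<lambda>x\<in>carrier M. r \<odot>\<^bsub>N\<^esub> f x)\<rparr>"

text \<open>The free module on a set, realised by the functions of finite support.\<close>

definition free_module :: "('a, 'r) ring_scheme \<Rightarrow> 's set \<Rightarrow> ('a, 's \<Rightarrow> 'a) module" where
  "free_module R S = \<lparr>carrier = {f \<in> S \<rightarrow>\<^sub>E carrier R. finite {s \<in> S. f s \<noteq> \<zero>\<^bsub>R\<^esub>}},
     mult = undefined, one = undefined,
     zero = (\<lambda>s\<in>S. \<zero>\<^bsub>R\<^esub>),
     add = (\<lambda>f g. \<lambda>s\<in>S. f s \<oplus>\<^bsub>R\<^esub> g s),
     smult = (\<lambda>r f. \<lambda>s\<in>S. r \<otimes>\<^bsub>R\<^esub> f s)\<rparr>"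

definition free_gen :: "('a, 'r) ring_scheme \<Rightarrow> 's set \<Rightarrow> 's \<Rightarrow> 's \<Rightarrow> 'a" where
  "free_gen R S s = (\<lambda>t\<in>S. if t = s then \<one>\<^bsub>R\<^esub> else \<zero>\<^bsub>R\<^esub>)"

section \<open>Tensor products\<close>

text \<open>
  The usual construction: the free module on the product of the carriers, modulo the submodule
  generated by the bilinearity relations.
\<close>

definition tensor_rels ::
  "('a, 'r) ring_scheme \<Rightarrow> ('a, 'm) module \<Rightarrow> ('a, 'n) module \<Rightarrow> ('m \<times> 'n \<Rightarrow> 'a) set" where
  "tensor_rels R M N =
    (let F = free_module R (carrier M \<times> carrier N);
         e = (\<lambda>x y. free_gen R (carrier M \<times> carrier N) (x, y)) in
     {e (x \<oplus>\<^bsub>M\<^esub> x') y \<ominus>\<^bsub>F\<^esub> (e x y \<oplus>\<^bsub>F\<^esub> e x' y) | x x' y.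
        x \<in> carrier M \<and> x' \<in> carrier M \<and> y \<in> carrier N} \<union>
     {e x (y \<oplus>\<^bsub>N\<^esub> y') \<ominus>\<^bsub>F\<^esub> (e x y \<oplus>\<^bsub>F\<^esub> e x y') | x y y'.
        x \<in> carrier M \<and> y \<in> carrier N \<and> y' \<in> carrier N} \<union>
     {e (r \<odot>\<^bsub>M\<^esub> x) y \<ominus>\<^bsub>F\<^esub> (r \<odot>\<^bsub>F\<^esub> e x y) | r x y.
        r \<in> carrier R \<and> x \<in> carrier M \<and> y \<in> carrier N} \<union>
     {e x (r \<odot>\<^bsub>N\<^esub> y) \<ominus>\<^bsub>F\<^esub> (r \<odot>\<^bsub>F\<^esub> e x y) | r x y.
        r \<in> carrier R \<and> x \<in> carrier M \<and> y \<in> carrier N})"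

definition tensor_ker ::
  "('a, 'r) ring_scheme \<Rightarrow> ('a, 'm) module \<Rightarrow> ('a, 'n) module \<Rightarrow> ('m \<times> 'n \<Rightarrow> 'a) set" where
  "tensor_ker R M N =
     module.span R (free_module R (carrier M \<times> carrier N)) (tensor_rels R M N)"

definition tensor_product :: "('a, 'r) ring_scheme \<Rightarrow> ('a, 'm) module \<Rightarrow> ('a, 'n) module \<Rightarrow>
    ('a, ('m \<times> 'n \<Rightarrow> 'a) set) module" where
  "tensor_product R M N =
     quot_module (free_module R (carrier M \<times> carrier N)) (tensor_ker R M N)"

definition pure_tensor :: "('a, 'r) ring_scheme \<Rightarrow> ('a, 'm) module \<Rightarrow> ('a, 'n) module \<Rightarrow>
    'm \<Rightarrow> 'n \<Rightarrow> ('m \<times> 'n \<Rightarrow> 'a) set" where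
  "pure_tensor R M N x y =
     tensor_ker R M N +>\<^bsub>free_module R (carrier M \<times> carrier N)\<^esub>
       free_gen R (carrier M \<times> carrier N) (x, y)"

text \<open>
  For a homomorphism \<open>f\<close> from \<open>M\<close> to \<open>M'\<close>, the induced homomorphism from \<open>M \<otimes> N\<close> to \<open>M' \<otimes> N\<close>;
  it is determined by its values on pure tensors, since these generate.
\<close>

definition tensor_map :: "('a, 'r) ring_scheme \<Rightarrow> ('a, 'm) module \<Rightarrow> ('a, 'k) module \<Rightarrow>
    ('a, 'n) module \<Rightarrow> ('m \<Rightarrow> 'k) \<Rightarrow> ('m \<times> 'n \<Rightarrow> 'a) set \<Rightarrow> ('k \<times> 'n \<Rightarrow> 'a) set" where
  "tensor_map R M M' N f =
     (THE h. h \<in> carrier (hom_module R (tensor_product R M N) (tensor_product R M' N)) \<and>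
        (\<forall>x\<in>carrier M. \<forall>y\<in>carrier N. h (pure_tensor R M N x y) = pure_tensor R M' N (f x) y))"

section \<open>Complexes\<close>

text \<open>Complexes are indexed homologically: the differential \<open>diff C n\<close> goes from degree \<open>n\<close> to
  degree \<open>n - 1\<close>.\<close>

record ('a, 'm) cplx =
  obj  :: "int \<Rightarrow> ('a, 'm) module"
  diff :: "int \<Rightarrow> 'm \<Rightarrow> 'm"

definition chain_complex :: "('a, 'r) ring_scheme \<Rightarrow> ('a, 'm) cplx \<Rightarrow> bool" where
  "chain_complex R C \<longleftrightarrow>
     (\<forall>n. module R (obj C n)) \<and>
     (\<forall>n. diff C n \<in> module_hom R (obj C n) (obj C (n - 1))) \<and>
     (\<forall>n. \<forall>x\<in>carrier (obj C n). diff C (n - 1) (diff C n x) = \<zero>\<^bsub>obj C (n - 1 - 1)\<^esub>)"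

definition chain_map ::
  "('a, 'r) ring_scheme \<Rightarrow> ('a, 'm) cplx \<Rightarrow> ('a, 'n) cplx \<Rightarrow> (int \<Rightarrow> 'm \<Rightarrow> 'n) \<Rightarrow> bool" where
  "chain_map R C D \<theta> \<longleftrightarrow>
     (\<forall>n. \<theta> n \<in> module_hom R (obj C n) (obj D n)) \<and>
     (\<forall>n. \<forall>x\<in>carrier (obj C n). \<theta> (n - 1) (diff C n x) = diff D n (\<theta> n x))"

definition cycles :: "('a, 'm) cplx \<Rightarrow> int \<Rightarrow> 'm set" where
  "cycles C n = {x \<in> carrier (obj C n). diff C n x = \<zero>\<^bsub>obj C (n - 1)\<^esub>}"

definition boundaries :: "('a, 'm) cplx \<Rightarrow> int \<Rightarrow> 'm set" where
  "boundaries C n = diff C (n + 1) ` carrier (obj C (n + 1))"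

definition homology :: "('a, 'm) cplx \<Rightarrow> int \<Rightarrow> ('a, 'm set) module" where
  "homology C n = quot_module ((obj C n)\<lparr>carrier := cycles C n\<rparr>) (boundaries C n)"

text \<open>
  \<open>Hom(C, N)\<close> has \<open>Hom(C_{-n}, N)\<close> in degree \<open>n\<close>. The sign that is customary in its differential
  is omitted; it affects neither cycles nor boundaries.
\<close>

definition hom_complex ::
  "('a, 'r) ring_scheme \<Rightarrow> ('a, 'm) cplx \<Rightarrow> ('a, 'n) module \<Rightarrow> ('a, 'm \<Rightarrow> 'n) cplx" where
  "hom_complex R C N = \<lparr>obj = (\<lambda>n. hom_module R (obj C (- n)) N),
     diff = (\<lambda>n f. \<lambda>x\<in>carrier (obj C (1 - n)). f (diff C (1 - n) x))\<rparr>"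

definition tensor_complex :: "('a, 'r) ring_scheme \<Rightarrow> ('a, 'm) cplx \<Rightarrow> ('a, 'n) module \<Rightarrow>
    ('a, ('m \<times> 'n \<Rightarrow> 'a) set) cplx" where
  "tensor_complex R C N = \<lparr>obj = (\<lambda>n. tensor_product R (obj C n) N),
     diff = (\<lambda>n. tensor_map R (obj C n) (obj C (n - 1)) N (diff C n))\<rparr>"

section \<open>Injective modules and Gorenstein local rings\<close>

text \<open>
  A definition in HOL cannot quantify over all modules, only over those with carriers in given
  types. In the following definition the test modules \<open>A\<close>, \<open>B\<close> have their carriers in the type
  of the ring elements. These include the inclusions of the ideals into the ring, so that by Baer's
  criterion the extension property follows for modules with carriers in arbitrary types.
\<close>

definition injective_module :: "('a, 'r) ring_scheme \<Rightarrow> ('a, 'e) module \<Rightarrow> bool" where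
  "injective_module R E \<longleftrightarrow> module R E \<and>
     (\<forall>(A :: ('a, 'a) module) (B :: ('a, 'a) module) i g.
        module R A \<and> module R B \<and>
        i \<in> module_hom R A B \<and> inj_on i (carrier A) \<and> g \<in> module_hom R A E \<longrightarrow>
        (\<exists>h\<in>module_hom R B E. \<forall>x\<in>carrier A. h (i x) = g x))"

text \<open>
  \<open>0 \<rightarrow> M \<rightarrow> I 0 \<rightarrow> I 1 \<rightarrow> \<dots>\<close> is exact with injective \<open>I j\<close>, where \<open>\<epsilon>\<close> is the first and the
  \<open>d j\<close> are the subsequent maps.
\<close>

definition injective_resolution :: "('a, 'r) ring_scheme \<Rightarrow> ('a, 'm) module \<Rightarrow>
    ('m \<Rightarrow> 'e) \<Rightarrow> (nat \<Rightarrow> ('a, 'e) module) \<Rightarrow> (nat \<Rightarrow> 'e \<Rightarrow> 'e) \<Rightarrow> bool" where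
  "injective_resolution R M \<epsilon> I d \<longleftrightarrow>
     (\<forall>j. injective_module R (I j)) \<and>
     \<epsilon> \<in> module_hom R M (I 0) \<and> inj_on \<epsilon> (carrier M) \<and>
     (\<forall>j. d j \<in> module_hom R (I j) (I (Suc j))) \<and>
     \<epsilon> ` carrier M = {x \<in> carrier (I 0). d 0 x = \<zero>\<^bsub>I 1\<^esub>} \<and>
     (\<forall>j. d j ` carrier (I j) = {x \<in> carrier (I (Suc j)). d (Suc j) x = \<zero>\<^bsub>I (Suc (Suc j))\<^esub>})"

text \<open>
  The first argument is the type in which the injective modules of the resolution are sought.
  A theorem that assumes the property for a type variable assumes only that there is a
  finite injective resolution with carriers in some type.
\<close>

definition finite_inj_dim ::
  "'e itself \<Rightarrow> ('a, 'r) ring_scheme \<Rightarrow> ('a, 'm) module \<Rightarrow> bool" where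
  "finite_inj_dim TYPE('e) R M \<longleftrightarrow>
     (\<exists>(\<epsilon> :: 'm \<Rightarrow> 'e) I d n. injective_resolution R M \<epsilon> I d \<and> (\<forall>j>n. zero_module (I j)))"

definition gorenstein_local_ring :: "'e itself \<Rightarrow> ('a, 'r) ring_scheme \<Rightarrow> bool" where
  "gorenstein_local_ring TYPE('e) R \<longleftrightarrow>
     noetherian_ring R \<and> local_ring R \<and> finite_inj_dim TYPE('e) R (ring_module R)"

section \<open>Complete resolutions and Tate homology\<close>

text \<open>
  Again the types of the test modules \<open>A\<close>, \<open>B\<close> are no restriction: \<open>A\<close> can be the free module
  on the carrier of \<open>P\<close> and \<open>B\<close> can be \<open>P\<close> itself, so the lifting property makes \<open>P\<close> a direct
  summand of a free module.
\<close>

definition projective_module :: "('a, 'r) ring_scheme \<Rightarrow> ('a, 'p) module \<Rightarrow> bool" where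
  "projective_module R P \<longleftrightarrow> module R P \<and>
     (\<forall>(A :: ('a, 'p \<Rightarrow> 'a) module) (B :: ('a, 'p) module) q g.
        module R A \<and> module R B \<and>
        q \<in> module_hom R A B \<and> q ` carrier A = carrier B \<and> g \<in> module_hom R P B \<longrightarrow>
        (\<exists>h\<in>module_hom R P A. \<forall>x\<in>carrier P. q (h x) = g x))"

definition projective_resolution ::
  "('a, 'r) ring_scheme \<Rightarrow> ('a, 'p) cplx \<Rightarrow> ('p \<Rightarrow> 'm) \<Rightarrow> ('a, 'm) module \<Rightarrow> bool" where
  "projective_resolution R P \<pi> M \<longleftrightarrow>
     chain_complex R P \<and>
     (\<forall>n<0. zero_module (obj P n)) \<and>
     (\<forall>n\<ge>0. projective_module R (obj P n)) \<and>
     (\<forall>n\<ge>1. zero_module (homology P n)) \<and>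
     \<pi> \<in> module_hom R (obj P 0) M \<and>
     \<pi> ` carrier (obj P 0) = carrier M \<and>
     {x \<in> carrier (obj P 0). \<pi> x = \<zero>\<^bsub>M\<^esub>} = boundaries P 0"

definition totally_acyclic :: "('a, 'r) ring_scheme \<Rightarrow> ('a, 't) cplx \<Rightarrow> bool" where
  "totally_acyclic R T \<longleftrightarrow>
     chain_complex R T \<and>
     (\<forall>n. fin_gen_free R (obj T n)) \<and>
     (\<forall>n. zero_module (homology T n)) \<and>
     (\<forall>n. zero_module (homology (hom_complex R T (ring_module R)) n))"

definition complete_resolution :: "('a, 'r) ring_scheme \<Rightarrow> ('a, 't) cplx \<Rightarrow>
    (int \<Rightarrow> 't \<Rightarrow> 'p) \<Rightarrow> ('a, 'p) cplx \<Rightarrow> ('p \<Rightarrow> 'm) \<Rightarrow> ('a, 'm) module \<Rightarrow> bool" where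
  "complete_resolution R T \<theta> P \<pi> M \<longleftrightarrow>
     totally_acyclic R T \<and>
     projective_resolution R P \<pi> M \<and>
     chain_map R T P \<theta> \<and>
     (\<exists>n. \<forall>i\<ge>n. bij_betw (\<theta> i) (carrier (obj T i)) (carrier (obj P i)))"

text \<open>
  Tate homology of \<open>M\<close> and \<open>N\<close> in degree \<open>i\<close>, computed from the totally acyclic complex \<open>T\<close>
  of a complete resolution of \<open>M\<close>.
\<close>

definition tate_Tor :: "('a, 'r) ring_scheme \<Rightarrow> ('a, 't) cplx \<Rightarrow> ('a, 'n) module \<Rightarrow> int \<Rightarrow>
    ('a, ('t \<times> 'n \<Rightarrow> 'a) set set) module" where
  "tate_Tor R T N i = homology (tensor_complex R T N) i"

end

theory Submission
  imports Defs
begin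

text \<open>
  Over a one-dimensional Gorenstein local domain the ring has injective dimension at most one: a
  cosyzygy in degree at least one is divisible, and the residue field embeds into \<open>R/x\<close> for
  \<open>x \<noteq> 0\<close> in the maximal ideal, so the injectivity of one cosyzygy passes to the previous one. Hence maps from a syzygy to a projective module extend to the ambient projective
  module whenever the syzygy is a second syzygy; since a finitely generated torsion-free \<open>M\<close> embeds
  into a projective module, this applies to all degrees of the resolution of \<open>M\<close>. Descending from
  the degrees where \<open>\<theta>\<close> is bijective one therefore obtains an inverse of \<open>\<theta>\<close> up to homotopy in all
  degrees \<open>\<ge> 0\<close>, with maps that factor through projectives as error terms in degree \<open>0\<close>. These error
  terms kill torsion after tensoring with \<open>N\<close>, and so \<open>M \<otimes> N\<close> has torsion if and only if
  \<open>Z \<otimes> N\<close> has, where \<open>Z\<close> is the image of \<open>T\<^sub>0\<close> in \<open>T\<^sub>-\<^sub>1\<close>. The torsion of \<open>Z \<otimes> N\<close> is the kernel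
  of the map to the torsion-free module \<open>T\<^sub>-\<^sub>1 \<otimes> N\<close>, which is the Tate homology in degree \<open>0\<close>.
\<close>

section \<open>Homomorphisms, submodules and quotients\<close>

text \<open>The terms of \<open>P\<close> are arbitrary projectives, so they are retracts of free
  modules of possibly infinite rank, and homomorphisms into these have to be extended as well.
  Injectivity is therefore replaced by the condition Ext^1(R/\<open>\<mm>\<close>, Y) = 0, called
  \<open>m_extension\<close>. It passes to infinite direct sums because \<open>\<mm>\<close> is
  finitely generated. Since zero and \<open>\<mm>\<close> are the only primes, it already forces the
  extension of all partial homomorphisms into Y, between modules with carriers in any types. The
  fraction field is never constructed. Sections and contractions over it appear with denominators
  cleared, as identities up to multiplication by some nonzero \<open>r\<close>, which
  torsion-freeness later cancels. In particular the embedding of M into a projective module is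
  realised by an endomorphism of the degree 0 term of \<open>P\<close> with the same kernel as
  \<open>\<pi>\<close>; it serves as a differential leaving degree 0.\<close>

lemma hom_zero: "module R A \<Longrightarrow> module R B \<Longrightarrow> f \<in> module_hom R A B \<Longrightarrow> f \<zero>\<^bsub>A\<^esub> = \<zero>\<^bsub>B\<^esub>"
  by (rule mod_hom.f0_is_0[of R]) (simp add: mod_hom_def mod_hom_axioms_def)

lemma hom_minus:
  "module R A \<Longrightarrow> module R B \<Longrightarrow> f \<in> module_hom R A B \<Longrightarrow> x \<in> carrier A \<Longrightarrow> y \<in> carrier A \<Longrightarrow>
   f (x \<ominus>\<^bsub>A\<^esub> y) = f x \<ominus>\<^bsub>B\<^esub> f y"
  by (rule mod_hom.f_minus[of R]) (simp_all add: mod_hom_def mod_hom_axioms_def)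

lemma hom_closed: "f \<in> module_hom R A B \<Longrightarrow> x \<in> carrier A \<Longrightarrow> f x \<in> carrier B"
  using module_hom_closed by blast

lemmas hom_add = module_hom_add and hom_smult = module_hom_smult

lemma homI:
  assumes "\<And>x. x \<in> carrier A \<Longrightarrow> f x \<in> carrier B"
    and "\<And>x y. x \<in> carrier A \<Longrightarrow> y \<in> carrier A \<Longrightarrow> f (x \<oplus>\<^bsub>A\<^esub> y) = f x \<oplus>\<^bsub>B\<^esub> f y"
    and "\<And>r x. r \<in> carrier R \<Longrightarrow> x \<in> carrier A \<Longrightarrow> f (r \<odot>\<^bsub>A\<^esub> x) = r \<odot>\<^bsub>B\<^esub> f x"
  shows "f \<in> module_hom R A B"
  using assms unfolding module_hom_def by blast

lemma hom_cong:
  assumes "module R A" "f \<in> module_hom R A B" "\<And>x. x \<in> carrier A \<Longrightarrow> g x = f x"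
  shows "g \<in> module_hom R A B"
proof -
  interpret A: module R A by fact
  show ?thesis using assms(2,3) unfolding module_hom_def by auto
qed

lemma hom_id: "(\<lambda>x. x) \<in> module_hom R A A"
  by (rule homI) auto

lemma hom_comp:
  "f \<in> module_hom R A B \<Longrightarrow> g \<in> module_hom R B C \<Longrightarrow> (\<lambda>x. g (f x)) \<in> module_hom R A C"
  by (rule homI) (simp_all add: hom_closed hom_add hom_smult)

lemma hom_const_zero:
  assumes "module R B" shows "(\<lambda>x. \<zero>\<^bsub>B\<^esub>) \<in> module_hom R A B"
proof -
  interpret B: module R B by fact
  show ?thesis by (rule homI) auto
qed

lemma hom_plus:
  assumes "module R B" and f: "f \<in> module_hom R A B" and g: "g \<in> module_hom R A B"
  shows "(\<lambda>x. f x \<oplus>\<^bsub>B\<^esub> g x) \<in> module_hom R A B"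
proof -
  interpret B: module R B by fact
  show ?thesis
    by (rule homI)
      (simp_all add: hom_closed[OF f] hom_closed[OF g] hom_add[OF f] hom_add[OF g] hom_smult[OF f]
        hom_smult[OF g] B.smult_r_distr B.M.a_ac)
qed

lemma hom_scale:
  assumes "module R B" and f: "f \<in> module_hom R A B" and c: "c \<in> carrier R"
  shows "(\<lambda>x. c \<odot>\<^bsub>B\<^esub> f x) \<in> module_hom R A B"
proof -
  interpret B: module R B by fact
  show ?thesis
    by (rule homI)
      (simp_all add: c hom_closed[OF f] hom_add[OF f] hom_smult[OF f]
        B.smult_r_distr B.R.m_comm flip: B.smult_assoc1)
qed

lemma hom_diff:
  assumes "module R B" and f: "f \<in> module_hom R A B" and g: "g \<in> module_hom R A B"
  shows "(\<lambda>x. f x \<ominus>\<^bsub>B\<^esub> g x) \<in> module_hom R A B"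
proof -
  interpret B: module R B by fact
  show ?thesis
    using hom_closed[OF f] hom_closed[OF g] hom_add[OF f] hom_add[OF g] hom_smult[OF f] hom_smult[OF g]
    by (intro homI) (simp_all add: a_minus_def B.smult_r_distr B.M.a_ac B.M.minus_add B.smult_r_minus)
qed

lemma hom_scale_right:
  assumes "module R B" "x \<in> carrier B"
  shows "(\<lambda>r. r \<odot>\<^bsub>B\<^esub> x) \<in> module_hom R (ring_module R) B"
proof -
  interpret B: module R B by fact
  show ?thesis
    by (rule homI) (simp_all add: assms ring_module_def B.smult_l_distr B.smult_assoc1)
qed

lemma module_ring_module:
  assumes "cring R" shows "module R (ring_module R)"
proof -
  interpret cring R by fact
  show ?thesis
    by (rule moduleI[OF assms])
      (auto simp: ring_module_def l_distr r_distr m_assoc a_ac intro!: abelian_groupI bexI[of _ "\<ominus>\<^bsub>R\<^esub> _"] l_neg)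
qed

lemma module_diff_eq_zero:
  assumes "module R A" "x \<in> carrier A" "y \<in> carrier A"
  shows "x \<ominus>\<^bsub>A\<^esub> y = \<zero>\<^bsub>A\<^esub> \<longleftrightarrow> x = y"
proof -
  interpret A: module R A by fact
  show ?thesis using assms by simp
qed

lemma hom_injI:
  assumes "module R A" "module R B" "f \<in> module_hom R A B"
    and "\<And>x. x \<in> carrier A \<Longrightarrow> f x = \<zero>\<^bsub>B\<^esub> \<Longrightarrow> x = \<zero>\<^bsub>A\<^esub>"
  shows "inj_on f (carrier A)"
proof (rule inj_onI)
  fix x y assume *: "x \<in> carrier A" "y \<in> carrier A" "f x = f y"
  interpret A: module R A by fact
  interpret B: module R B by fact
  have "f (x \<ominus>\<^bsub>A\<^esub> y) = \<zero>\<^bsub>B\<^esub>"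
    using * by (simp add: hom_minus[OF assms(1-3)] hom_closed[OF assms(3)])
  then show "x = y" using * assms(4)[of "x \<ominus>\<^bsub>A\<^esub> y"] by simp
qed

section \<open>Submodules, cosets and quotient modules\<close>

lemma submodule_of_closed:
  assumes "module R M" "K \<subseteq> carrier M" "\<zero>\<^bsub>M\<^esub> \<in> K"
    "\<And>x y. x \<in> K \<Longrightarrow> y \<in> K \<Longrightarrow> x \<oplus>\<^bsub>M\<^esub> y \<in> K"
    "\<And>r x. r \<in> carrier R \<Longrightarrow> x \<in> K \<Longrightarrow> r \<odot>\<^bsub>M\<^esub> x \<in> K"
  shows "submodule R K M"
  using assms by (simp add: submodule_def)

lemma submodule_module: "submodule R K M \<Longrightarrow> module R (M\<lparr>carrier := K\<rparr>)"
  by (rule module.submodule_is_module[OF submodule.module])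

lemma submodule_kernel:
  assumes "module R A" "module R B" "f \<in> module_hom R A B"
  shows "submodule R {x \<in> carrier A. f x = \<zero>\<^bsub>B\<^esub>} A"
  using mod_hom.ker_is_submodule[of R A B f] assms
  by (simp add: mod_hom_def mod_hom_axioms_def mod_hom.ker_def)

lemma submodule_image:
  assumes "module R A" "module R B" "f \<in> module_hom R A B"
  shows "submodule R (f ` carrier A) B"
  using mod_hom.im_is_submodule[of R A B f] assms
  by (simp add: mod_hom_def mod_hom_axioms_def mod_hom.im_def)

lemma submodule_minus:
  assumes "submodule R K M" "x \<in> K" "y \<in> K" shows "x \<ominus>\<^bsub>M\<^esub> y \<in> K"
proof -
  interpret M: module R M using assms(1) by (rule submodule.module)
  have "y \<in> carrier M" using assms submodule.subset by blast
  then have "x \<ominus>\<^bsub>M\<^esub> y = x \<oplus>\<^bsub>M\<^esub> (\<ominus>\<^bsub>R\<^esub> \<one>\<^bsub>R\<^esub>) \<odot>\<^bsub>M\<^esub> y"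
    by (simp add: a_minus_def M.smult_l_minus)
  then show ?thesis using assms by (simp add: submodule.m_closed submodule.smult_closed)
qed

lemma submodule_abelian_subgroup:
  assumes "submodule R K M" shows "abelian_subgroup K M"
proof -
  interpret M: module R M using assms by (rule submodule.module)
  show ?thesis
  proof (rule abelian_subgroupI3[OF additive_subgroupI])
    show "subgroup K (add_monoid M)"
    proof (rule M.add.subgroupI)
      show "K \<subseteq> carrier M" "K \<noteq> {}" "\<And>a b. a \<in> K \<Longrightarrow> b \<in> K \<Longrightarrow> a \<oplus>\<^bsub>M\<^esub> b \<in> K"
        using assms by (auto simp: submodule_def)
      fix a assume a: "a \<in> K"
      have "\<zero>\<^bsub>M\<^esub> \<ominus>\<^bsub>M\<^esub> a \<in> K"
        by (rule submodule_minus[OF assms _ a]) (use assms in \<open>simp add: submodule_def\<close>)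
      moreover have "a \<in> carrier M" using a assms submodule.subset by blast
      ultimately show "\<ominus>\<^bsub>M\<^esub> a \<in> K" by (simp add: a_minus_def)
    qed
  qed (rule M.abelian_group_axioms)
qed

lemma coset_eq_iff:
  assumes "submodule R K M" "x \<in> carrier M" "y \<in> carrier M"
  shows "K +>\<^bsub>M\<^esub> x = K +>\<^bsub>M\<^esub> y \<longleftrightarrow> x \<ominus>\<^bsub>M\<^esub> y \<in> K"
proof -
  interpret K: abelian_subgroup K M by (rule submodule_abelian_subgroup[OF assms(1)])
  interpret M: module R M using assms(1) by (rule submodule.module)
  have "K +>\<^bsub>M\<^esub> x = K +>\<^bsub>M\<^esub> y \<longleftrightarrow> x \<in> K +>\<^bsub>M\<^esub> y"
    using assms(2,3) K.a_repr_independence' K.a_repr_independenceD K.a_rcos_self by blast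
  then show ?thesis using K.a_rcos_module[OF assms(3,2)] by (simp add: a_minus_def)
qed

lemma quot_carrier: "carrier (quot_module M K) = (\<lambda>x. K +>\<^bsub>M\<^esub> x) ` carrier M"
  by (auto simp: quot_module_def A_RCOSETS_def RCOSETS_def a_r_coset_def)

lemma quot_zero: "\<zero>\<^bsub>quot_module M K\<^esub> = K"
  by (simp add: quot_module_def)

lemma quot_add:
  assumes "submodule R K M" "x \<in> carrier M" "y \<in> carrier M"
  shows "(K +>\<^bsub>M\<^esub> x) \<oplus>\<^bsub>quot_module M K\<^esub> (K +>\<^bsub>M\<^esub> y) = K +>\<^bsub>M\<^esub> (x \<oplus>\<^bsub>M\<^esub> y)"
proof -
  interpret K: abelian_subgroup K M by (rule submodule_abelian_subgroup[OF assms(1)])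
  show ?thesis using assms by (simp add: quot_module_def K.a_rcos_sum)
qed

text \<open>The scalar action of \<open>quot_module\<close> is a union of cosets over all
  representatives. These cosets coincide because \<open>K\<close> is closed under scalars, and the
  union collapses to one of them because a coset is nonempty.\<close>

lemma quot_smult:
  assumes K: "submodule R K M" and r: "r \<in> carrier R" and x: "x \<in> carrier M"
  shows "r \<odot>\<^bsub>quot_module M K\<^esub> (K +>\<^bsub>M\<^esub> x) = K +>\<^bsub>M\<^esub> (r \<odot>\<^bsub>M\<^esub> x)"
proof -
  interpret K: abelian_subgroup K M by (rule submodule_abelian_subgroup[OF assms(1)])
  interpret M: module R M using assms(1) by (rule submodule.module)
  have "K +>\<^bsub>M\<^esub> (r \<odot>\<^bsub>M\<^esub> y) = K +>\<^bsub>M\<^esub> (r \<odot>\<^bsub>M\<^esub> x)" if y: "y \<in> K +>\<^bsub>M\<^esub> x" for y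
  proof -
    have yc: "y \<in> carrier M" using x y K.a_elemrcos_carrier by blast
    have "y \<ominus>\<^bsub>M\<^esub> x \<in> K" using K.a_rcos_module_imp[OF x y] by (simp add: a_minus_def)
    then have "r \<odot>\<^bsub>M\<^esub> (y \<ominus>\<^bsub>M\<^esub> x) \<in> K" using K r by (simp add: submodule_def)
    moreover have "r \<odot>\<^bsub>M\<^esub> (y \<ominus>\<^bsub>M\<^esub> x) = r \<odot>\<^bsub>M\<^esub> y \<ominus>\<^bsub>M\<^esub> r \<odot>\<^bsub>M\<^esub> x"
      using r x yc by (simp add: a_minus_def M.smult_r_distr M.smult_r_minus)
    ultimately show ?thesis using r x yc by (simp add: coset_eq_iff[OF K])
  qed
  then have "(\<Union>y\<in>K +>\<^bsub>M\<^esub> x. K +>\<^bsub>M\<^esub> (r \<odot>\<^bsub>M\<^esub> y)) = (\<Union>y\<in>K +>\<^bsub>M\<^esub> x. K +>\<^bsub>M\<^esub> (r \<odot>\<^bsub>M\<^esub> x))"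
    by (intro SUP_cong refl)
  also have "\<dots> = K +>\<^bsub>M\<^esub> (r \<odot>\<^bsub>M\<^esub> x)"
    using K.a_rcos_self[OF x] by blast
  finally show ?thesis by (simp add: quot_module_def)
qed

lemma module_quot:
  assumes K: "submodule R K M" shows "module R (quot_module M K)"
proof -
  let ?Q = "quot_module M K"
  interpret M: module R M using assms(1) by (rule submodule.module)
  note simps = quot_add[OF K] quot_smult[OF K]
  interpret K: abelian_subgroup K M by (rule submodule_abelian_subgroup[OF K])
  \<comment> \<open>Carrier and addition agree with those of the factor group, so the abelian group
    axioms are inherited and only the scalar action needs work.\<close>
  note cg = comm_groupE[OF K.a_factorgroup_is_comm_group, unfolded A_FactGroup_def FactGroup_def, simplified]
  have "abelian_group ?Q"
    by (rule abelian_groupI; insert cg; simp add: quot_module_def A_RCOSETS_def set_add_def)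
  then show ?thesis
  proof (rule moduleI[OF M.is_cring])
    fix a X
    assume a: "a \<in> carrier R" and "X \<in> carrier ?Q"
    then obtain x where x: "x \<in> carrier M" "X = K +>\<^bsub>M\<^esub> x" by (auto simp: quot_carrier)
    show "a \<odot>\<^bsub>?Q\<^esub> X \<in> carrier ?Q"
      using a x by (simp add: simps quot_carrier)
  next
    fix a b X
    assume a: "a \<in> carrier R" "b \<in> carrier R" and "X \<in> carrier ?Q"
    then obtain x where x: "x \<in> carrier M" "X = K +>\<^bsub>M\<^esub> x" by (auto simp: quot_carrier)
    show "(a \<oplus>\<^bsub>R\<^esub> b) \<odot>\<^bsub>?Q\<^esub> X = a \<odot>\<^bsub>?Q\<^esub> X \<oplus>\<^bsub>?Q\<^esub> b \<odot>\<^bsub>?Q\<^esub> X"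
      using a x by (simp add: simps M.smult_l_distr)
    show "(a \<otimes>\<^bsub>R\<^esub> b) \<odot>\<^bsub>?Q\<^esub> X = a \<odot>\<^bsub>?Q\<^esub> (b \<odot>\<^bsub>?Q\<^esub> X)"
      using a x by (simp add: simps M.smult_assoc1)
  next
    fix a X Y
    assume a: "a \<in> carrier R" and "X \<in> carrier ?Q" "Y \<in> carrier ?Q"
    then obtain x y where "x \<in> carrier M" "X = K +>\<^bsub>M\<^esub> x" "y \<in> carrier M" "Y = K +>\<^bsub>M\<^esub> y"
      by (auto simp: quot_carrier)
    then show "a \<odot>\<^bsub>?Q\<^esub> (X \<oplus>\<^bsub>?Q\<^esub> Y) = a \<odot>\<^bsub>?Q\<^esub> X \<oplus>\<^bsub>?Q\<^esub> a \<odot>\<^bsub>?Q\<^esub> Y"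
      using a by (simp add: simps M.smult_r_distr)
  next
    fix X assume "X \<in> carrier ?Q"
    then show "\<one>\<^bsub>R\<^esub> \<odot>\<^bsub>?Q\<^esub> X = X" by (auto simp: quot_carrier simps)
  qed
qed

lemma hom_coset:
  assumes "submodule R K M" shows "(\<lambda>x. K +>\<^bsub>M\<^esub> x) \<in> module_hom R M (quot_module M K)"
  by (rule homI) (auto simp: quot_carrier quot_add[OF assms] quot_smult[OF assms])

lemma coset_eq_zero_iff:
  assumes "submodule R K M" "x \<in> carrier M"
  shows "K +>\<^bsub>M\<^esub> x = \<zero>\<^bsub>quot_module M K\<^esub> \<longleftrightarrow> x \<in> K"
proof -
  interpret K: abelian_subgroup K M by (rule submodule_abelian_subgroup[OF assms(1)])
  show ?thesis
    using K.a_rcos_const K.a_rcos_self[OF assms(2)] by (auto simp: quot_zero)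
qed

lemma zero_module_quot_iff:
  assumes K: "submodule R K M"
  shows "zero_module (quot_module M K) \<longleftrightarrow> carrier M \<subseteq> K"
proof -
  interpret M: module R M using assms(1) by (rule submodule.module)
  have "zero_module (quot_module M K) \<longleftrightarrow> (\<forall>x\<in>carrier M. K +>\<^bsub>M\<^esub> x = \<zero>\<^bsub>quot_module M K\<^esub>)"
    unfolding zero_module_def quot_carrier using M.M.zero_closed by blast
  then show ?thesis using coset_eq_zero_iff[OF K] by blast
qed

lemma hom_quot_lift:
  assumes K: "submodule R K M" and Y: "module R Y" and g: "g \<in> module_hom R M Y"
    and kill: "\<And>x. x \<in> K \<Longrightarrow> g x = \<zero>\<^bsub>Y\<^esub>"
  obtains h where "h \<in> module_hom R (quot_module M K) Y"
    "\<And>x. x \<in> carrier M \<Longrightarrow> h (K +>\<^bsub>M\<^esub> x) = g x"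
proof -
  interpret M: module R M using K by (rule submodule.module)
  define h where "h X = g (SOME x. x \<in> carrier M \<and> X = K +>\<^bsub>M\<^esub> x)" for X
  have h: "h (K +>\<^bsub>M\<^esub> x) = g x" if x: "x \<in> carrier M" for x
  proof -
    define y where "y = (SOME y. y \<in> carrier M \<and> K +>\<^bsub>M\<^esub> x = K +>\<^bsub>M\<^esub> y)"
    have y: "y \<in> carrier M \<and> K +>\<^bsub>M\<^esub> x = K +>\<^bsub>M\<^esub> y"
      unfolding y_def by (rule someI[of _ x]) (simp add: x)
    then have "x \<ominus>\<^bsub>M\<^esub> y \<in> K" using coset_eq_iff[OF K] x by blast
    then have "g (x \<ominus>\<^bsub>M\<^esub> y) = \<zero>\<^bsub>Y\<^esub>" by (rule kill)
    then have "g x \<ominus>\<^bsub>Y\<^esub> g y = \<zero>\<^bsub>Y\<^esub>" using x y by (simp add: hom_minus[OF M.module_axioms Y g])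
    then have "g x = g y" using module_diff_eq_zero[OF Y] hom_closed[OF g] x y by blast
    then show ?thesis by (simp add: h_def y_def)
  qed
  show thesis
  proof (rule that)
    show "h \<in> module_hom R (quot_module M K) Y"
      by (rule homI)
        (auto simp: quot_carrier quot_add[OF K] quot_smult[OF K] h hom_closed[OF g] hom_add[OF g] hom_smult[OF g])
  qed (rule h)
qed

section \<open>Direct sums and free modules\<close>

text \<open>Copies of an arbitrary \<open>Y\<close>, because sums of the ring, of the modules
  resolving it and of \<open>N\<close> all occur. The index set may be infinite, hence the finite
  supports. For \<open>Y = ring_module R\<close> this is literally
  \<open>free_module\<close>.\<close>

definition dsum :: "('a, 'm, 'z) module_scheme \<Rightarrow> 's set \<Rightarrow> ('a, 's \<Rightarrow> 'm) module" where
  "dsum Y X = \<lparr>carrier = {f \<in> X \<rightarrow>\<^sub>E carrier Y. finite {s \<in> X. f s \<noteq> \<zero>\<^bsub>Y\<^esub>}},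
     mult = undefined, one = undefined,
     zero = (\<lambda>s\<in>X. \<zero>\<^bsub>Y\<^esub>),
     add = (\<lambda>f g. \<lambda>s\<in>X. f s \<oplus>\<^bsub>Y\<^esub> g s),
     smult = (\<lambda>r f. \<lambda>s\<in>X. r \<odot>\<^bsub>Y\<^esub> f s)\<rparr>"

definition dsingle :: "('a, 'm, 'z) module_scheme \<Rightarrow> 's set \<Rightarrow> 's \<Rightarrow> 'm \<Rightarrow> 's \<Rightarrow> 'm" where
  "dsingle Y X x c = (\<lambda>s\<in>X. if s = x then c else \<zero>\<^bsub>Y\<^esub>)"

text \<open>The map out of a direct sum with components \<open>a x\<close>. The sum runs over the
  support of \<open>y\<close> because \<open>X\<close> may be infinite, where \<open>finsum\<close>
  does not compute a sum.\<close>

definition dsum_lift :: "('a, 'm, 'z) module_scheme \<Rightarrow> ('a, 'v, 'w) module_scheme \<Rightarrow> 's set \<Rightarrow>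
    ('s \<Rightarrow> 'm \<Rightarrow> 'v) \<Rightarrow> ('s \<Rightarrow> 'm) \<Rightarrow> 'v" where
  "dsum_lift Y V X a y = (\<Oplus>\<^bsub>V\<^esub>x\<in>{x \<in> X. y x \<noteq> \<zero>\<^bsub>Y\<^esub>}. a x (y x))"

lemma dsum_sel:
  "carrier (dsum Y X) = {f \<in> X \<rightarrow>\<^sub>E carrier Y. finite {s \<in> X. f s \<noteq> \<zero>\<^bsub>Y\<^esub>}}"
  "\<zero>\<^bsub>dsum Y X\<^esub> = (\<lambda>s\<in>X. \<zero>\<^bsub>Y\<^esub>)"
  "f \<oplus>\<^bsub>dsum Y X\<^esub> g = (\<lambda>s\<in>X. f s \<oplus>\<^bsub>Y\<^esub> g s)"
  "r \<odot>\<^bsub>dsum Y X\<^esub> f = (\<lambda>s\<in>X. r \<odot>\<^bsub>Y\<^esub> f s)"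
  by (simp_all add: dsum_def)

lemma dsum_coord: "f \<in> carrier (dsum Y X) \<Longrightarrow> x \<in> X \<Longrightarrow> f x \<in> carrier Y"
  by (auto simp: dsum_sel)

lemma dsum_finite: "f \<in> carrier (dsum Y X) \<Longrightarrow> finite {s \<in> X. f s \<noteq> \<zero>\<^bsub>Y\<^esub>}"
  by (simp add: dsum_sel)

lemma dsum_eqI:
  "f \<in> carrier (dsum Y X) \<Longrightarrow> g \<in> carrier (dsum Y X) \<Longrightarrow> (\<And>x. x \<in> X \<Longrightarrow> f x = g x) \<Longrightarrow> f = g"
  by (auto simp: dsum_sel intro: PiE_ext)

lemma module_dsum:
  assumes "module R Y" shows "module R (dsum Y X)"
proof -
  let ?D = "dsum Y X"
  interpret Y: module R Y by fact
  have add: "f \<oplus>\<^bsub>?D\<^esub> g \<in> carrier ?D"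
    if f: "f \<in> carrier ?D" and g: "g \<in> carrier ?D" for f g
  proof -
    have "finite {s \<in> X. f s \<oplus>\<^bsub>Y\<^esub> g s \<noteq> \<zero>\<^bsub>Y\<^esub>}"
      by (rule finite_subset[OF _ finite_UnI[OF dsum_finite[OF f] dsum_finite[OF g]]]) auto
    moreover have "{s \<in> X. (\<lambda>s\<in>X. f s \<oplus>\<^bsub>Y\<^esub> g s) s \<noteq> \<zero>\<^bsub>Y\<^esub>} = {s \<in> X. f s \<oplus>\<^bsub>Y\<^esub> g s \<noteq> \<zero>\<^bsub>Y\<^esub>}" by auto
    ultimately show ?thesis using dsum_coord[OF f] dsum_coord[OF g] by (simp add: dsum_sel)
  qed
  have smult: "r \<odot>\<^bsub>?D\<^esub> f \<in> carrier ?D"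
    if r: "r \<in> carrier R" and f: "f \<in> carrier ?D" for r f
  proof -
    have "finite {s \<in> X. r \<odot>\<^bsub>Y\<^esub> f s \<noteq> \<zero>\<^bsub>Y\<^esub>}"
      by (rule finite_subset[OF _ dsum_finite[OF f]]) (use r in auto)
    moreover have "{s \<in> X. (\<lambda>s\<in>X. r \<odot>\<^bsub>Y\<^esub> f s) s \<noteq> \<zero>\<^bsub>Y\<^esub>} = {s \<in> X. r \<odot>\<^bsub>Y\<^esub> f s \<noteq> \<zero>\<^bsub>Y\<^esub>}" by auto
    ultimately show ?thesis using dsum_coord[OF f] r by (simp add: dsum_sel)
  qed
  have zero: "\<zero>\<^bsub>?D\<^esub> \<in> carrier ?D"
    by (simp add: dsum_sel)
  have neg: "\<exists>g\<in>carrier ?D. g \<oplus>\<^bsub>?D\<^esub> f = \<zero>\<^bsub>?D\<^esub>"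
    if f: "f \<in> carrier ?D" for f
  proof (rule bexI)
    show "(\<ominus>\<^bsub>R\<^esub> \<one>\<^bsub>R\<^esub>) \<odot>\<^bsub>?D\<^esub> f \<in> carrier ?D" by (rule smult[OF _ f]) simp
    then show "(\<ominus>\<^bsub>R\<^esub> \<one>\<^bsub>R\<^esub>) \<odot>\<^bsub>?D\<^esub> f \<oplus>\<^bsub>?D\<^esub> f = \<zero>\<^bsub>?D\<^esub>"
      by (intro dsum_eqI[OF add[OF _ f] zero])
        (simp_all add: dsum_sel(2-4) dsum_coord[OF f] Y.smult_l_minus Y.M.l_neg)
  qed
  have "abelian_group ?D"
  proof (rule abelian_groupI[OF add zero _ _ _ neg])
  qed (assumption | (intro dsum_eqI[of _ Y X] add zero; simp add: dsum_sel(2-4) dsum_coord[of _ Y X] Y.M.a_ac))+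
  then show ?thesis
  proof (rule moduleI[OF Y.is_cring _ smult])
  qed (assumption | (intro dsum_eqI[of _ Y X] add smult;
      simp add: dsum_sel(2-4) dsum_coord[of _ Y X] Y.smult_l_distr Y.smult_r_distr Y.smult_assoc1))+
qed

lemma dsingle_closed:
  assumes "module R Y" "x \<in> X" "c \<in> carrier Y"
  shows "dsingle Y X x c \<in> carrier (dsum Y X)"
proof -
  interpret Y: module R Y by fact
  have "finite {s \<in> X. dsingle Y X x c s \<noteq> \<zero>\<^bsub>Y\<^esub>}"
    by (rule finite_subset[of _ "{x}"]) (auto simp: dsingle_def)
  then show ?thesis using assms(3) by (auto simp: dsum_sel dsingle_def)
qed

lemma dsum_homI:
  assumes "module R Y" and "\<And>x. x \<in> X \<Longrightarrow> f x \<in> module_hom R A Y"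
    and "\<And>a. a \<in> carrier A \<Longrightarrow> finite {x \<in> X. f x a \<noteq> \<zero>\<^bsub>Y\<^esub>}"
  shows "(\<lambda>a. \<lambda>x\<in>X. f x a) \<in> module_hom R A (dsum Y X)"
proof (rule homI)
  fix a assume a: "a \<in> carrier A"
  have "{x \<in> X. (\<lambda>x\<in>X. f x a) x \<noteq> \<zero>\<^bsub>Y\<^esub>} = {x \<in> X. f x a \<noteq> \<zero>\<^bsub>Y\<^esub>}" by auto
  then show "(\<lambda>x\<in>X. f x a) \<in> carrier (dsum Y X)"
    using assms(3)[OF a] hom_closed[OF assms(2) a] by (auto simp: dsum_sel)
qed (auto simp: dsum_sel fun_eq_iff restrict_def hom_add[OF assms(2)] hom_smult[OF assms(2)])

lemma hom_dsum_coord: "x \<in> X \<Longrightarrow> (\<lambda>y. y x) \<in> module_hom R (dsum Y X) Y"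
  by (rule homI) (simp_all add: dsum_coord dsum_sel(3,4))

text \<open>Induction on a finite set that contains the support; containment instead of equality
  makes an inserted index outside \<open>X\<close> harmless.\<close>

lemma dsum_induct [consumes 2, case_names zero single add]:
  assumes Y: "module R Y" and y: "y \<in> carrier (dsum Y X)"
    and zero: "P \<zero>\<^bsub>dsum Y X\<^esub>"
    and single: "\<And>x c. x \<in> X \<Longrightarrow> c \<in> carrier Y \<Longrightarrow> P (dsingle Y X x c)"
    and add: "\<And>y z. y \<in> carrier (dsum Y X) \<Longrightarrow> z \<in> carrier (dsum Y X) \<Longrightarrow> P y \<Longrightarrow> P z \<Longrightarrow>
      P (y \<oplus>\<^bsub>dsum Y X\<^esub> z)"
  shows "P y"
proof -
  interpret Y: module R Y by fact
  interpret D: module R "dsum Y X" by (rule module_dsum[OF Y])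
  have "y \<in> carrier (dsum Y X) \<Longrightarrow> {s \<in> X. y s \<noteq> \<zero>\<^bsub>Y\<^esub>} \<subseteq> F \<Longrightarrow> P y" if "finite F" for F y
    using that
  proof (induction F arbitrary: y rule: finite_induct)
    case empty
    then have "y = \<zero>\<^bsub>dsum Y X\<^esub>"
      by (intro dsum_eqI[of _ Y X] D.M.zero_closed) (auto simp: dsum_sel(2))
    then show ?case by (simp add: zero)
  next
    case (insert x F)
    show ?case
    proof (cases "x \<in> X")
      case False
      then show ?thesis using insert by blast
    next
      case x: True
      define z where "z = (\<lambda>s\<in>X. if s = x then \<zero>\<^bsub>Y\<^esub> else y s)"
      have zF: "{s \<in> X. z s \<noteq> \<zero>\<^bsub>Y\<^esub>} \<subseteq> F" using insert.prems(2) by (auto simp: z_def)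
      have z: "z \<in> carrier (dsum Y X)"
        using finite_subset[OF zF insert.hyps(1)] dsum_coord[OF insert.prems(1)]
        by (auto simp: dsum_sel z_def)
      have s: "dsingle Y X x (y x) \<in> carrier (dsum Y X)"
        using dsingle_closed[OF Y x] dsum_coord[OF insert.prems(1) x] by blast
      have "y = dsingle Y X x (y x) \<oplus>\<^bsub>dsum Y X\<^esub> z"
        using z s by (intro dsum_eqI[OF insert.prems(1)] D.M.a_closed)
          (auto simp: dsum_sel(3) z_def dsingle_def dsum_coord[OF insert.prems(1)])
      then show ?thesis
        using add[OF s z single insert.IH[OF z zF]] x dsum_coord[OF insert.prems(1) x] by metis
    qed
  qed
  from this[OF dsum_finite[OF y] y] show ?thesis by blast
qed

lemma dsum_hom_eqI:
  assumes "module R Y" "module R V"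
    and f: "f \<in> module_hom R (dsum Y X) V" and g: "g \<in> module_hom R (dsum Y X) V"
    and eq: "\<And>x c. x \<in> X \<Longrightarrow> c \<in> carrier Y \<Longrightarrow> f (dsingle Y X x c) = g (dsingle Y X x c)"
    and y: "y \<in> carrier (dsum Y X)"
  shows "f y = g y"
  using assms(1) y
proof (induction y rule: dsum_induct)
  case zero
  have D: "module R (dsum Y X)" by (rule module_dsum[OF assms(1)])
  show ?case using hom_zero[OF D assms(2)] f g by metis
qed (simp_all add: eq hom_add[OF f] hom_add[OF g])

context
  fixes R Y V and X :: "'s set" and a
  assumes Y: "module R Y" and V: "module R V" and a: "\<And>x. x \<in> X \<Longrightarrow> a x \<in> module_hom R Y V"
begin

text \<open>Supports can shrink under sums and multiples. Evaluating over one common finite set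
  makes the lifts comparable; the additional terms vanish since each \<open>a x\<close> sends zero
  to zero.\<close>

lemma dsum_lift_superset:
  assumes y: "y \<in> carrier (dsum Y X)" and Z: "finite Z" "{x \<in> X. y x \<noteq> \<zero>\<^bsub>Y\<^esub>} \<subseteq> Z" "Z \<subseteq> X"
  shows "dsum_lift Y V X a y = (\<Oplus>\<^bsub>V\<^esub>x\<in>Z. a x (y x))"
proof -
  interpret V: module R V by (rule V)
  show ?thesis unfolding dsum_lift_def
    using Z dsum_coord[OF y] hom_zero[OF Y V a] hom_closed[OF a]
    by (intro V.M.add.finprod_mono_neutral_cong_left) (auto simp: subset_iff)
qed

lemma hom_dsum_lift: "dsum_lift Y V X a \<in> module_hom R (dsum Y X) V"
proof -
  let ?D = "dsum Y X" and ?L = "dsum_lift Y V X a"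
  interpret Y: module R Y by (rule Y)
  interpret V: module R V by (rule V)
  interpret D: module R "?D" by (rule module_dsum[OF Y])
  have cl: "a x (y x) \<in> carrier V" if "y \<in> carrier ?D" "x \<in> X" for x y
    by (rule hom_closed[OF a[OF that(2)] dsum_coord[OF that]])
  show ?thesis
  proof (rule homI)
    fix y assume y: "y \<in> carrier ?D"
    show "?L y \<in> carrier V"
      unfolding dsum_lift_def using cl[OF y] by (intro V.M.finsum_closed) auto
    fix r assume r: "r \<in> carrier R"
    let ?Z = "{x \<in> X. y x \<noteq> \<zero>\<^bsub>Y\<^esub>}"
    have "?L (r \<odot>\<^bsub>?D\<^esub> y) = (\<Oplus>\<^bsub>V\<^esub>x\<in>?Z. a x ((r \<odot>\<^bsub>?D\<^esub> y) x))"
      using y r dsum_finite[OF y] D.smult_closed[OF r y] by (intro dsum_lift_superset) (auto simp: dsum_sel(4))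
    also have "\<dots> = (\<Oplus>\<^bsub>V\<^esub>x\<in>?Z. r \<odot>\<^bsub>V\<^esub> a x (y x))"
      using cl[OF y] r dsum_coord[OF y]
      by (intro V.M.finsum_cong') (auto simp: dsum_sel(4) hom_smult[OF a])
    also have "\<dots> = r \<odot>\<^bsub>V\<^esub> ?L y"
      unfolding dsum_lift_def using cl[OF y] r dsum_finite[OF y]
      by (intro V.finsum_smult_ldistr[symmetric]) auto
    finally show "?L (r \<odot>\<^bsub>?D\<^esub> y) = r \<odot>\<^bsub>V\<^esub> ?L y" .
  next
    fix y z assume y: "y \<in> carrier ?D" and z: "z \<in> carrier ?D"
    let ?Z = "{x \<in> X. y x \<noteq> \<zero>\<^bsub>Y\<^esub>} \<union> {x \<in> X. z x \<noteq> \<zero>\<^bsub>Y\<^esub>}"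
    have fin: "finite ?Z" using dsum_finite[OF y] dsum_finite[OF z] by blast
    have "?L (y \<oplus>\<^bsub>?D\<^esub> z) = (\<Oplus>\<^bsub>V\<^esub>x\<in>?Z. a x ((y \<oplus>\<^bsub>?D\<^esub> z) x))"
      using y z fin D.M.a_closed[OF y z] by (intro dsum_lift_superset) (auto simp: dsum_sel(3))
    also have "\<dots> = (\<Oplus>\<^bsub>V\<^esub>x\<in>?Z. a x (y x) \<oplus>\<^bsub>V\<^esub> a x (z x))"
      using cl[OF y] cl[OF z] dsum_coord[OF y] dsum_coord[OF z]
      by (intro V.M.finsum_cong') (auto simp: dsum_sel(3) hom_add[OF a])
    also have "\<dots> = (\<Oplus>\<^bsub>V\<^esub>x\<in>?Z. a x (y x)) \<oplus>\<^bsub>V\<^esub> (\<Oplus>\<^bsub>V\<^esub>x\<in>?Z. a x (z x))"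
      using cl[OF y] cl[OF z] by (intro V.M.finsum_addf) auto
    also have "(\<Oplus>\<^bsub>V\<^esub>x\<in>?Z. a x (y x)) = ?L y"
      using y fin by (intro dsum_lift_superset[symmetric]) auto
    also have "(\<Oplus>\<^bsub>V\<^esub>x\<in>?Z. a x (z x)) = ?L z"
      using z fin by (intro dsum_lift_superset[symmetric]) auto
    finally show "?L (y \<oplus>\<^bsub>?D\<^esub> z) = ?L y \<oplus>\<^bsub>V\<^esub> ?L z" .
  qed
qed

lemma dsum_lift_single:
  assumes "x \<in> X" "c \<in> carrier Y"
  shows "dsum_lift Y V X a (dsingle Y X x c) = a x c"
proof -
  interpret V: module R V by (rule V)
  have "dsum_lift Y V X a (dsingle Y X x c) = (\<Oplus>\<^bsub>V\<^esub>s\<in>{x}. a s (dsingle Y X x c s))"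
    using assms by (intro dsum_lift_superset dsingle_closed[OF Y]) (auto simp: dsingle_def)
  then show ?thesis
    using hom_closed[OF a] assms by (simp add: dsingle_def)
qed

end

section \<open>Free modules as direct sums of copies of the ring\<close>

lemma ring_module_sel:
  "carrier (ring_module R) = carrier R" "\<zero>\<^bsub>ring_module R\<^esub> = \<zero>\<^bsub>R\<^esub>"
  "x \<oplus>\<^bsub>ring_module R\<^esub> y = x \<oplus>\<^bsub>R\<^esub> y" "x \<odot>\<^bsub>ring_module R\<^esub> y = x \<otimes>\<^bsub>R\<^esub> y"
  by (simp_all add: ring_module_def)

lemma free_module_eq: "free_module R S = dsum (ring_module R) S"
  by (simp add: free_module_def dsum_def ring_module_sel)

lemma free_gen_eq: "free_gen R S s = dsingle (ring_module R) S s \<one>\<^bsub>R\<^esub>"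
  by (auto simp: free_gen_def dsingle_def ring_module_sel fun_eq_iff)

lemma module_free: "cring R \<Longrightarrow> module R (free_module R S)"
  by (simp add: free_module_eq module_dsum module_ring_module)

lemma free_gen_closed:
  assumes "cring R" "s \<in> S" shows "free_gen R S s \<in> carrier (free_module R S)"
proof -
  interpret cring R by fact
  show ?thesis unfolding free_module_eq free_gen_eq
    by (rule dsingle_closed[OF module_ring_module assms(2)]) (simp_all add: assms ring_module_sel)
qed

lemma dsingle_ring_module:
  assumes "cring R" "s \<in> S" "c \<in> carrier R"
  shows "dsingle (ring_module R) S s c = c \<odot>\<^bsub>free_module R S\<^esub> free_gen R S s"
proof -
  interpret cring R by fact
  show ?thesis using assms(3)
    by (auto simp: free_module_def free_gen_def dsingle_def ring_module_sel fun_eq_iff restrict_def)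
qed

lemma free_hom_eqI:
  assumes V: "module R V"
    and f: "f \<in> module_hom R (free_module R S) V" and g: "g \<in> module_hom R (free_module R S) V"
    and eq: "\<And>s. s \<in> S \<Longrightarrow> f (free_gen R S s) = g (free_gen R S s)"
    and y: "y \<in> carrier (free_module R S)"
  shows "f y = g y"
proof -
  interpret V: module R V by fact
  note R = V.is_cring
  show ?thesis
  proof (rule dsum_hom_eqI[OF module_ring_module[OF R] V f[unfolded free_module_eq] g[unfolded free_module_eq] _ y[unfolded free_module_eq]])
    fix x c assume x: "x \<in> S" and "c \<in> carrier (ring_module R)"
    then have c: "c \<in> carrier R" by (simp add: ring_module_sel)
    show "f (dsingle (ring_module R) S x c) = g (dsingle (ring_module R) S x c)"
      using x c eq[OF x]
      by (simp add: dsingle_ring_module[OF R] hom_smult[OF f] hom_smult[OF g] free_gen_closed[OF R])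
  qed
qed

definition free_lift :: "('a, 'r) ring_scheme \<Rightarrow> ('a, 'v, 'w) module_scheme \<Rightarrow> 's set \<Rightarrow> ('s \<Rightarrow> 'v) \<Rightarrow> ('s \<Rightarrow> 'a) \<Rightarrow> 'v" where
  "free_lift R V S g = dsum_lift (ring_module R) V S (\<lambda>s c. c \<odot>\<^bsub>V\<^esub> g s)"

lemma
  assumes V: "module R V" and g: "\<And>s. s \<in> S \<Longrightarrow> g s \<in> carrier V"
  shows hom_free_lift: "free_lift R V S g \<in> module_hom R (free_module R S) V"
    and free_lift_gen: "s \<in> S \<Longrightarrow> free_lift R V S g (free_gen R S s) = g s"
proof -
  interpret V: module R V by fact
  note R = module_ring_module[OF V.is_cring]
  have h: "(\<lambda>c. c \<odot>\<^bsub>V\<^esub> g s) \<in> module_hom R (ring_module R) V" if "s \<in> S" for s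
    using hom_scale_right[OF V g[OF that]] .
  show "free_lift R V S g \<in> module_hom R (free_module R S) V"
    unfolding free_lift_def free_module_eq by (rule hom_dsum_lift[OF R V h])
  show "free_lift R V S g (free_gen R S s) = g s" if s: "s \<in> S"
    using s dsum_lift_single[OF R V h s, where c = "\<one>\<^bsub>R\<^esub>"] g
    by (simp add: free_lift_def free_gen_eq ring_module_sel)
qed

section \<open>Tensor products\<close>

definition bilin where
  "bilin R A N Y \<beta> \<longleftrightarrow>
     (\<forall>y\<in>carrier N. (\<lambda>x. \<beta> x y) \<in> module_hom R A Y) \<and> (\<forall>x\<in>carrier A. \<beta> x \<in> module_hom R N Y)"

lemma bilinI:
  "(\<And>y. y \<in> carrier N \<Longrightarrow> (\<lambda>x. \<beta> x y) \<in> module_hom R A Y) \<Longrightarrow>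
   (\<And>x. x \<in> carrier A \<Longrightarrow> (\<lambda>y. \<beta> x y) \<in> module_hom R N Y) \<Longrightarrow> bilin R A N Y \<beta>"
  by (simp add: bilin_def)

lemma carrier_tensor:
  "carrier (tensor_product R A N) =
     (\<lambda>x. tensor_ker R A N +>\<^bsub>free_module R (carrier A \<times> carrier N)\<^esub> x) ` carrier (free_module R (carrier A \<times> carrier N))"
  by (simp add: tensor_product_def quot_carrier)

context
  fixes R :: "('a, 'r) ring_scheme" and A :: "('a, 'm) module" and N :: "('a, 'n) module"
  assumes A: "module R A" and N: "module R N"
begin

private abbreviation "F \<equiv> free_module R (carrier A \<times> carrier N)"
private abbreviation "e x y \<equiv> free_gen R (carrier A \<times> carrier N) (x, y)"

lemma module_free_pairs: "module R F"
  using module_free A by (auto simp: module_def)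

lemma free_pair_closed: "x \<in> carrier A \<Longrightarrow> y \<in> carrier N \<Longrightarrow> e x y \<in> carrier F"
  using free_gen_closed A by (metis SigmaI module.axioms(1))

lemma tensor_rels_closed: "tensor_rels R A N \<subseteq> carrier F"
proof -
  interpret F: module R F by (rule module_free_pairs)
  interpret A: module R A by (rule A)
  interpret N: module R N by (rule N)
  show ?thesis unfolding tensor_rels_def Let_def by (auto intro!: free_pair_closed)
qed

lemma tensor_ker_submodule: "submodule R (tensor_ker R A N) F"
  unfolding tensor_ker_def by (rule module.span_is_submodule[OF module_free_pairs tensor_rels_closed])

lemma tensor_rels_in_ker: "tensor_rels R A N \<subseteq> tensor_ker R A N"
  unfolding tensor_ker_def by (rule module.in_own_span[OF module_free_pairs tensor_rels_closed])

lemma module_tensor: "module R (tensor_product R A N)"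
  unfolding tensor_product_def by (rule module_quot[OF tensor_ker_submodule])

lemma pure_closed:
  "x \<in> carrier A \<Longrightarrow> y \<in> carrier N \<Longrightarrow> pure_tensor R A N x y \<in> carrier (tensor_product R A N)"
  unfolding carrier_tensor pure_tensor_def using free_pair_closed by blast

lemma bilin_pure: "bilin R A N (tensor_product R A N) (pure_tensor R A N)"
proof -
  let ?T = "tensor_product R A N" and ?p = "pure_tensor R A N" and ?K = "tensor_ker R A N"
  interpret F: module R F by (rule module_free_pairs)
  interpret A: module R A by (rule A)
  interpret N: module R N by (rule N)
  note K = tensor_ker_submodule
  note simps = pure_tensor_def tensor_product_def quot_add[OF K] quot_smult[OF K] free_pair_closed coset_eq_iff[OF K]
  have rel: "z \<in> tensor_rels R A N \<Longrightarrow> z \<in> ?K" for z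
    using tensor_rels_in_ker by blast
  show ?thesis
  proof (intro bilinI homI pure_closed)
    fix x x' y assume *: "x \<in> carrier A" "x' \<in> carrier A" "y \<in> carrier N"
    have "e (x \<oplus>\<^bsub>A\<^esub> x') y \<ominus>\<^bsub>F\<^esub> (e x y \<oplus>\<^bsub>F\<^esub> e x' y) \<in> ?K"
      by (rule rel) (use * in \<open>unfold tensor_rels_def Let_def, blast\<close>)
    then show "?p (x \<oplus>\<^bsub>A\<^esub> x') y =
        ?p x y \<oplus>\<^bsub>?T\<^esub> ?p x' y"
      using * by (simp add: simps)
  next
    fix r x y assume *: "r \<in> carrier R" "x \<in> carrier A" "y \<in> carrier N"
    have "e (r \<odot>\<^bsub>A\<^esub> x) y \<ominus>\<^bsub>F\<^esub> (r \<odot>\<^bsub>F\<^esub> e x y) \<in> ?K"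
      by (rule rel) (use * in \<open>unfold tensor_rels_def Let_def, blast\<close>)
    then show "?p (r \<odot>\<^bsub>A\<^esub> x) y = r \<odot>\<^bsub>?T\<^esub> ?p x y"
      using * by (simp add: simps)
    have "e x (r \<odot>\<^bsub>N\<^esub> y) \<ominus>\<^bsub>F\<^esub> (r \<odot>\<^bsub>F\<^esub> e x y) \<in> ?K"
      by (rule rel) (use * in \<open>unfold tensor_rels_def Let_def, blast\<close>)
    then show "?p x (r \<odot>\<^bsub>N\<^esub> y) = r \<odot>\<^bsub>?T\<^esub> ?p x y"
      using * by (simp add: simps)
  next
    fix x y y' assume *: "x \<in> carrier A" "y \<in> carrier N" "y' \<in> carrier N"
    have "e x (y \<oplus>\<^bsub>N\<^esub> y') \<ominus>\<^bsub>F\<^esub> (e x y \<oplus>\<^bsub>F\<^esub> e x y') \<in> ?K"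
      by (rule rel) (use * in \<open>unfold tensor_rels_def Let_def, blast\<close>)
    then show "?p x (y \<oplus>\<^bsub>N\<^esub> y') =
        ?p x y \<oplus>\<^bsub>?T\<^esub> ?p x y'"
      using * by (simp add: simps)
  qed
qed

text \<open>The linear extension of \<open>\<beta>\<close> to the free module on pairs kills the
  four families of relations by bilinearity, hence also their span, and so descends to the
  quotient.\<close>

lemma tensor_lift:
  assumes Y: "module R Y" and \<beta>: "bilin R A N Y \<beta>"
  obtains h where "h \<in> module_hom R (tensor_product R A N) Y"
    "\<And>x y. x \<in> carrier A \<Longrightarrow> y \<in> carrier N \<Longrightarrow> h (pure_tensor R A N x y) = \<beta> x y"
proof -
  let ?K = "tensor_ker R A N"
  interpret F: module R F by (rule module_free_pairs)
  interpret A: module R A by (rule A)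
  interpret N: module R N by (rule N)
  interpret Y: module R Y by (rule Y)
  have \<beta>1: "(\<lambda>x. \<beta> x y) \<in> module_hom R A Y" if "y \<in> carrier N" for y
    using \<beta> that by (simp add: bilin_def)
  have \<beta>2: "\<beta> x \<in> module_hom R N Y" if "x \<in> carrier A" for x
    using \<beta> that by (simp add: bilin_def)
  have cl: "\<beta> x y \<in> carrier Y" if "x \<in> carrier A" "y \<in> carrier N" for x y
    using hom_closed[OF \<beta>2] that by blast
  define g where "g = free_lift R Y (carrier A \<times> carrier N) (case_prod \<beta>)"
  have g: "g \<in> module_hom R F Y"
    unfolding g_def by (rule hom_free_lift[OF Y]) (use cl in auto)
  have ge: "g (e x y) = \<beta> x y" if "x \<in> carrier A" "y \<in> carrier N" for x y
    using free_lift_gen[OF Y, of "carrier A \<times> carrier N" "case_prod \<beta>" "(x, y)"] cl that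
    by (auto simp: g_def)
  note gs = hom_minus[OF module_free_pairs Y g] hom_add[OF g] hom_smult[OF g] ge free_pair_closed
    hom_add[OF \<beta>1] hom_smult[OF \<beta>1] hom_add[OF \<beta>2] hom_smult[OF \<beta>2] cl
  have eq: "u = v \<Longrightarrow> v \<in> carrier Y \<Longrightarrow> u \<ominus>\<^bsub>Y\<^esub> v = \<zero>\<^bsub>Y\<^esub>" for u v
    by simp
  have "tensor_rels R A N \<subseteq> {z \<in> carrier F. g z = \<zero>\<^bsub>Y\<^esub>}"
  proof
    fix z assume z: "z \<in> tensor_rels R A N"
    have "g z = \<zero>\<^bsub>Y\<^esub>"
      using z unfolding tensor_rels_def Let_def
      by (elim UnE; clarsimp simp: gs)
    then show "z \<in> {z \<in> carrier F. g z = \<zero>\<^bsub>Y\<^esub>}" using z tensor_rels_closed by blast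
  qed
  then have kill: "?K \<subseteq> {z \<in> carrier F. g z = \<zero>\<^bsub>Y\<^esub>}"
    unfolding tensor_ker_def
    by (rule module.span_is_subset[OF module_free_pairs _ submodule_kernel[OF module_free_pairs Y g]])
  obtain h where h: "h \<in> module_hom R (quot_module F ?K) Y"
      "\<And>x. x \<in> carrier F \<Longrightarrow> h (?K +>\<^bsub>F\<^esub> x) = g x"
    by (rule hom_quot_lift[OF tensor_ker_submodule Y g]) (use kill in blast)+
  show thesis
  proof (rule that)
    show "h \<in> module_hom R (tensor_product R A N) Y" using h(1) by (simp add: tensor_product_def)
    show "h (pure_tensor R A N x y) = \<beta> x y" if "x \<in> carrier A" "y \<in> carrier N" for x y
      using that by (simp add: pure_tensor_def h(2) free_pair_closed ge)
  qed
qed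

lemma tensor_hom_eqI:
  assumes Y: "module R Y"
    and f: "f \<in> module_hom R (tensor_product R A N) Y" and g: "g \<in> module_hom R (tensor_product R A N) Y"
    and eq: "\<And>x y. x \<in> carrier A \<Longrightarrow> y \<in> carrier N \<Longrightarrow> f (pure_tensor R A N x y) = g (pure_tensor R A N x y)"
    and t: "t \<in> carrier (tensor_product R A N)"
  shows "f t = g t"
proof -
  obtain z where z: "z \<in> carrier F" "t = tensor_ker R A N +>\<^bsub>F\<^esub> z"
    using t unfolding carrier_tensor by blast
  note q = hom_coset[OF tensor_ker_submodule, folded tensor_product_def]
  show ?thesis unfolding z(2)
  proof (rule free_hom_eqI[OF Y hom_comp[OF q f] hom_comp[OF q g] _ z(1)])
    fix s assume "s \<in> carrier A \<times> carrier N"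
    then show "f (tensor_ker R A N +>\<^bsub>F\<^esub> free_gen R (carrier A \<times> carrier N) s) =
        g (tensor_ker R A N +>\<^bsub>F\<^esub> free_gen R (carrier A \<times> carrier N) s)"
      using eq by (auto simp: pure_tensor_def)
  qed
qed

end

section \<open>Functoriality in the first factor and right exactness\<close>

lemma bilin_comp:
  assumes "bilin R A N Y \<beta>" "f \<in> module_hom R A' A"
  shows "bilin R A' N Y (\<lambda>x. \<beta> (f x))"
proof (rule bilinI)
  show "(\<lambda>x. \<beta> (f x) y) \<in> module_hom R A' Y" if "y \<in> carrier N" for y
    using assms that hom_comp[OF assms(2), of "\<lambda>x. \<beta> x y" Y] by (simp add: bilin_def)
  show "(\<lambda>y. \<beta> (f x) y) \<in> module_hom R N Y" if "x \<in> carrier A'" for x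
    using assms that hom_closed[OF assms(2)] by (simp add: bilin_def)
qed

context
  fixes R :: "('a, 'r) ring_scheme" and A :: "('a, 'm) module" and B :: "('a, 'k) module"
    and N :: "('a, 'n) module"
  assumes A: "module R A" and B: "module R B" and N: "module R N"
begin

lemma
  assumes f: "f \<in> module_hom R A B"
  shows hom_tensor_map: "tensor_map R A B N f \<in> module_hom R (tensor_product R A N) (tensor_product R B N)"
    and tensor_map_pure: "x \<in> carrier A \<Longrightarrow> y \<in> carrier N \<Longrightarrow>
      tensor_map R A B N f (pure_tensor R A N x y) = pure_tensor R B N (f x) y"
proof -
  let ?P = "\<lambda>h. h \<in> carrier (hom_module R (tensor_product R A N) (tensor_product R B N)) \<and>
        (\<forall>x\<in>carrier A. \<forall>y\<in>carrier N. h (pure_tensor R A N x y) = pure_tensor R B N (f x) y)"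
  obtain h where h: "h \<in> module_hom R (tensor_product R A N) (tensor_product R B N)"
    "\<And>x y. x \<in> carrier A \<Longrightarrow> y \<in> carrier N \<Longrightarrow> h (pure_tensor R A N x y) = pure_tensor R B N (f x) y"
    by (rule tensor_lift[OF A N module_tensor[OF B N] bilin_comp[OF bilin_pure[OF B N] f]]) blast
  \<comment> \<open>\<open>tensor_map\<close> is a definite description over
    \<open>hom_module\<close>, whose members are fixed outside their source. The restriction is what
    makes the map unique.\<close>
  let ?h = "restrict h (carrier (tensor_product R A N))"
  have h': "?h \<in> module_hom R (tensor_product R A N) (tensor_product R B N)"
    by (rule hom_cong[OF module_tensor[OF A N] h(1)]) simp
  have "?P ?h"
    using h h' by (simp add: hom_module_def pure_closed[OF A N])
  moreover have "g = ?h" if g: "?P g" for g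
  proof (rule extensionalityI)
    show "g \<in> extensional (carrier (tensor_product R A N))" using g by (simp add: hom_module_def)
    show "?h \<in> extensional (carrier (tensor_product R A N))" by simp
    fix t assume t: "t \<in> carrier (tensor_product R A N)"
    show "g t = ?h t"
      using g h by (intro tensor_hom_eqI[OF A N module_tensor[OF B N] _ h' _ t])
        (simp_all add: hom_module_def pure_closed[OF A N])
  qed
  ultimately have "?P (tensor_map R A B N f)"
    unfolding tensor_map_def by (rule theI)
  then show "tensor_map R A B N f \<in> module_hom R (tensor_product R A N) (tensor_product R B N)"
    "x \<in> carrier A \<Longrightarrow> y \<in> carrier N \<Longrightarrow>
      tensor_map R A B N f (pure_tensor R A N x y) = pure_tensor R B N (f x) y"
    by (simp_all add: hom_module_def)
qed

text \<open>Reduces the rules for zero, sums, multiples, identities and composites to a check on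
  pure tensors for a candidate already known to be a homomorphism.\<close>

lemma tensor_map_eqI:
  assumes f: "f \<in> module_hom R A B"
    and h: "h \<in> module_hom R (tensor_product R A N) (tensor_product R B N)"
    and "\<And>x y. x \<in> carrier A \<Longrightarrow> y \<in> carrier N \<Longrightarrow> h (pure_tensor R A N x y) = pure_tensor R B N (f x) y"
    and "t \<in> carrier (tensor_product R A N)"
  shows "tensor_map R A B N f t = h t"
  by (rule tensor_hom_eqI[OF A N module_tensor[OF B N] hom_tensor_map[OF f] h _ assms(4)])
    (simp add: assms(3) tensor_map_pure[OF f])

lemma pure_hom: "y \<in> carrier N \<Longrightarrow> (\<lambda>x. pure_tensor R B N x y) \<in> module_hom R B (tensor_product R B N)"
  using bilin_pure[OF B N] by (simp add: bilin_def)

lemma tensor_map_zero: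
  assumes "f \<in> module_hom R A B" "\<And>x. x \<in> carrier A \<Longrightarrow> f x = \<zero>\<^bsub>B\<^esub>" "t \<in> carrier (tensor_product R A N)"
  shows "tensor_map R A B N f t = \<zero>\<^bsub>tensor_product R B N\<^esub>"
  by (rule tensor_map_eqI[OF assms(1) hom_const_zero[OF module_tensor[OF B N]] _ assms(3)])
    (simp add: assms(2) hom_zero[OF B module_tensor[OF B N] pure_hom])

lemma tensor_map_plus:
  assumes f: "f \<in> module_hom R A B" and g: "g \<in> module_hom R A B" and k: "k \<in> module_hom R A B"
    and eq: "\<And>x. x \<in> carrier A \<Longrightarrow> k x = f x \<oplus>\<^bsub>B\<^esub> g x"
    and t: "t \<in> carrier (tensor_product R A N)"
  shows "tensor_map R A B N k t = tensor_map R A B N f t \<oplus>\<^bsub>tensor_product R B N\<^esub> tensor_map R A B N g t"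
  by (rule tensor_map_eqI[OF k hom_plus[OF module_tensor[OF B N] hom_tensor_map[OF f] hom_tensor_map[OF g]] _ t])
    (simp add: eq tensor_map_pure[OF f] tensor_map_pure[OF g] hom_add[OF pure_hom] hom_closed[OF f] hom_closed[OF g])

lemma tensor_map_smult:
  assumes f: "f \<in> module_hom R A B" and k: "k \<in> module_hom R A B" and r: "r \<in> carrier R"
    and eq: "\<And>x. x \<in> carrier A \<Longrightarrow> k x = r \<odot>\<^bsub>B\<^esub> f x"
    and t: "t \<in> carrier (tensor_product R A N)"
  shows "tensor_map R A B N k t = r \<odot>\<^bsub>tensor_product R B N\<^esub> tensor_map R A B N f t"
  by (rule tensor_map_eqI[OF k hom_scale[OF module_tensor[OF B N] hom_tensor_map[OF f] r] _ t])
    (simp add: eq r tensor_map_pure[OF f] hom_smult[OF pure_hom] hom_closed[OF f])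

end

lemma tensor_map_id:
  assumes A: "module R A" and N: "module R N"
    and f: "f \<in> module_hom R A A" "\<And>x. x \<in> carrier A \<Longrightarrow> f x = x"
    and t: "t \<in> carrier (tensor_product R A N)"
  shows "tensor_map R A A N f t = t"
  by (rule tensor_map_eqI[OF A A N f(1) hom_id _ t]) (simp add: f(2))

lemma tensor_map_comp:
  assumes A: "module R A" and B: "module R B" and C: "module R C" and N: "module R N"
    and f: "f \<in> module_hom R A B" and g: "g \<in> module_hom R B C" and k: "k \<in> module_hom R A C"
    and eq: "\<And>x. x \<in> carrier A \<Longrightarrow> k x = g (f x)"
    and t: "t \<in> carrier (tensor_product R A N)"
  shows "tensor_map R A C N k t = tensor_map R B C N g (tensor_map R A B N f t)"
  by (rule tensor_map_eqI[OF A C N k hom_comp[OF hom_tensor_map[OF A B N f] hom_tensor_map[OF B C N g]] _ t])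
    (simp add: eq tensor_map_pure[OF A B N f] tensor_map_pure[OF B C N g] hom_closed[OF f])

text \<open>Choosing preimages along \<open>p\<close> gives a bilinear map from \<open>C\<close> and
  \<open>N\<close> to the cokernel of the map induced by \<open>a\<close>; the choice is irrelevant
  because the kernel of \<open>p\<close> lies in the image of \<open>a\<close>. The projection to
  this cokernel therefore factors through the map induced by \<open>p\<close>, so it kills whatever
  that map kills.\<close>

lemma tensor_right_exact:
  assumes A: "module R A" and B: "module R B" and C: "module R C" and N: "module R N"
    and a: "a \<in> module_hom R A B" and p: "p \<in> module_hom R B C"
    and surj: "p ` carrier B = carrier C"
    and ker: "{x \<in> carrier B. p x = \<zero>\<^bsub>C\<^esub>} \<subseteq> a ` carrier A"
    and t: "t \<in> carrier (tensor_product R B N)"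
    and pt: "tensor_map R B C N p t = \<zero>\<^bsub>tensor_product R C N\<^esub>"
  shows "t \<in> tensor_map R A B N a ` carrier (tensor_product R A N)"
proof -
  let ?BN = "tensor_product R B N" and ?CN = "tensor_product R C N"
  let ?K = "tensor_map R A B N a ` carrier (tensor_product R A N)"
  let ?p = "pure_tensor R B N"
  interpret B: module R B by (rule B)
  interpret C: module R C by (rule C)
  note BN = module_tensor[OF B N] and CN = module_tensor[OF C N]
  note K = submodule_image[OF module_tensor[OF A N] BN hom_tensor_map[OF A B N a]]
  let ?Y = "quot_module ?BN ?K"
  note Y = module_quot[OF K]
  define q where "q t = ?K +>\<^bsub>?BN\<^esub> t" for t
  have q: "q \<in> module_hom R ?BN ?Y" unfolding q_def by (rule hom_coset[OF K])
  have qz: "q t = \<zero>\<^bsub>?Y\<^esub> \<longleftrightarrow> t \<in> ?K" if "t \<in> carrier ?BN" for t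
    unfolding q_def by (rule coset_eq_zero_iff[OF K that])
  define l where "l c = (SOME b. b \<in> carrier B \<and> p b = c)" for c
  have l: "l c \<in> carrier B" "p (l c) = c" if "c \<in> carrier C" for c
  proof -
    have "\<exists>b. b \<in> carrier B \<and> p b = c" using surj that by (metis imageE)
    from someI_ex[OF this] show "l c \<in> carrier B" "p (l c) = c" by (simp_all add: l_def)
  qed
  have pure_eq: "q (?p b y) = q (?p b' y)"
    if "b \<in> carrier B" "b' \<in> carrier B" "p b = p b'" "y \<in> carrier N" for b b' y
  proof -
    note ph = pure_hom[OF B B N that(4)]
    have "p (b \<ominus>\<^bsub>B\<^esub> b') = \<zero>\<^bsub>C\<^esub>" using that hom_closed[OF p] by (simp add: hom_minus[OF B C p])
    moreover have "b \<ominus>\<^bsub>B\<^esub> b' \<in> carrier B" using that by simp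
    ultimately have "b \<ominus>\<^bsub>B\<^esub> b' \<in> a ` carrier A" using ker by blast
    then obtain x where x: "x \<in> carrier A" "a x = b \<ominus>\<^bsub>B\<^esub> b'" by (metis imageE)
    have "?p (b \<ominus>\<^bsub>B\<^esub> b') y = tensor_map R A B N a (pure_tensor R A N x y)"
      using x that by (simp add: tensor_map_pure[OF A B N a])
    then have "?p (b \<ominus>\<^bsub>B\<^esub> b') y \<in> ?K"
      using pure_closed[OF A N x(1) that(4)] by blast
    then have "q (?p (b \<ominus>\<^bsub>B\<^esub> b') y) = \<zero>\<^bsub>?Y\<^esub>"
      using qz pure_closed[OF B N _ that(4)] that by simp
    then have "q (?p b y) \<ominus>\<^bsub>?Y\<^esub> q (?p b' y) = \<zero>\<^bsub>?Y\<^esub>"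
      using that by (simp add: hom_minus[OF B BN ph] hom_minus[OF BN Y q] hom_closed[OF ph])
    then show ?thesis
      using that by (simp add: module_diff_eq_zero[OF Y] hom_closed[OF q] hom_closed[OF ph])
  qed
  have pl: "q (?p (l c) y) = q (?p b y)"
    if "b \<in> carrier B" "p b = c" "y \<in> carrier N" for b c y
    using that pure_eq[of "l c" b y] l[of c] hom_closed[OF p] by auto
  have "bilin R C N ?Y (\<lambda>c y. q (?p (l c) y))"
  proof (rule bilinI)
    fix y assume y: "y \<in> carrier N"
    note ph = hom_comp[OF pure_hom[OF B B N y] q]
    show "(\<lambda>c. q (?p (l c) y)) \<in> module_hom R C ?Y"
    proof (rule homI)
      fix c assume c: "c \<in> carrier C"
      then show "q (?p (l c) y) \<in> carrier ?Y" using hom_closed[OF ph] l by blast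
      fix r assume r: "r \<in> carrier R"
      show "q (?p (l (r \<odot>\<^bsub>C\<^esub> c)) y) = r \<odot>\<^bsub>?Y\<^esub> q (?p (l c) y)"
        using pl[of "r \<odot>\<^bsub>B\<^esub> l c" "r \<odot>\<^bsub>C\<^esub> c" y] l[OF c] r y by (simp add: hom_smult[OF p] hom_smult[OF ph])
    next
      fix c c' assume c: "c \<in> carrier C" "c' \<in> carrier C"
      show "q (?p (l (c \<oplus>\<^bsub>C\<^esub> c')) y) =
          q (?p (l c) y) \<oplus>\<^bsub>?Y\<^esub> q (?p (l c') y)"
        using pl[of "l c \<oplus>\<^bsub>B\<^esub> l c'" "c \<oplus>\<^bsub>C\<^esub> c'" y] l[OF c(1)] l[OF c(2)] y
        by (simp add: hom_add[OF p] hom_add[OF ph])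
    qed
  next
    fix c assume c: "c \<in> carrier C"
    show "(\<lambda>y. q (?p (l c) y)) \<in> module_hom R N ?Y"
      using bilin_pure[OF B N] l[OF c] by (intro hom_comp[OF _ q]) (simp add: bilin_def)
  qed
  from tensor_lift[OF C N Y this] obtain h where h: "h \<in> module_hom R ?CN ?Y"
    "\<And>c y. c \<in> carrier C \<Longrightarrow> y \<in> carrier N \<Longrightarrow> h (pure_tensor R C N c y) = q (?p (l c) y)"
    by blast
  have "h (tensor_map R B C N p t) = q t"
    by (rule tensor_hom_eqI[OF B N Y hom_comp[OF hom_tensor_map[OF B C N p] h(1)] q _ t])
      (simp add: tensor_map_pure[OF B C N p] h(2) pl hom_closed[OF p])
  then have "q t = \<zero>\<^bsub>?Y\<^esub>" using pt hom_zero[OF CN Y h(1)] by simp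
  then show ?thesis using qz t by simp
qed

section \<open>Projective modules via dual bases\<close>

lemma module_zero_closed: "module R A \<Longrightarrow> \<zero>\<^bsub>A\<^esub> \<in> carrier A"
  by (simp add: module_def abelian_group.axioms abelian_monoid.zero_closed)

lemma module_add_closed:
  assumes "module R A" "x \<in> carrier A" "y \<in> carrier A" shows "x \<oplus>\<^bsub>A\<^esub> y \<in> carrier A"
proof -
  interpret A: module R A by fact
  show ?thesis using assms(2,3) by simp
qed

lemma module_minus_zero:
  assumes "module R A" "x \<in> carrier A" shows "x \<ominus>\<^bsub>A\<^esub> \<zero>\<^bsub>A\<^esub> = x"
proof -
  interpret A: module R A by fact
  have "\<ominus>\<^bsub>A\<^esub> \<zero>\<^bsub>A\<^esub> = \<zero>\<^bsub>A\<^esub>" by (rule A.M.minus_equality) simp_all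
  then show ?thesis using assms(2) by (simp add: A.M.minus_eq)
qed

lemma module_smult_diff:
  assumes "module R A" "r \<in> carrier R" "x \<in> carrier A" "y \<in> carrier A"
  shows "r \<odot>\<^bsub>A\<^esub> (x \<ominus>\<^bsub>A\<^esub> y) = r \<odot>\<^bsub>A\<^esub> x \<ominus>\<^bsub>A\<^esub> r \<odot>\<^bsub>A\<^esub> y"
proof -
  interpret A: module R A by fact
  show ?thesis using assms(2-) by (simp add: A.M.minus_eq A.smult_r_distr A.smult_r_minus)
qed

text \<open>A presentation of \<open>P\<close> as a retract of the free module on a subset
  \<open>X\<close> of its own carrier, where \<open>\<iota>\<close> gives coordinates and a
  generator is sent to itself. It covers projective modules (\<open>X\<close> the whole carrier) and
  finitely generated free ones (\<open>X\<close> a basis) alike.\<close>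

definition dual_basis where
  "dual_basis R P X \<iota> \<longleftrightarrow> module R P \<and> X \<subseteq> carrier P \<and> \<iota> \<in> module_hom R P (free_module R X) \<and>
     (\<forall>p\<in>carrier P. free_lift R P X (\<lambda>x. x) (\<iota> p) = p)"

lemma projective_dual_basis:
  fixes P :: "('a, 'p) module"
  assumes "projective_module R P"
  obtains \<iota> where "dual_basis R P (carrier P) \<iota>"
proof -
  interpret P: module R P using assms by (simp add: projective_module_def)
  let ?F = "free_module R (carrier P)" and ?q = "free_lift R P (carrier P) (\<lambda>x. x)"
  have F: "module R ?F" by (rule module_free) (rule P.is_cring)
  have q: "?q \<in> module_hom R ?F P" by (rule hom_free_lift[OF P.module_axioms])
  have "?q ` carrier ?F = carrier P"
  proof
    show "?q ` carrier ?F \<subseteq> carrier P" using hom_closed[OF q] by blast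
    show "carrier P \<subseteq> ?q ` carrier ?F"
    proof
      fix x assume x: "x \<in> carrier P"
      have "?q (free_gen R (carrier P) x) = x" using x by (intro free_lift_gen[OF P.module_axioms]) auto
      then show "x \<in> ?q ` carrier ?F" using free_gen_closed[OF P.is_cring x] by (metis imageI)
    qed
  qed
  then obtain \<iota> where "\<iota> \<in> module_hom R P ?F" "\<forall>x\<in>carrier P. ?q (\<iota> x) = x"
    using assms F q hom_id[of R P] unfolding projective_module_def by blast
  then show thesis using that by (auto simp: dual_basis_def P.module_axioms)
qed

lemma hom_inv_into:
  assumes A: "module R A" and f: "f \<in> module_hom R A B" and bij: "bij_betw f (carrier A) (carrier B)"
  shows "inv_into (carrier A) f \<in> module_hom R B A"
proof -
  interpret A: module R A by (rule A)
  have img: "f ` carrier A = carrier B" and inj: "inj_on f (carrier A)"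
    using bij by (simp_all add: bij_betw_def)
  have g: "inv_into (carrier A) f y \<in> carrier A" "f (inv_into (carrier A) f y) = y" if "y \<in> carrier B" for y
    using that img by (auto intro: inv_into_into f_inv_into_f)
  have eq: "inv_into (carrier A) f y = x" if "x \<in> carrier A" "f x = y" for x y
    using inj that by (auto simp: inv_into_f_f)
  show ?thesis
  proof (rule homI)
    fix y assume y: "y \<in> carrier B"
    show "inv_into (carrier A) f y \<in> carrier A" by (rule g(1)[OF y])
    show "inv_into (carrier A) f (r \<odot>\<^bsub>B\<^esub> y) = r \<odot>\<^bsub>A\<^esub> inv_into (carrier A) f y" if r: "r \<in> carrier R" for r
      by (rule eq) (simp_all add: r g[OF y] hom_smult[OF f])
    show "inv_into (carrier A) f (y \<oplus>\<^bsub>B\<^esub> z) = inv_into (carrier A) f y \<oplus>\<^bsub>A\<^esub> inv_into (carrier A) f z"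
      if z: "z \<in> carrier B" for z
      by (rule eq) (simp_all add: g[OF y] g[OF z] hom_add[OF f])
  qed
qed

lemma fin_gen_free_dual_basis:
  fixes P :: "('a, 'p) module"
  assumes P: "module R P" and "fin_gen_free R P"
  obtains X \<iota> where "dual_basis R P X \<iota>"
proof -
  interpret P: module R P by (rule P)
  obtain B where B: "finite B" "B \<subseteq> carrier P" "\<not> P.lin_dep B" "P.span B = carrier P"
    using assms(2) by (auto simp: fin_gen_free_def)
  let ?F = "free_module R B" and ?q = "free_lift R P B (\<lambda>x. x)"
  have F: "module R ?F" by (rule module_free) (rule P.is_cring)
  have q: "?q \<in> module_hom R ?F P" by (rule hom_free_lift[OF P]) (use B(2) in blast)
  have lc: "?q f = P.lincomb f B" if "f \<in> carrier ?F" for f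
    unfolding free_lift_def P.lincomb_def
    by (rule dsum_lift_superset[OF module_ring_module[OF P.is_cring] P hom_scale_right[OF P]])
      (use B(1,2) that in \<open>auto simp: free_module_eq\<close>)
  have carr: "f \<in> carrier ?F \<longleftrightarrow> f \<in> B \<rightarrow>\<^sub>E carrier R" for f
    using B(1) by (simp add: free_module_def)
  have "inj_on ?q (carrier ?F)"
  proof (rule hom_injI[OF F P q])
    fix f assume f: "f \<in> carrier ?F" "?q f = \<zero>\<^bsub>P\<^esub>"
    have "P.lincomb f B = \<zero>\<^bsub>P\<^esub>" "f \<in> B \<rightarrow> carrier R" using f lc carr by auto
    then have "\<forall>v\<in>B. f v = \<zero>\<^bsub>R\<^esub>" using B unfolding P.lin_dep_def by blast
    then show "f = \<zero>\<^bsub>?F\<^esub>"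
      unfolding free_module_eq
      by (intro dsum_eqI[OF f(1)[unfolded free_module_eq] module_zero_closed[OF F[unfolded free_module_eq]]])
        (simp add: dsum_sel(2) ring_module_sel)
  qed
  moreover have "?q ` carrier ?F = carrier P"
  proof
    show "?q ` carrier ?F \<subseteq> carrier P" using hom_closed[OF q] by blast
    show "carrier P \<subseteq> ?q ` carrier ?F"
    proof
      fix p assume "p \<in> carrier P"
      then obtain a where a: "a \<in> B \<rightarrow> carrier R" "p = P.lincomb a B"
        using P.finite_span[OF B(1,2)] B(4) by auto
      have "restrict a B \<in> carrier ?F" using a(1) carr by auto
      moreover have "P.lincomb (restrict a B) B = P.lincomb a B"
        using a(1) B(2) by (intro P.lincomb_cong) auto
      ultimately show "p \<in> ?q ` carrier ?F" using lc a(2) by (metis imageI)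
    qed
  qed
  ultimately have bij: "bij_betw ?q (carrier ?F) (carrier P)" by (simp add: bij_betw_def)
  have "?q (inv_into (carrier ?F) ?q p) = p" if "p \<in> carrier P" for p
    by (rule bij_betw_inv_into_right[OF bij that])
  then show thesis
    using that[of B "inv_into (carrier ?F) ?q"] hom_inv_into[OF F q bij] P B(2) by (simp add: dual_basis_def)
qed

text \<open>Preimages are chosen on the generators in \<open>X\<close>. Only the image of
  \<open>g\<close> has to lie in that of \<open>q\<close>, so \<open>q\<close> may be a differential
  that is not onto.\<close>

lemma dual_basis_lift:
  assumes P: "dual_basis R P X \<iota>" and A: "module R A" and B: "module R B"
    and q: "q \<in> module_hom R A B" and g: "g \<in> module_hom R P B"
    and img: "g ` carrier P \<subseteq> q ` carrier A"
  obtains h where "h \<in> module_hom R P A" "\<And>p. p \<in> carrier P \<Longrightarrow> q (h p) = g p"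
proof -
  let ?q = "free_lift R P X (\<lambda>x. x)"
  have Pm: "module R P" and X: "X \<subseteq> carrier P" and \<iota>: "\<iota> \<in> module_hom R P (free_module R X)"
    and sec: "\<And>p. p \<in> carrier P \<Longrightarrow> ?q (\<iota> p) = p"
    using P by (auto simp: dual_basis_def)
  define l where "l = inv_into (carrier A) q"
  have l: "l (g x) \<in> carrier A" "q (l (g x)) = g x" if "x \<in> carrier P" for x
  proof -
    have "g x \<in> q ` carrier A" using img that by blast
    then show "l (g x) \<in> carrier A" "q (l (g x)) = g x"
      unfolding l_def by (rule inv_into_into, rule f_inv_into_f)
  qed
  let ?h = "free_lift R A X (\<lambda>x. l (g x))"
  have L: "?h \<in> module_hom R (free_module R X) A"
    by (rule hom_free_lift[OF A]) (use l X in blast)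
  have I: "?q \<in> module_hom R (free_module R X) P"
    by (rule hom_free_lift[OF Pm]) (use X in blast)
  have eq: "q (?h f) = g (?q f)"
    if "f \<in> carrier (free_module R X)" for f
  proof (rule free_hom_eqI[OF B hom_comp[OF L q] hom_comp[OF I g] _ that])
    fix s assume s: "s \<in> X"
    have "?h (free_gen R X s) = l (g s)"
      by (rule free_lift_gen[OF A _ s]) (use l X in blast)
    moreover have "?q (free_gen R X s) = s"
      by (rule free_lift_gen[OF Pm _ s]) (use X in blast)
    ultimately show "q (?h (free_gen R X s)) =
        g (?q (free_gen R X s))"
      using l s X by auto
  qed
  show thesis
  proof (rule that[OF hom_comp[OF \<iota> L]])
    fix p assume "p \<in> carrier P"
    then show "q (?h (\<iota> p)) = g p"
      using eq[OF hom_closed[OF \<iota>]] sec by simp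
  qed
qed

section \<open>Torsion-freeness of tensor products with projective modules\<close>

lemma dsum_torsion_free:
  assumes "module R Y" "torsion_free R Y" shows "torsion_free R (dsum Y X)"
  unfolding torsion_free_def
proof (intro ballI impI)
  fix r f assume r: "r \<in> carrier R" and f: "f \<in> carrier (dsum Y X)"
    and 0: "r \<odot>\<^bsub>dsum Y X\<^esub> f = \<zero>\<^bsub>dsum Y X\<^esub>"
  interpret D: module R "dsum Y X" by (rule module_dsum[OF assms(1)])
  have "r \<odot>\<^bsub>Y\<^esub> f x = \<zero>\<^bsub>Y\<^esub>" if "x \<in> X" for x
    using fun_cong[OF 0, of x] that by (simp add: dsum_sel)
  then have "r = \<zero>\<^bsub>R\<^esub> \<or> (\<forall>x\<in>X. f x = \<zero>\<^bsub>Y\<^esub>)"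
    using assms(2) r dsum_coord[OF f] by (fastforce simp: torsion_free_def)
  moreover have "f = \<zero>\<^bsub>dsum Y X\<^esub>" if "\<forall>x\<in>X. f x = \<zero>\<^bsub>Y\<^esub>"
    by (rule dsum_eqI[OF f D.M.zero_closed]) (use that in \<open>simp add: dsum_sel(2)\<close>)
  ultimately show "r = \<zero>\<^bsub>R\<^esub> \<or> f = \<zero>\<^bsub>dsum Y X\<^esub>" by blast
qed

lemma torsion_free_inj:
  assumes A: "module R A" and B: "module R B" and "torsion_free R B" and f: "f \<in> module_hom R A B"
    and inj: "\<And>x. x \<in> carrier A \<Longrightarrow> f x = \<zero>\<^bsub>B\<^esub> \<Longrightarrow> x = \<zero>\<^bsub>A\<^esub>"
  shows "torsion_free R A"
  unfolding torsion_free_def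
proof (intro ballI impI)
  fix r x assume r: "r \<in> carrier R" and x: "x \<in> carrier A" and 0: "r \<odot>\<^bsub>A\<^esub> x = \<zero>\<^bsub>A\<^esub>"
  have "r \<odot>\<^bsub>B\<^esub> f x = \<zero>\<^bsub>B\<^esub>"
    using r x 0 hom_smult[OF f] hom_zero[OF A B f] by metis
  then show "r = \<zero>\<^bsub>R\<^esub> \<or> x = \<zero>\<^bsub>A\<^esub>"
    using assms(3) r x inj hom_closed[OF f x] by (auto simp: torsion_free_def)
qed

text \<open>The tensor product is a retract of a direct sum of copies of \<open>N\<close>:
  \<open>c\<close> sends a pure tensor of p and n to the coordinates of p times n, and
  \<open>b\<close> sends n in the copy at x to the pure tensor of x and n. As \<open>b\<close> after
  \<open>c\<close> is the identity, \<open>c\<close> is injective and torsion-freeness is inherited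
  from \<open>N\<close>.\<close>

lemma tensor_dual_basis_torsion_free:
  assumes P: "dual_basis R P X \<iota>" and N: "module R N" "torsion_free R N"
  shows "torsion_free R (tensor_product R P N)"
proof -
  let ?q = "free_lift R P X (\<lambda>x. x)"
  have Pm: "module R P" and X: "X \<subseteq> carrier P" and \<iota>: "\<iota> \<in> module_hom R P (free_module R X)"
    and sec: "\<And>p. p \<in> carrier P \<Longrightarrow> ?q (\<iota> p) = p"
    using P by (auto simp: dual_basis_def)
  interpret P: module R P by (rule Pm)
  interpret N: module R N by (rule N)
  note R = P.is_cring
  let ?F = "free_module R X" and ?T = "tensor_product R P N"
  note T = module_tensor[OF Pm N(1)] and F = module_free[OF R]
  have I: "?q \<in> module_hom R ?F P"
    by (rule hom_free_lift[OF Pm]) (use X in blast)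
  have co: "(\<lambda>f. f x) \<in> module_hom R ?F (ring_module R)" if "x \<in> X" for x
    unfolding free_module_eq by (rule hom_dsum_coord[OF that])
  have cc: "f x \<in> carrier R" if "f \<in> carrier ?F" "x \<in> X" for f x
    using hom_closed[OF co[OF that(2)] that(1)] by (simp add: ring_module_sel)
  have fin: "finite {x \<in> X. f x \<odot>\<^bsub>N\<^esub> n \<noteq> \<zero>\<^bsub>N\<^esub>}" if "f \<in> carrier ?F" "n \<in> carrier N" for f n
    by (rule finite_subset[of _ "{x \<in> X. f x \<noteq> \<zero>\<^bsub>R\<^esub>}"]) (use that in \<open>auto simp: free_module_def\<close>)
  define \<gamma> where "\<gamma> f n = (\<lambda>x\<in>X. f x \<odot>\<^bsub>N\<^esub> n)" for f n
  have \<gamma>1: "(\<lambda>f. \<gamma> f n) \<in> module_hom R ?F (dsum N X)" if n: "n \<in> carrier N" for n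
    unfolding \<gamma>_def by (rule dsum_homI[OF N(1) hom_comp[OF co hom_scale_right[OF N(1) n]] fin[OF _ n]])
  have \<gamma>2: "\<gamma> f \<in> module_hom R N (dsum N X)" if f: "f \<in> carrier ?F" for f
    unfolding \<gamma>_def by (rule dsum_homI[OF N(1) hom_scale[OF N(1) hom_id] fin[OF f]]) (rule cc[OF f])
  have "bilin R P N (dsum N X) (\<lambda>p. \<gamma> (\<iota> p))"
    by (intro bilinI \<gamma>2 hom_closed[OF \<iota>] hom_comp[OF \<iota> \<gamma>1])
  from tensor_lift[OF Pm N(1) module_dsum[OF N(1)] this]
  obtain c where c: "c \<in> module_hom R ?T (dsum N X)"
    "\<And>p n. p \<in> carrier P \<Longrightarrow> n \<in> carrier N \<Longrightarrow> c (pure_tensor R P N p n) = \<gamma> (\<iota> p) n" by blast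
  have pr: "pure_tensor R P N x \<in> module_hom R N ?T" if "x \<in> X" for x
    using bilin_pure[OF Pm N(1)] that X by (auto simp: bilin_def)
  define b where "b = dsum_lift N ?T X (pure_tensor R P N)"
  have b: "b \<in> module_hom R (dsum N X) ?T"
    unfolding b_def by (rule hom_dsum_lift[OF N(1) T pr])
  have bc: "b (\<gamma> f n) = pure_tensor R P N (?q f) n"
    if "f \<in> carrier ?F" and n: "n \<in> carrier N" for f n
  proof (rule free_hom_eqI[OF T hom_comp[OF \<gamma>1[OF n] b] hom_comp[OF I pure_hom[OF Pm Pm N(1) n]] _ that(1)])
    fix s assume s: "s \<in> X"
    have "\<gamma> (free_gen R X s) n = dsingle N X s n"
      using n by (auto simp: \<gamma>_def free_gen_def dsingle_def fun_eq_iff)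
    moreover have "b (dsingle N X s n) = pure_tensor R P N s n"
      unfolding b_def by (rule dsum_lift_single[OF N(1) T pr s n])
    moreover have "?q (free_gen R X s) = s"
      by (rule free_lift_gen[OF Pm _ s]) (use X in blast)
    ultimately show "b (\<gamma> (free_gen R X s) n) = pure_tensor R P N (?q (free_gen R X s)) n"
      by simp
  qed
  have "b (c t) = t" if t: "t \<in> carrier ?T" for t
    by (rule tensor_hom_eqI[OF Pm N(1) T hom_comp[OF c(1) b] hom_id _ t])
      (simp add: c(2) bc hom_closed[OF \<iota>] sec)
  then show ?thesis
    by (intro torsion_free_inj[OF T module_dsum[OF N(1)] dsum_torsion_free[OF N] c(1)])
      (metis hom_zero[OF module_dsum[OF N(1)] T b])
qed

section \<open>One-dimensional Noetherian local domains\<close>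

text \<open>Zorn's lemma applies because in a Noetherian ring the union of a nonempty chain of
  ideals is itself a member of the chain.\<close>

lemma noetherian_maximal_member:
  assumes "noetherian_ring R" "\<I> \<noteq> {}" "\<I> \<subseteq> {I. ideal I R}"
  shows "\<exists>M\<in>\<I>. \<forall>X\<in>\<I>. M \<subseteq> X \<longrightarrow> X = M"
proof (rule subset_Zorn)
    fix C assume C: "subset.chain \<I> C"
    show "\<exists>U\<in>\<I>. \<forall>X\<in>C. X \<subseteq> U"
    proof (cases "C = {}")
      case True
      then show ?thesis using assms(2) by blast
    next
      case False
      have "subset.chain {I. ideal I R} C" using C assms(3) by (auto simp: subset_chain_def)
      then have "\<Union>C \<in> C" by (rule noetherian_ring.ideal_chain_is_trivial[OF assms(1) False])
      then show ?thesis using C by (auto simp: subset_chain_def)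
    qed
qed

lemma noetherian_proper_subset_maximal:
  assumes "noetherian_ring R" "ideal I R" "I \<noteq> carrier R"
  obtains M where "maximalideal M R" "I \<subseteq> M"
proof -
  let ?A = "{J. ideal J R \<and> I \<subseteq> J \<and> J \<noteq> carrier R}"
  have "?A \<noteq> {}" "?A \<subseteq> {I. ideal I R}" using assms(2,3) by blast+
  from noetherian_maximal_member[OF assms(1) this]
  obtain M where M': "M \<in> ?A" and max: "\<forall>J\<in>?A. M \<subseteq> J \<longrightarrow> J = M" by blast
  then have M: "ideal M R" "I \<subseteq> M" "M \<noteq> carrier R" by simp_all
  have "maximalideal M R"
  proof (rule maximalidealI[OF M(1)])
    show "carrier R \<noteq> M" using M(3) by simp
    fix J assume J: "ideal J R" "M \<subseteq> J" "J \<subseteq> carrier R"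
    show "J = M \<or> J = carrier R"
    proof (rule disjCI)
      assume "J \<noteq> carrier R"
      then have "J \<in> ?A" using J M(2) by simp
      then show "J = M" using max J(2) by simp
    qed
  qed
  then show thesis using that M(2) by blast
qed

lemma (in cring) ideal_of_closed:
  assumes "I \<subseteq> carrier R" "\<zero> \<in> I" "\<And>a b. a \<in> I \<Longrightarrow> b \<in> I \<Longrightarrow> a \<oplus> b \<in> I"
    and mult: "\<And>r a. r \<in> carrier R \<Longrightarrow> a \<in> I \<Longrightarrow> r \<otimes> a \<in> I"
  shows "ideal I R"
proof (rule idealI[OF ring_axioms])
  show "subgroup I (add_monoid R)"
  proof (rule add.subgroupI)
    show "\<ominus> a \<in> I" if "a \<in> I" for a
      using mult[of "\<ominus> \<one>" a] that assms(1) by (auto simp: l_minus subset_iff)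
  qed (use assms in auto)
  fix a x assume "a \<in> I" "x \<in> carrier R"
  then show "x \<otimes> a \<in> I" "a \<otimes> x \<in> I" using mult[of x a] assms(1) m_comm[of a x] by auto
qed

text \<open>The form in which locality and Krull dimension one are used. That \<open>\<mm>\<close>
  is the only maximal ideal is recovered in \<open>maximal_unique\<close>.\<close>

locale dim_one_local = domain R + noetherian_ring R for R (structure) +
  fixes \<mm>
  assumes maximal: "maximalideal \<mm> R"
    and nonzero: "\<mm> \<noteq> {\<zero>}"
    and prime_cases: "primeideal \<pp> R \<Longrightarrow> \<pp> = {\<zero>} \<or> \<pp> = \<mm>"

lemma (in domain) krull_dim_one_local:
  assumes "noetherian_ring R" "local_ring R" "krull_dim R = 1"
  obtains \<mm> where "dim_one_local R \<mm>"
proof -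
  obtain \<mm> where \<mm>: "maximalideal \<mm> R" and uniq: "\<And>\<nn>. maximalideal \<nn> R \<Longrightarrow> \<nn> = \<mm>"
    using assms(2) unfolding local_ring_def by blast
  define ch where "ch n \<pp> \<longleftrightarrow> (\<forall>i\<le>n. primeideal (\<pp> i) R) \<and> (\<forall>i<n. \<pp> i \<subset> \<pp> (Suc i))"
    for n :: nat and \<pp> :: "nat \<Rightarrow> 'a set"
  let ?S = "{enat n | n. \<exists>\<pp>. ch n \<pp>}"
  have sup: "Sup ?S = 1" using assms(3) by (simp add: krull_dim_def ch_def)
  have long: "n \<le> 1" if "ch n \<pp>" for n \<pp>
  proof -
    have "enat n \<le> Sup ?S" by (rule Sup_upper) (use that in blast)
    then show ?thesis unfolding sup by (simp add: one_enat_def)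
  qed
  have zero_sub: "\<zero> \<in> \<pp>" if "primeideal \<pp> R" for \<pp>
    using that by (simp add: primeideal_def ideal.axioms(1) additive_subgroup.zero_closed)
  have sub: "\<pp> \<subseteq> \<mm>" if p: "primeideal \<pp> R" for \<pp>
  proof -
    have "\<pp> \<noteq> carrier R" using p by (metis primeideal.I_notcarr)
    then show ?thesis
      using noetherian_proper_subset_maximal[OF assms(1) _ , of \<pp>] p uniq
      by (metis primeideal_def)
  qed
  have mprime: "primeideal \<mm> R" by (rule maximalideal_prime[OF \<mm>])
  have cases: "\<pp> = {\<zero>} \<or> \<pp> = \<mm>" if p: "primeideal \<pp> R" for \<pp>
  proof (rule ccontr)
    assume "\<not> ?thesis"
    then have "{\<zero>} \<subset> \<pp>" "\<pp> \<subset> \<mm>" using zero_sub[OF p] sub[OF p] by auto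
    \<comment> \<open>A prime strictly between zero and \<open>\<mm>\<close> would give a chain of
      length two.\<close>
    then have "ch 2 (\<lambda>i. if i = 0 then {\<zero>} else if i = 1 then \<pp> else \<mm>)"
      using p zeroprimeideal mprime by (auto simp: ch_def less_2_cases_iff)
    from long[OF this] show False by simp
  qed
  have "\<mm> \<noteq> {\<zero>}"
  proof
    assume z: "\<mm> = {\<zero>}"
    \<comment> \<open>If \<open>\<mm>\<close> is zero then so is every prime, no strict inclusion
      exists, and the dimension would be 0.\<close>
    have "s \<le> 0" if s_mem: "s \<in> ?S" for s
    proof -
      obtain n \<pp> where s: "s = enat n" and ch: "ch n \<pp>" using s_mem by blast
      have "n = 0"
      proof (rule ccontr)
        assume "n \<noteq> 0"
        then have "\<pp> 0 \<subset> \<pp> (Suc 0)" "primeideal (\<pp> 0) R" "primeideal (\<pp> (Suc 0)) R"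
          using ch by (auto simp: ch_def)
        then show False using sub zero_sub z by blast
      qed
      then show ?thesis using s by (simp add: zero_enat_def)
    qed
    then have "Sup ?S \<le> 0" by (rule Sup_least)
    then show False unfolding sup by simp
  qed
  then show thesis
    using that[of \<mm>] cases \<mm> assms(1) domain_axioms
    by (simp add: dim_one_local_def dim_one_local_axioms_def)
qed

context dim_one_local
begin

lemma m_ideal: "ideal \<mm> R" using maximal by (rule maximalideal.axioms)

lemma m_closed_R: "a \<in> \<mm> \<Longrightarrow> a \<in> carrier R"
  using m_ideal by (meson additive_subgroup.a_Hcarr ideal.axioms(1))

lemma one_notin_m: "\<one> \<notin> \<mm>"
  using maximal m_ideal ideal.one_imp_carrier maximalideal.I_notcarr by metis

lemma maximal_unique:
  assumes "maximalideal M R" shows "M = \<mm>"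
proof -
  have "M \<noteq> {\<zero>}"
  proof
    assume z: "M = {\<zero>}"
    have "\<zero> \<in> \<mm>" using m_ideal by (simp add: additive_subgroup.zero_closed ideal.axioms(1))
    then have "M \<subseteq> \<mm>" using z by simp
    then have "\<mm> = M \<or> \<mm> = carrier R"
      using maximalideal.I_maximal[OF assms m_ideal] m_closed_R by blast
    then show False using z nonzero maximalideal.I_notcarr[OF maximal] by blast
  qed
  then show ?thesis using prime_cases[OF maximalideal_prime[OF assms]] by blast
qed

lemma unit_or_m:
  assumes r: "r \<in> carrier R" "r \<notin> \<mm>"
  obtains r' where "r' \<in> carrier R" "r' \<otimes> r = \<one>"
proof -
  have "PIdl r = carrier R"
  proof (rule ccontr)
    assume "PIdl r \<noteq> carrier R"
    then obtain M where "maximalideal M R" "PIdl r \<subseteq> M"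
      using noetherian_proper_subset_maximal[OF noetherian_ring_axioms cgenideal_ideal[OF r(1)]] by blast
    then show False using maximal_unique cgenideal_self[OF r(1)] r(2) by blast
  qed
  then have "\<one> \<in> PIdl r" by simp
  then show thesis using that unfolding cgenideal_def by auto
qed

text \<open>An annihilator that is maximal among those of nonzero elements of R/I is a prime ideal.
  It contains the nonzero ideal \<open>I\<close>, so it can only be \<open>\<mm>\<close>; thus the
  class of \<open>s\<close> spans a copy of the residue field in R/I.\<close>

lemma socle_element:
  assumes I: "ideal I R" "I \<noteq> carrier R" "I \<noteq> {\<zero>}"
  obtains s where "s \<in> carrier R" "s \<notin> I" "\<And>a. a \<in> \<mm> \<Longrightarrow> a \<otimes> s \<in> I"
proof -
  interpret I: ideal I R by (rule I(1))
  \<comment> \<open>\<open>co s\<close> is the annihilator of the class of \<open>s\<close> in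
    R/I.\<close>
  define co where "co s = {r \<in> carrier R. r \<otimes> s \<in> I}" for s
  have co: "ideal (co s) R" if s: "s \<in> carrier R" for s
  proof (rule ideal_of_closed)
    show "co s \<subseteq> carrier R" "\<zero> \<in> co s" using s I.zero_closed by (auto simp: co_def)
    show "a \<oplus> b \<in> co s" if "a \<in> co s" "b \<in> co s" for a b
      using that s by (simp add: co_def l_distr I.a_closed)
    show "x \<otimes> a \<in> co s" if "x \<in> carrier R" "a \<in> co s" for a x
      using that s I.I_l_closed[of "a \<otimes> s" x] by (simp add: co_def m_assoc)
  qed
  have ne: "co ` (carrier R - I) \<noteq> {}" using I(2) I.a_subset by blast
  have ids: "co ` (carrier R - I) \<subseteq> {I. ideal I R}" using co by blast
  from noetherian_maximal_member[OF noetherian_ring_axioms ne ids]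
  obtain J where "J \<in> co ` (carrier R - I)"
    and max: "\<forall>K\<in>co ` (carrier R - I). J \<subseteq> K \<longrightarrow> K = J" by blast
  then obtain s where s: "s \<in> carrier R" "s \<notin> I" and J: "J = co s" by blast
  have "primeideal J R"
  proof (rule primeidealI)
    show "ideal J R" "cring R" using co s J by (auto simp: is_cring)
    have "\<one> \<notin> J" using s by (simp add: J co_def)
    then show "carrier R \<noteq> J" by blast
    fix a b assume a: "a \<in> carrier R" and b: "b \<in> carrier R" and ab: "a \<otimes> b \<in> J"
    show "a \<in> J \<or> b \<in> J"
    proof (rule disjCI)
      assume "b \<notin> J"
      then have bs: "b \<otimes> s \<in> carrier R - I" using b s by (auto simp: J co_def)
      \<comment> \<open>The class of \<open>b \<otimes> s\<close> is nonzero and its annihilator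
        contains that of \<open>s\<close>, so by maximality the two agree.\<close>
      have "J \<subseteq> co (b \<otimes> s)"
      proof
        fix r assume r: "r \<in> J"
        then have "b \<otimes> (r \<otimes> s) \<in> I" using b by (simp add: J co_def I.I_l_closed)
        then show "r \<in> co (b \<otimes> s)" using r b s by (simp add: J co_def m_lcomm)
      qed
      then have "co (b \<otimes> s) = J" using max bs by blast
      moreover have "a \<in> co (b \<otimes> s)" using ab a b s by (simp add: J co_def m_assoc)
      ultimately show "a \<in> J" by simp
    qed
  qed
  moreover have "J \<noteq> {\<zero>}"
  proof -
    obtain i where i: "i \<in> I" "i \<noteq> \<zero>" using I(3) I.zero_closed by blast
    then have "i \<in> J" using s I.I_r_closed[of i s] I.a_Hcarr by (simp add: J co_def)
    then show ?thesis using i by blast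
  qed
  ultimately have "J = \<mm>" using prime_cases by blast
  then show thesis using that s by (auto simp: J co_def)
qed

end

text \<open>Graphs of partial homomorphisms; unlike partial functions they form chains under inclusion
  to which Zorn's lemma applies directly.\<close>

definition linrel where
  "linrel R B Y G \<longleftrightarrow> G \<subseteq> carrier B \<times> carrier Y \<and> (\<zero>\<^bsub>B\<^esub>, \<zero>\<^bsub>Y\<^esub>) \<in> G \<and>
     (\<forall>b y b' y'. (b, y) \<in> G \<longrightarrow> (b', y') \<in> G \<longrightarrow> (b \<oplus>\<^bsub>B\<^esub> b', y \<oplus>\<^bsub>Y\<^esub> y') \<in> G) \<and>
     (\<forall>r b y. r \<in> carrier R \<longrightarrow> (b, y) \<in> G \<longrightarrow> (r \<odot>\<^bsub>B\<^esub> b, r \<odot>\<^bsub>Y\<^esub> y) \<in> G)"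

lemma linrelD:
  assumes "linrel R B Y G"
  shows "(b, y) \<in> G \<Longrightarrow> b \<in> carrier B" "(b, y) \<in> G \<Longrightarrow> y \<in> carrier Y" "(\<zero>\<^bsub>B\<^esub>, \<zero>\<^bsub>Y\<^esub>) \<in> G"
    "(b, y) \<in> G \<Longrightarrow> (b', y') \<in> G \<Longrightarrow> (b \<oplus>\<^bsub>B\<^esub> b', y \<oplus>\<^bsub>Y\<^esub> y') \<in> G"
    "r \<in> carrier R \<Longrightarrow> (b, y) \<in> G \<Longrightarrow> (r \<odot>\<^bsub>B\<^esub> b, r \<odot>\<^bsub>Y\<^esub> y) \<in> G"
  using assms unfolding linrel_def by blast+

text \<open>The side condition is phrased as containment in a fixed set \<open>U\<close> because
  containment survives unions of chains. One use takes single-valuedness at zero for it, another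
  additionally demands that the relation be part of a section.\<close>

lemma linrel_maximal:
  assumes "linrel R B Y G0" "G0 \<subseteq> U"
  obtains G where "linrel R B Y G" "G0 \<subseteq> G" "G \<subseteq> U"
    "\<And>G'. linrel R B Y G' \<Longrightarrow> G \<subseteq> G' \<Longrightarrow> G' \<subseteq> U \<Longrightarrow> G' = G"
proof -
  let ?A = "{G. linrel R B Y G \<and> G0 \<subseteq> G \<and> G \<subseteq> U}"
  have "\<exists>G\<in>?A. \<forall>X\<in>?A. G \<subseteq> X \<longrightarrow> X = G"
  proof (rule subset_Zorn_nonempty)
    show "?A \<noteq> {}" using assms by blast
    fix C assume ne: "C \<noteq> {}" and ch: "subset.chain ?A C"
    then have mem: "G \<in> C \<Longrightarrow> linrel R B Y G \<and> G0 \<subseteq> G \<and> G \<subseteq> U" for G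
      by (auto simp: subset_chain_def)
    have "linrel R B Y (\<Union>C)"
      unfolding linrel_def
    proof (intro conjI allI impI)
      show "\<Union>C \<subseteq> carrier B \<times> carrier Y" using mem unfolding linrel_def by blast
      show "(\<zero>\<^bsub>B\<^esub>, \<zero>\<^bsub>Y\<^esub>) \<in> \<Union>C" using ne mem linrelD(3) by blast
      show "(r \<odot>\<^bsub>B\<^esub> b, r \<odot>\<^bsub>Y\<^esub> y) \<in> \<Union>C" if "r \<in> carrier R" "(b, y) \<in> \<Union>C" for r b y
        using that mem linrelD(5) by (meson UnionE UnionI)
      fix b y b' y' assume "(b, y) \<in> \<Union>C" "(b', y') \<in> \<Union>C"
      then obtain G G' where G: "G \<in> C" "(b, y) \<in> G" "G' \<in> C" "(b', y') \<in> G'" by blast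
      then have "G \<subseteq> G' \<or> G' \<subseteq> G" using ch by (auto simp: subset_chain_def)
      then show "(b \<oplus>\<^bsub>B\<^esub> b', y \<oplus>\<^bsub>Y\<^esub> y') \<in> \<Union>C"
        using G mem linrelD(4) by (meson UnionI subsetD)
    qed
    then show "\<Union>C \<in> ?A" using mem ne by blast
  qed
  then obtain G where G: "linrel R B Y G" "G0 \<subseteq> G" "G \<subseteq> U" "\<forall>X\<in>?A. G \<subseteq> X \<longrightarrow> X = G" by blast
  have "G' = G" if "linrel R B Y G'" "G \<subseteq> G'" "G' \<subseteq> U" for G'
    using G that by blast
  then show thesis using that G(1-3) by blast
qed

text \<open>For a linear relation \<open>G\<close>, the submodule of the product of \<open>B\<close>
  and \<open>Y\<close> generated by \<open>G\<close> and the pair (\<open>b\<close>,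
  \<open>y\<close>).\<close>

definition linrel_extend where
  "linrel_extend R B Y G b y = {(c \<oplus>\<^bsub>B\<^esub> r \<odot>\<^bsub>B\<^esub> b, z \<oplus>\<^bsub>Y\<^esub> r \<odot>\<^bsub>Y\<^esub> y) | c z r. (c, z) \<in> G \<and> r \<in> carrier R}"

lemma
  assumes B: "module R B" and Y: "module R Y" and G: "linrel R B Y G"
    and b: "b \<in> carrier B" and y: "y \<in> carrier Y"
  shows linrel_linrel_extend: "linrel R B Y (linrel_extend R B Y G b y)"
    and linrel_extend_superset: "G \<subseteq> linrel_extend R B Y G b y"
    and linrel_extend_mem: "(b, y) \<in> linrel_extend R B Y G b y"
proof -
  let ?E = "linrel_extend R B Y G b y"
  interpret B: module R B by (rule B)
  interpret Y: module R Y by (rule Y)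
  note Gd = linrelD[OF G]
  have I: "(c, z) \<in> G \<Longrightarrow> r \<in> carrier R \<Longrightarrow> u = c \<oplus>\<^bsub>B\<^esub> r \<odot>\<^bsub>B\<^esub> b \<Longrightarrow> v = z \<oplus>\<^bsub>Y\<^esub> r \<odot>\<^bsub>Y\<^esub> y \<Longrightarrow>
      (u, v) \<in> ?E" for c z r u v
    unfolding linrel_extend_def by blast
  show sup: "G \<subseteq> ?E"
  proof safe
    fix c z assume cz: "(c, z) \<in> G"
    show "(c, z) \<in> ?E"
      by (rule I[OF cz B.R.zero_closed]) (simp_all add: b y Gd(1)[OF cz] Gd(2)[OF cz])
  qed
  show "(b, y) \<in> ?E"
    by (rule I[OF Gd(3) B.R.one_closed]) (simp_all add: b y)
  show "linrel R B Y ?E"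
    unfolding linrel_def
  proof (intro conjI allI impI)
    show "?E \<subseteq> carrier B \<times> carrier Y"
      unfolding linrel_extend_def using Gd(1,2) b y by blast
    show "(\<zero>\<^bsub>B\<^esub>, \<zero>\<^bsub>Y\<^esub>) \<in> ?E" using sup Gd(3) by blast
  next
    fix u v u' v' assume "(u, v) \<in> ?E" "(u', v') \<in> ?E"
    then obtain c z r c' z' r' where *: "(c, z) \<in> G" "r \<in> carrier R" "(c', z') \<in> G" "r' \<in> carrier R"
      "u = c \<oplus>\<^bsub>B\<^esub> r \<odot>\<^bsub>B\<^esub> b" "v = z \<oplus>\<^bsub>Y\<^esub> r \<odot>\<^bsub>Y\<^esub> y" "u' = c' \<oplus>\<^bsub>B\<^esub> r' \<odot>\<^bsub>B\<^esub> b" "v' = z' \<oplus>\<^bsub>Y\<^esub> r' \<odot>\<^bsub>Y\<^esub> y"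
      unfolding linrel_extend_def by blast
    note cl = Gd(1)[OF *(1)] Gd(2)[OF *(1)] Gd(1)[OF *(3)] Gd(2)[OF *(3)] b y *(2,4)
    show "(u \<oplus>\<^bsub>B\<^esub> u', v \<oplus>\<^bsub>Y\<^esub> v') \<in> ?E"
      by (rule I[OF Gd(4)[OF *(1,3)] B.R.a_closed[OF *(2,4)]])
        (simp_all add: * cl B.smult_l_distr Y.smult_l_distr B.M.a_ac Y.M.a_ac)
  next
    fix s u v assume s: "s \<in> carrier R" and "(u, v) \<in> ?E"
    then obtain c z r where *: "(c, z) \<in> G" "r \<in> carrier R"
      "u = c \<oplus>\<^bsub>B\<^esub> r \<odot>\<^bsub>B\<^esub> b" "v = z \<oplus>\<^bsub>Y\<^esub> r \<odot>\<^bsub>Y\<^esub> y"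
      unfolding linrel_extend_def by blast
    note cl = Gd(1)[OF *(1)] Gd(2)[OF *(1)] b y *(2) s
    show "(s \<odot>\<^bsub>B\<^esub> u, s \<odot>\<^bsub>Y\<^esub> v) \<in> ?E"
      by (rule I[OF Gd(5)[OF s *(1)] B.R.m_closed[OF s *(2)]])
        (simp_all add: * cl B.smult_r_distr Y.smult_r_distr B.smult_assoc1 Y.smult_assoc1)
  qed
qed

lemma linrel_image:
  assumes A: "module R A" and B: "module R B" and Y: "module R Y"
    and a: "a \<in> module_hom R A B" and f: "f \<in> module_hom R A Y"
  shows "linrel R B Y {(a x, f x) | x. x \<in> carrier A}"
proof -
  let ?G = "{(a x, f x) | x. x \<in> carrier A}"
  interpret A: module R A by (rule A)
  have I: "x \<in> carrier A \<Longrightarrow> u = a x \<Longrightarrow> v = f x \<Longrightarrow> (u, v) \<in> ?G" for x u v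
    by blast
  show ?thesis
    unfolding linrel_def
  proof (intro conjI allI impI)
    show "?G \<subseteq> carrier B \<times> carrier Y"
      using hom_closed[OF a] hom_closed[OF f] by blast
    show "(\<zero>\<^bsub>B\<^esub>, \<zero>\<^bsub>Y\<^esub>) \<in> ?G"
      by (rule I[OF A.M.zero_closed]) (simp_all add: hom_zero[OF A B a] hom_zero[OF A Y f])
    fix b y b' y' assume "(b, y) \<in> ?G" "(b', y') \<in> ?G"
    then obtain x x' where *: "x \<in> carrier A" "x' \<in> carrier A" "b = a x" "y = f x" "b' = a x'" "y' = f x'"
      by blast
    show "(b \<oplus>\<^bsub>B\<^esub> b', y \<oplus>\<^bsub>Y\<^esub> y') \<in> ?G"
      by (rule I[OF A.M.a_closed[OF *(1,2)]]) (simp_all add: * hom_add[OF a] hom_add[OF f])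
  next
    fix r b y assume r: "r \<in> carrier R" and "(b, y) \<in> ?G"
    then obtain x where *: "x \<in> carrier A" "b = a x" "y = f x" by blast
    show "(r \<odot>\<^bsub>B\<^esub> b, r \<odot>\<^bsub>Y\<^esub> y) \<in> ?G"
      by (rule I[OF A.smult_closed[OF r *(1)]]) (simp_all add: * r hom_smult[OF a] hom_smult[OF f])
  qed
qed

lemma linrel_minus:
  assumes B: "module R B" and Y: "module R Y" and G: "linrel R B Y G" and "(b, y) \<in> G" "(b', y') \<in> G"
  shows "(b \<ominus>\<^bsub>B\<^esub> b', y \<ominus>\<^bsub>Y\<^esub> y') \<in> G"
proof -
  interpret B: module R B by (rule B)
  interpret Y: module R Y by (rule Y)
  note Gd = linrelD[OF G]
  have "(b \<oplus>\<^bsub>B\<^esub> (\<ominus>\<^bsub>R\<^esub> \<one>\<^bsub>R\<^esub>) \<odot>\<^bsub>B\<^esub> b', y \<oplus>\<^bsub>Y\<^esub> (\<ominus>\<^bsub>R\<^esub> \<one>\<^bsub>R\<^esub>) \<odot>\<^bsub>Y\<^esub> y') \<in> G"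
    using assms(4,5) by (intro Gd(4,5)) auto
  then show ?thesis
    using Gd(1,2) assms(5) by (simp add: a_minus_def B.smult_l_minus Y.smult_l_minus)
qed

text \<open>Linearity turns two values at \<open>b\<close> into a value at zero, namely their
  difference. This is why \<open>U\<close> only has to restrict the values at zero.\<close>

lemma linrel_functional:
  assumes B: "module R B" and Y: "module R Y" and G: "linrel R B Y G"
    and 0: "\<And>y. (\<zero>\<^bsub>B\<^esub>, y) \<in> G \<Longrightarrow> y = \<zero>\<^bsub>Y\<^esub>" and "(b, y) \<in> G" "(b, y') \<in> G"
  shows "y = y'"
proof -
  interpret B: module R B by (rule B)
  have "(\<zero>\<^bsub>B\<^esub>, y \<ominus>\<^bsub>Y\<^esub> y') \<in> G"
    using linrel_minus[OF B Y G assms(5,6)] linrelD(1)[OF G assms(5)] by (simp add: B.M.r_neg a_minus_def)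
  then show ?thesis
    using 0 module_diff_eq_zero[OF Y] linrelD(2)[OF G] assms(5,6) by blast
qed

section \<open>Extension of homomorphisms\<close>

context dim_one_local
begin

text \<open>The vanishing of Ext^1(R/\<open>\<mm>\<close>, Y): a homomorphism from
  \<open>\<mm>\<close> to \<open>Y\<close> extends to the ring exactly if it is multiplication into
  some element \<open>y\<close>, the image of one.\<close>

definition m_extension :: "('a, 'y, 'z) module_scheme \<Rightarrow> bool" where
  "m_extension Y \<longleftrightarrow> (\<forall>f \<in> module_hom R (ring_module R\<lparr>carrier := \<mm>\<rparr>) Y.
     \<exists>y\<in>carrier Y. \<forall>a\<in>\<mm>. f a = a \<odot>\<^bsub>Y\<^esub> y)"

lemma m_extensionD:
  assumes "m_extension Y"
    and "\<And>a. a \<in> \<mm> \<Longrightarrow> f a \<in> carrier Y"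
    and "\<And>a b. a \<in> \<mm> \<Longrightarrow> b \<in> \<mm> \<Longrightarrow> f (a \<oplus> b) = f a \<oplus>\<^bsub>Y\<^esub> f b"
    and "\<And>r a. r \<in> carrier R \<Longrightarrow> a \<in> \<mm> \<Longrightarrow> f (r \<otimes> a) = r \<odot>\<^bsub>Y\<^esub> f a"
  obtains y where "y \<in> carrier Y" "\<And>a. a \<in> \<mm> \<Longrightarrow> f a = a \<odot>\<^bsub>Y\<^esub> y"
proof -
  have "f \<in> module_hom R (ring_module R\<lparr>carrier := \<mm>\<rparr>) Y"
    by (rule homI) (simp_all add: assms ring_module_def)
  then show thesis using assms(1) that unfolding m_extension_def by blast
qed

text \<open>Baer's criterion, tested on \<open>\<mm>\<close> alone. Let \<open>b\<close> lie outside
  the domain of a maximal single-valued relation, and let \<open>I\<close> consist of the scalars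
  that bring \<open>b\<close> into this domain. If \<open>I\<close> is zero, any value for
  \<open>b\<close> is consistent. Otherwise a socle element \<open>s\<close> of R/I yields the
  multiple \<open>s\<close> times \<open>b\<close>, which is brought into the domain exactly by
  \<open>\<mm>\<close>, and the hypothesis supplies a value for it.\<close>

lemma m_extension_linrel_extension:
  fixes B :: "('a, 'v) module" and Y :: "('a, 'y) module"
  assumes B: "module R B" and Y: "module R Y" and ext: "m_extension Y"
    and G0: "linrel R B Y G0" and G00: "\<And>y. (\<zero>\<^bsub>B\<^esub>, y) \<in> G0 \<Longrightarrow> y = \<zero>\<^bsub>Y\<^esub>"
  obtains g where "g \<in> module_hom R B Y" "\<And>b y. (b, y) \<in> G0 \<Longrightarrow> g b = y"
proof -
  interpret B: module R B by (rule B)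
  interpret Y: module R Y by (rule Y)
  let ?U = "{(b, y). b = \<zero>\<^bsub>B\<^esub> \<longrightarrow> y = \<zero>\<^bsub>Y\<^esub>}"
  have "G0 \<subseteq> ?U" using G00 by blast
  from linrel_maximal[OF G0 this]
  obtain G where G: "linrel R B Y G" "G0 \<subseteq> G" "G \<subseteq> ?U"
    and max: "\<And>G'. linrel R B Y G' \<Longrightarrow> G \<subseteq> G' \<Longrightarrow> G' \<subseteq> ?U \<Longrightarrow> G' = G" by metis
  note Gd = linrelD[OF G(1)]
  have Gz: "y = \<zero>\<^bsub>Y\<^esub>" if "(\<zero>\<^bsub>B\<^esub>, y) \<in> G" for y using that G(3) by blast
  have fn: "y = y'" if "(b, y) \<in> G" "(b, y') \<in> G" for b y y'
    by (rule linrel_functional[OF B Y G(1) Gz that])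
  have dom: "\<exists>y. (b, y) \<in> G" if b: "b \<in> carrier B" for b
  proof (rule ccontr)
    assume nb: "\<not> ?thesis"
    define I where "I = {r \<in> carrier R. \<exists>y. (r \<odot>\<^bsub>B\<^esub> b, y) \<in> G}"
    have I: "ideal I R"
    proof (rule ideal_of_closed)
      show "I \<subseteq> carrier R" "\<zero> \<in> I" using Gd(3) b by (auto simp: I_def)
      show "a \<oplus> a' \<in> I" if "a \<in> I" "a' \<in> I" for a a'
        using that Gd(4) b unfolding I_def by (fastforce simp: B.smult_l_distr)
      show "x \<otimes> a \<in> I" if "x \<in> carrier R" "a \<in> I" for x a
        using that Gd(5)[OF that(1)] b by (fastforce simp: I_def B.smult_assoc1)
    qed
    have "\<one> \<notin> I" using nb b by (simp add: I_def)
    then have I1: "I \<noteq> carrier R" by blast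
    have "\<exists>b'\<in>carrier B. \<exists>y\<in>carrier Y. (\<nexists>z. (b', z) \<in> G) \<and>
        (\<forall>r\<in>carrier R. \<forall>z. (r \<odot>\<^bsub>B\<^esub> b', z) \<in> G \<longrightarrow> z = r \<odot>\<^bsub>Y\<^esub> y)"
    proof (cases "I = {\<zero>}")
      case True
      \<comment> \<open>Only the zero multiple of \<open>b\<close> lies in the domain, so zero is an
        admissible value for \<open>b\<close>.\<close>
      have "z = r \<odot>\<^bsub>Y\<^esub> \<zero>\<^bsub>Y\<^esub>" if "r \<in> carrier R" "(r \<odot>\<^bsub>B\<^esub> b, z) \<in> G" for r z
      proof -
        have "r \<in> I" using that by (auto simp: I_def)
        then have r: "r = \<zero>" using True by simp
        then have "z = \<zero>\<^bsub>Y\<^esub>" using that b by (intro Gz) simp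
        then show ?thesis using r by simp
      qed
      then show ?thesis using b nb Y.M.zero_closed by blast
    next
      case False
      obtain s where s: "s \<in> carrier R" "s \<notin> I" and ms: "\<And>a. a \<in> \<mm> \<Longrightarrow> a \<otimes> s \<in> I"
        using socle_element[OF I I1 False] by blast
      let ?b = "s \<odot>\<^bsub>B\<^esub> b"
      have b': "?b \<in> carrier B" using s b by simp
      have nb': "\<nexists>z. (?b, z) \<in> G" using s by (auto simp: I_def)
      define f where "f a = (SOME y. (a \<odot>\<^bsub>B\<^esub> ?b, y) \<in> G)" for a
      have f: "(a \<odot>\<^bsub>B\<^esub> ?b, f a) \<in> G" if a: "a \<in> \<mm>" for a
      proof -
        have "\<exists>y. (a \<odot>\<^bsub>B\<^esub> ?b, y) \<in> G"
          using ms[OF a] b s m_closed_R[OF a] by (auto simp: I_def B.smult_assoc1)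
        then show ?thesis unfolding f_def by (rule someI_ex)
      qed
      interpret mi: ideal \<mm> R by (rule m_ideal)
      obtain y where y: "y \<in> carrier Y" "\<And>a. a \<in> \<mm> \<Longrightarrow> f a = a \<odot>\<^bsub>Y\<^esub> y"
      proof (rule m_extensionD[OF ext])
        show "f a \<in> carrier Y" if "a \<in> \<mm>" for a using Gd(2)[OF f[OF that]] .
        show "f (a \<oplus> a') = f a \<oplus>\<^bsub>Y\<^esub> f a'" if "a \<in> \<mm>" "a' \<in> \<mm>" for a a'
          using f[OF mi.a_closed[OF that]] Gd(4)[OF f[OF that(1)] f[OF that(2)]] b' m_closed_R that
          by (intro fn) (auto simp: B.smult_l_distr)
        show "f (r \<otimes> a) = r \<odot>\<^bsub>Y\<^esub> f a" if "r \<in> carrier R" "a \<in> \<mm>" for r a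
          using f[OF mi.I_l_closed[OF that(2,1)]] Gd(5)[OF that(1) f[OF that(2)]] b' m_closed_R that
          by (intro fn) (auto simp: B.smult_assoc1)
      qed blast
      have "z = r \<odot>\<^bsub>Y\<^esub> y" if r: "r \<in> carrier R" and z: "(r \<odot>\<^bsub>B\<^esub> ?b, z) \<in> G" for r z
      proof (cases "r \<in> \<mm>")
        case True
        then show ?thesis using fn[OF z f[OF True]] y(2) by simp
      next
        case False
        \<comment> \<open>A unit \<open>r\<close> would bring \<open>?b\<close> itself into the
          domain of \<open>G\<close>, so this case cannot occur.\<close>
        then obtain r' where r': "r' \<in> carrier R" "r' \<otimes> r = \<one>" using unit_or_m r by blast
        have "r' \<odot>\<^bsub>B\<^esub> (r \<odot>\<^bsub>B\<^esub> ?b) = ?b"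
          using r r' b' B.smult_assoc1[of r' r ?b] by simp
        then have "(?b, r' \<odot>\<^bsub>Y\<^esub> z) \<in> G" using Gd(5)[OF r'(1) z] by simp
        then show ?thesis using nb' by blast
      qed
      then show ?thesis using b' nb' y(1) by blast
    qed
    then obtain b' y where b': "b' \<in> carrier B" and y: "y \<in> carrier Y" and nb': "\<nexists>z. (b', z) \<in> G"
      and key: "\<And>r z. r \<in> carrier R \<Longrightarrow> (r \<odot>\<^bsub>B\<^esub> b', z) \<in> G \<Longrightarrow> z = r \<odot>\<^bsub>Y\<^esub> y" by blast
    \<comment> \<open>Adjoining the pair keeps the relation single-valued: if \<open>c\<close> plus
      \<open>r\<close> times \<open>b'\<close> is zero, then the negative of \<open>z\<close> is the
      value at \<open>r\<close> times \<open>b'\<close>, and by \<open>key\<close> this value is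
      \<open>r\<close> times \<open>y\<close>.\<close>
    have "linrel_extend R B Y G b' y \<subseteq> ?U"
    proof (clarsimp simp: linrel_extend_def)
      fix c z r assume cz: "(c, z) \<in> G" and r: "r \<in> carrier R" and 0: "c \<oplus>\<^bsub>B\<^esub> r \<odot>\<^bsub>B\<^esub> b' = \<zero>\<^bsub>B\<^esub>"
      have cl: "c \<in> carrier B" "z \<in> carrier Y" using Gd(1,2)[OF cz] .
      have "r \<odot>\<^bsub>B\<^esub> b' = \<ominus>\<^bsub>B\<^esub> c"
        using 0 cl r b' by (metis B.M.minus_equality B.M.minus_minus B.smult_closed)
      moreover have "(\<ominus>\<^bsub>B\<^esub> c, \<ominus>\<^bsub>Y\<^esub> z) \<in> G"
        using Gd(5)[of "\<ominus> \<one>", OF _ cz] cl by (simp add: B.smult_l_minus Y.smult_l_minus)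
      ultimately have "\<ominus>\<^bsub>Y\<^esub> z = r \<odot>\<^bsub>Y\<^esub> y" using key[OF r] by simp
      then show "z \<oplus>\<^bsub>Y\<^esub> r \<odot>\<^bsub>Y\<^esub> y = \<zero>\<^bsub>Y\<^esub>" using cl by (simp add: Y.M.r_neg flip: \<open>\<ominus>\<^bsub>Y\<^esub> z = _\<close>)
    qed
    then have "linrel_extend R B Y G b' y = G"
      by (rule max[OF linrel_linrel_extend[OF B Y G(1) b' y] linrel_extend_superset[OF B Y G(1) b' y]])
    then show False using linrel_extend_mem[OF B Y G(1) b' y] nb' by blast
  qed
  define g where "g b = (SOME y. (b, y) \<in> G)" for b
  have g: "(b, g b) \<in> G" if "b \<in> carrier B" for b
    unfolding g_def by (rule someI_ex[OF dom[OF that]])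
  show thesis
  proof (rule that)
    show "g \<in> module_hom R B Y"
    proof (rule homI)
      fix b assume b: "b \<in> carrier B"
      show "g b \<in> carrier Y" using Gd(2)[OF g[OF b]] .
      show "g (r \<odot>\<^bsub>B\<^esub> b) = r \<odot>\<^bsub>Y\<^esub> g b" if "r \<in> carrier R" for r
        by (rule fn[OF g Gd(5)[OF that g[OF b]]]) (simp add: that b)
      show "g (b \<oplus>\<^bsub>B\<^esub> c) = g b \<oplus>\<^bsub>Y\<^esub> g c" if "c \<in> carrier B" for c
        by (rule fn[OF g Gd(4)[OF g[OF b] g[OF that]]]) (simp add: that b)
    qed
    show "g b = y" if "(b, y) \<in> G0" for b y
    proof -
      have by': "(b, y) \<in> G" using that G(2) by blast
      show ?thesis by (rule fn[OF g[OF Gd(1)[OF by']] by'])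
    qed
  qed
qed

text \<open>As \<open>\<mm>\<close> is finitely generated, the image of \<open>f\<close> lives in
  finitely many coordinates even if \<open>X\<close> is infinite, and the extension can be made
  coordinatewise.\<close>

lemma m_extension_dsum:
  assumes Y: "module R Y" and ext: "m_extension Y"
  shows "m_extension (dsum Y X)"
  unfolding m_extension_def
proof
  let ?D = "dsum Y X" and ?m = "ring_module R\<lparr>carrier := \<mm>\<rparr>"
  fix f assume f: "f \<in> module_hom R ?m ?D"
  have fc: "f a \<in> carrier ?D" if "a \<in> \<mm>" for a using hom_closed[OF f] that by simp
  have fa: "f (a \<oplus> b) = f a \<oplus>\<^bsub>?D\<^esub> f b" if "a \<in> \<mm>" "b \<in> \<mm>" for a b
    using hom_add[OF f, of a b] that by (simp add: ring_module_def)
  have fs: "f (r \<otimes> a) = r \<odot>\<^bsub>?D\<^esub> f a" if "r \<in> carrier R" "a \<in> \<mm>" for r a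
    using hom_smult[OF f, of r a] that by (simp add: ring_module_def)
  interpret Y: module R Y by (rule Y)
  interpret mi: ideal \<mm> R by (rule m_ideal)
  obtain S where S: "S \<subseteq> carrier R" "finite S" "\<mm> = Idl S" using finetely_gen[OF m_ideal] by blast
  have Sm: "S \<subseteq> \<mm>" using S genideal_self by simp
  define Z where "Z = (\<Union>a\<in>S. {x \<in> X. f a x \<noteq> \<zero>\<^bsub>Y\<^esub>})"
  have Zfin: "finite Z" unfolding Z_def using S(2) Sm fc dsum_finite by (intro finite_UN_I) blast+
  \<comment> \<open>The elements of \<open>\<mm>\<close> whose image is supported in
    \<open>Z\<close>: an ideal that contains the generators of \<open>\<mm>\<close>.\<close>
  define J where "J = {a \<in> \<mm>. \<forall>x\<in>X - Z. f a x = \<zero>\<^bsub>Y\<^esub>}"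
  have J: "ideal J R"
  proof (rule ideal_of_closed)
    show "J \<subseteq> carrier R" using m_closed_R by (auto simp: J_def)
    have "f \<zero> = \<zero> \<odot>\<^bsub>?D\<^esub> f \<zero>" using fs[of \<zero> \<zero>] by simp
    then have "f \<zero> = \<zero>\<^bsub>?D\<^esub>"
      using module.smult_l_null[OF module_dsum[OF Y] fc[OF mi.zero_closed]] by simp
    then have "\<forall>x\<in>X. f \<zero> x = \<zero>\<^bsub>Y\<^esub>" by (simp add: dsum_sel(2))
    then show "\<zero> \<in> J" by (auto simp: J_def)
    show "a \<oplus> b \<in> J" if "a \<in> J" "b \<in> J" for a b
      using that by (auto simp: J_def fa dsum_sel(3))
    show "r \<otimes> a \<in> J" if "r \<in> carrier R" "a \<in> J" for r a
      using that mi.I_l_closed by (auto simp: J_def fs dsum_sel(4))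
  qed
  have "S \<subseteq> J" using Sm by (auto simp: J_def Z_def)
  then have mJ: "\<mm> \<subseteq> J" unfolding S(3) by (rule genideal_minimal[OF J])
  have "\<exists>y\<in>carrier Y. \<forall>a\<in>\<mm>. f a x = a \<odot>\<^bsub>Y\<^esub> y" if x: "x \<in> X" for x
  proof -
    obtain y where "y \<in> carrier Y" "\<And>a. a \<in> \<mm> \<Longrightarrow> f a x = a \<odot>\<^bsub>Y\<^esub> y"
      by (rule m_extensionD[OF ext, of "\<lambda>a. f a x"])
        (use x dsum_coord[OF fc x] in \<open>auto simp: fa fs dsum_sel(3,4)\<close>)
    then show ?thesis by blast
  qed
  then obtain y where y: "\<And>x. x \<in> X \<Longrightarrow> y x \<in> carrier Y" "\<And>x a. x \<in> X \<Longrightarrow> a \<in> \<mm> \<Longrightarrow> f a x = a \<odot>\<^bsub>Y\<^esub> y x"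
    by metis
  \<comment> \<open>Outside \<open>Z\<close> the chosen \<open>y x\<close> need not vanish; it is
    merely killed by \<open>\<mm>\<close>. Zero does as well there and keeps the support
    finite.\<close>
  define w where "w = (\<lambda>x\<in>X. if x \<in> Z then y x else \<zero>\<^bsub>Y\<^esub>)"
  have "finite {x \<in> X. w x \<noteq> \<zero>\<^bsub>Y\<^esub>}"
    by (rule finite_subset[OF _ Zfin]) (auto simp: w_def split: if_splits)
  then have w: "w \<in> carrier ?D" using y by (auto simp: dsum_sel w_def)
  have "f a = a \<odot>\<^bsub>?D\<^esub> w" if a: "a \<in> \<mm>" for a
  proof (rule dsum_eqI[OF fc[OF a]])
    show "a \<odot>\<^bsub>?D\<^esub> w \<in> carrier ?D"
      by (rule module.smult_closed[OF module_dsum[OF Y] m_closed_R[OF a] w])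
    show "f a x = (a \<odot>\<^bsub>?D\<^esub> w) x" if x: "x \<in> X" for x
      using x a y(2)[OF x a] mJ m_closed_R[OF a] by (auto simp: dsum_sel(4) w_def J_def)
  qed
  then show "\<exists>y\<in>carrier ?D. \<forall>a\<in>\<mm>. f a = a \<odot>\<^bsub>?D\<^esub> y" using w by blast
qed

end

section \<open>Injective dimension at most one\<close>

lemma injective_moduleD:
  fixes R :: "('a, 'r) ring_scheme" and A B :: "('a, 'a) module" and E :: "('a, 'e) module"
  assumes "injective_module R E" "module R A" "module R B" "i \<in> module_hom R A B"
    "inj_on i (carrier A)" "g \<in> module_hom R A E"
  shows "\<exists>h\<in>module_hom R B E. \<forall>x\<in>carrier A. h (i x) = g x"
  using assms(1)[unfolded injective_module_def, THEN conjunct2, rule_format, of A B i g] assms(2-6) by simp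

lemma (in dim_one_local) injective_m_extension:
  fixes E :: "('a, 'e) module"
  assumes "injective_module R E" shows "m_extension E"
  unfolding m_extension_def
proof
  let ?m = "ring_module R\<lparr>carrier := \<mm>\<rparr>"
  interpret E: module R E using assms by (simp add: injective_module_def)
  interpret mi: ideal \<mm> R by (rule m_ideal)
  fix f assume f: "f \<in> module_hom R ?m E"
  have "submodule R \<mm> (ring_module R)"
    by (rule submodule_of_closed[OF module_ring_module[OF is_cring]])
      (use m_closed_R mi.I_l_closed in \<open>auto simp: ring_module_sel\<close>)
  then have m: "module R ?m" by (rule submodule_module)
  have i: "(\<lambda>x. x) \<in> module_hom R ?m (ring_module R)"
    by (rule homI) (simp_all add: ring_module_def m_closed_R)
  obtain h where h: "h \<in> module_hom R (ring_module R) E" "\<forall>x\<in>carrier ?m. h x = f x"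
    using injective_moduleD[OF assms m module_ring_module[OF is_cring] i _ f] by (auto simp: inj_on_def)
  have "f a = a \<odot>\<^bsub>E\<^esub> h \<one>" if "a \<in> \<mm>" for a
    using h(2) hom_smult[OF h(1), of a \<one>] m_closed_R[OF that] that by (simp add: ring_module_def)
  moreover have "h \<one> \<in> carrier E" using hom_closed[OF h(1)] by (simp add: ring_module_def)
  ultimately show "\<exists>y\<in>carrier E. \<forall>a\<in>\<mm>. f a = a \<odot>\<^bsub>E\<^esub> y" by blast
qed

text \<open>Multiplication by \<open>x\<close> is injective on a domain, so the map r \<mapsto> r y
  extends along it; the value of the extension at one is the quotient sought.\<close>

lemma (in domain) injective_divisible:
  fixes E :: "('a, 'e) module"
  assumes E: "injective_module R E" and x: "x \<in> carrier R" "x \<noteq> \<zero>" and y: "y \<in> carrier E"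
  obtains z where "z \<in> carrier E" "x \<odot>\<^bsub>E\<^esub> z = y"
proof -
  let ?R = "ring_module R"
  interpret E: module R E using E by (simp add: injective_module_def)
  note R = module_ring_module[OF is_cring]
  have i: "(\<lambda>r. r \<otimes> x) \<in> module_hom R ?R ?R"
    by (rule homI) (simp_all add: ring_module_sel x l_distr m_assoc)
  have inj: "inj_on (\<lambda>r. r \<otimes> x) (carrier ?R)"
    by (rule inj_onI) (simp add: ring_module_sel x m_rcancel)
  obtain h where h: "h \<in> module_hom R ?R E" "\<forall>r\<in>carrier ?R. h (r \<otimes> x) = r \<odot>\<^bsub>E\<^esub> y"
    using injective_moduleD[OF E R R i inj hom_scale_right[OF E.module_axioms y]] by blast
  have "h x = y" using h(2) x y by (auto simp: ring_module_sel dest: bspec[of _ _ \<one>])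
  moreover have "h x = x \<odot>\<^bsub>E\<^esub> h \<one>" using hom_smult[OF h(1), of x \<one>] x by (simp add: ring_module_sel)
  moreover have "h \<one> \<in> carrier E" using hom_closed[OF h(1)] by (simp add: ring_module_sel)
  ultimately show thesis using that by metis
qed

text \<open>Because \<open>J\<close> is injective, \<open>f\<close> is multiplication into some
  \<open>y\<close> of \<open>J\<close>, and \<open>y\<close> fails to lie in the kernel of
  \<open>d'\<close> by the element \<open>y' = d' y\<close>, which \<open>\<mm>\<close> kills. If
  \<open>y'\<close> lifts to an element of \<open>J\<close> that \<open>\<mm>\<close> also kills,
  subtracting the lift moves \<open>y\<close> into the kernel without changing the products with
  elements of \<open>\<mm>\<close>.\<close>

lemma (in dim_one_local) cosyzygy_m_extension_step:
  fixes I J K :: "('a, 'e) module"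
  assumes I: "injective_module R I" and J: "injective_module R J" and K: "module R K" and L: "module R L"
    and d: "d \<in> module_hom R I J" and d': "d' \<in> module_hom R J K" and d'': "d'' \<in> module_hom R K L"
    and ex: "d ` carrier I = {x \<in> carrier J. d' x = \<zero>\<^bsub>K\<^esub>}"
    and ex': "d' ` carrier J = {x \<in> carrier K. d'' x = \<zero>\<^bsub>L\<^esub>}"
    and ext: "m_extension (K\<lparr>carrier := {x \<in> carrier K. d'' x = \<zero>\<^bsub>L\<^esub>}\<rparr>)"
  shows "m_extension (J\<lparr>carrier := {x \<in> carrier J. d' x = \<zero>\<^bsub>K\<^esub>}\<rparr>)"
  unfolding m_extension_def
proof
  let ?m = "ring_module R\<lparr>carrier := \<mm>\<rparr>"
  let ?Y = "J\<lparr>carrier := {x \<in> carrier J. d' x = \<zero>\<^bsub>K\<^esub>}\<rparr>" and ?Z = "K\<lparr>carrier := {x \<in> carrier K. d'' x = \<zero>\<^bsub>L\<^esub>}\<rparr>"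
  fix f assume f: "f \<in> module_hom R ?m ?Y"
  interpret mi: ideal \<mm> R by (rule m_ideal)
  have Im: "module R I" and Jm: "module R J" using I J by (simp_all add: injective_module_def)
  interpret I: module R I by (rule Im)
  interpret J: module R J by (rule Jm)
  interpret K: module R K by (rule K)
  have Z: "module R ?Z" by (rule submodule_module[OF submodule_kernel[OF K L d'']])
  have fJ: "f \<in> module_hom R ?m J" using f unfolding module_hom_def by auto
  obtain y where y: "y \<in> carrier J" "\<And>a. a \<in> \<mm> \<Longrightarrow> f a = a \<odot>\<^bsub>J\<^esub> y"
    using injective_m_extension[OF J] fJ unfolding m_extension_def by blast
  define y' where "y' = d' y"
  have y': "y' \<in> carrier K" "y' \<in> carrier ?Z" using hom_closed[OF d' y(1)] y(1) ex' by (auto simp: y'_def)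
  have my': "a \<odot>\<^bsub>K\<^esub> y' = \<zero>\<^bsub>K\<^esub>" if a: "a \<in> \<mm>" for a
  proof -
    have "f a \<in> carrier ?Y" using hom_closed[OF f] a by simp
    then have "d' (a \<odot>\<^bsub>J\<^esub> y) = \<zero>\<^bsub>K\<^esub>" using y(2)[OF a] by simp
    then show ?thesis using hom_smult[OF d' m_closed_R[OF a] y(1)] by (simp add: y'_def)
  qed
  \<comment> \<open>\<open>x\<close> is any nonzero element of \<open>\<mm>\<close>, and the class
    of \<open>u\<close> spans a copy of the residue field in R/(x). The lift of \<open>y'\<close> is
    sought as \<open>u\<close> times an element killed by \<open>x\<close>; such a product is
    automatically killed by \<open>\<mm>\<close>.\<close>
  have "\<zero> \<in> \<mm>" by (rule mi.zero_closed)
  then obtain x where x: "x \<in> \<mm>" "x \<noteq> \<zero>" using nonzero by blast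
  have xR: "x \<in> carrier R" by (rule m_closed_R[OF x(1)])
  have "PIdl x \<subseteq> \<mm>" using x(1) mi.I_l_closed by (auto simp: cgenideal_def)
  then have pr: "PIdl x \<noteq> carrier R" using one_notin_m one_closed by blast
  have "PIdl x \<noteq> {\<zero>}" using cgenideal_self[OF xR] x(2) by blast
  then obtain u where u: "u \<in> carrier R" "u \<notin> PIdl x" and mu: "\<And>a. a \<in> \<mm> \<Longrightarrow> a \<otimes> u \<in> PIdl x"
    using socle_element[OF cgenideal_ideal[OF xR] pr] by blast
  let ?R = "ring_module R"
  \<comment> \<open>The relation that sends multiples of \<open>x\<close> to zero. Together with the
    pair (\<open>u\<close>, \<open>y'\<close>) it is a homomorphism on the copy of the residue field
    in R/(x), and \<open>ext\<close> extends it to a map on R/(x).\<close>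
  let ?H = "{(s \<otimes> x, \<zero>\<^bsub>K\<^esub>) | s. s \<in> carrier ?R}"
  note Rm = module_ring_module[OF is_cring]
  have "(\<lambda>s. s \<otimes> x) \<in> module_hom R ?R ?R"
    by (rule homI) (simp_all add: ring_module_sel xR l_distr m_assoc)
  from linrel_image[OF Rm Rm Z this hom_const_zero[OF Z]] have G0: "linrel R ?R ?Z ?H" by simp
  have uR: "u \<in> carrier ?R" using u by (simp add: ring_module_sel)
  define G where "G = linrel_extend R ?R ?Z ?H u y'"
  have G: "linrel R ?R ?Z G" and G0G: "?H \<subseteq> G" and uG: "(u, y') \<in> G"
    unfolding G_def
    by (rule linrel_linrel_extend linrel_extend_superset linrel_extend_mem, (rule Rm Z G0 uR y'(2))+)+
  \<comment> \<open>Well-definedness: if \<open>r\<close> times \<open>u\<close> is a multiple of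
    \<open>x\<close>, then \<open>r\<close> is not a unit, so it lies in \<open>\<mm>\<close> and
    kills \<open>y'\<close>.\<close>
  have Gz: "z = \<zero>\<^bsub>?Z\<^esub>" if "(\<zero>\<^bsub>ring_module R\<^esub>, z) \<in> G" for z
  proof -
    obtain r s where *: "r \<in> carrier R" "s \<in> carrier R" "\<zero> = r \<otimes> u \<oplus> s \<otimes> x" "z = r \<odot>\<^bsub>K\<^esub> y'"
      using \<open>(\<zero>\<^bsub>ring_module R\<^esub>, z) \<in> G\<close> u xR y'(1)
      by (auto simp: G_def linrel_extend_def ring_module_sel a_comm)
    have "r \<otimes> u = (\<ominus> s) \<otimes> x"
      using *(1-3) u xR by (metis l_minus m_closed minus_equality)
    then have ru: "r \<otimes> u \<in> PIdl x" using *(2) unfolding cgenideal_def by blast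
    have "r \<in> \<mm>"
    proof (rule ccontr)
      assume "r \<notin> \<mm>"
      then obtain r' where r': "r' \<in> carrier R" "r' \<otimes> r = \<one>" using unit_or_m *(1) by blast
      have "r' \<otimes> (r \<otimes> u) \<in> PIdl x" by (rule ideal.I_l_closed[OF cgenideal_ideal[OF xR] ru r'(1)])
      then show False using r' u *(1) by (simp flip: m_assoc)
    qed
    then show ?thesis using my' *(4) by simp
  qed
  obtain g where g: "g \<in> module_hom R (ring_module R) ?Z" "\<And>b z. (b, z) \<in> G \<Longrightarrow> g b = z"
    by (rule m_extension_linrel_extension[OF Rm Z ext G]) (rule Gz, blast+)
  define w where "w = g \<one>"
  have w: "w \<in> carrier ?Z" using hom_closed[OF g(1)] by (simp add: w_def ring_module_sel)
  have uw: "u \<odot>\<^bsub>K\<^esub> w = y'"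
    using g(2)[OF uG] hom_smult[OF g(1), of u \<one>] u by (simp add: ring_module_sel w_def)
  have "(\<one> \<otimes> x, \<zero>\<^bsub>K\<^esub>) \<in> G" using G0G one_closed by (auto simp: ring_module_sel)
  then have xw: "x \<odot>\<^bsub>K\<^esub> w = \<zero>\<^bsub>K\<^esub>"
    using g(2) hom_smult[OF g(1), of x \<one>] xR by (simp add: ring_module_sel w_def)
  have "w \<in> d' ` carrier J" using w ex' by simp
  then obtain v where v: "v \<in> carrier J" "w = d' v" by blast
  have "x \<odot>\<^bsub>J\<^esub> v \<in> d ` carrier I" unfolding ex using v xR xw by (simp add: hom_smult[OF d'])
  then obtain t where t: "t \<in> carrier I" "x \<odot>\<^bsub>J\<^esub> v = d t" by blast
  \<comment> \<open>Divisibility of \<open>I\<close> is used here: subtracting \<open>d t'\<close>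
    from \<open>v\<close> leaves the image \<open>w\<close> unchanged and makes the result killed by
    \<open>x\<close>.\<close>
  obtain t' where t': "t' \<in> carrier I" "x \<odot>\<^bsub>I\<^esub> t' = t" using injective_divisible[OF I xR x(2) t(1)] by blast
  have dt': "d t' \<in> carrier J" "d' (d t') = \<zero>\<^bsub>K\<^esub>" using ex t'(1) by blast+
  define v' where "v' = v \<ominus>\<^bsub>J\<^esub> d t'"
  have v': "v' \<in> carrier J" using v dt' by (simp add: v'_def)
  have "x \<odot>\<^bsub>J\<^esub> d t' = x \<odot>\<^bsub>J\<^esub> v" using t t' xR by (simp flip: hom_smult[OF d])
  then have xv': "x \<odot>\<^bsub>J\<^esub> v' = \<zero>\<^bsub>J\<^esub>"
    using v dt' xR by (simp add: v'_def a_minus_def J.smult_r_distr J.smult_r_minus J.M.r_neg)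
  have dv': "d' v' = w"
    using v dt' hom_closed[OF d' v(1)] by (simp add: v'_def hom_minus[OF Jm K d'] module_minus_zero[OF K])
  define z where "z = y \<ominus>\<^bsub>J\<^esub> u \<odot>\<^bsub>J\<^esub> v'"
  have "z \<in> carrier J" using y v' u by (simp add: z_def)
  moreover have "d' z = \<zero>\<^bsub>K\<^esub>"
    using y(1) v' u y'(1) uw
    by (simp add: z_def hom_minus[OF Jm K d'] hom_smult[OF d'] dv' module_diff_eq_zero[OF K] flip: y'_def)
  moreover have "f a = a \<odot>\<^bsub>J\<^esub> z" if a: "a \<in> \<mm>" for a
  proof -
    have aR: "a \<in> carrier R" by (rule m_closed_R[OF a])
    obtain s where s: "s \<in> carrier R" "a \<otimes> u = s \<otimes> x" using mu[OF a] unfolding cgenideal_def by blast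
    have "a \<odot>\<^bsub>J\<^esub> (u \<odot>\<^bsub>J\<^esub> v') = \<zero>\<^bsub>J\<^esub>"
      using s v' u aR xR xv' J.smult_assoc1[of a u v'] J.smult_assoc1[of s x v'] by simp
    then show ?thesis
      using y(1) y(2)[OF a] v' u aR
      by (simp add: z_def module_smult_diff[OF Jm] module_minus_zero[OF Jm])
  qed
  ultimately show "\<exists>y\<in>carrier ?Y. \<forall>a\<in>\<mm>. f a = a \<odot>\<^bsub>?Y\<^esub> y" by auto
qed

text \<open>The property is trivial for the zero cosyzygies beyond the end of the resolution and is
  pulled back degree by degree to the first cosyzygy. There the descent ends: the step needs an
  injective module to the left of the cosyzygy, and the one in degree 0 is the ring itself.\<close>

lemma (in dim_one_local) gorenstein_m_extension:
  assumes "finite_inj_dim TYPE('e) R (ring_module R)"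
  obtains \<epsilon> :: "'a \<Rightarrow> 'e" and I Y :: "('a, 'e) module" and d
  where "module R I" "module R Y" "m_extension I" "m_extension Y"
    "\<epsilon> \<in> module_hom R (ring_module R) I" "inj_on \<epsilon> (carrier R)" "d \<in> module_hom R I Y"
    "d ` carrier I = carrier Y" "{x \<in> carrier I. d x = \<zero>\<^bsub>Y\<^esub>} = \<epsilon> ` carrier R"
proof -
  obtain \<epsilon> :: "'a \<Rightarrow> 'e" and I d n where res: "injective_resolution R (ring_module R) \<epsilon> I d"
    and zero: "\<forall>j>n. zero_module (I j)"
    using assms unfolding finite_inj_dim_def by blast
  have inj: "injective_module R (I j)" and d: "d j \<in> module_hom R (I j) (I (Suc j))"
    and ex: "d j ` carrier (I j) = {x \<in> carrier (I (Suc j)). d (Suc j) x = \<zero>\<^bsub>I (Suc (Suc j))\<^esub>}" for j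
    using res by (simp_all add: injective_resolution_def)
  have m: "module R (I j)" for j using inj by (simp add: injective_module_def)
  define Y where "Y j = (I j)\<lparr>carrier := {x \<in> carrier (I j). d j x = \<zero>\<^bsub>I (Suc j)\<^esub>}\<rparr>" for j
  have Y: "module R (Y j)" for j
    unfolding Y_def by (rule submodule_module[OF submodule_kernel[OF m m d]])
  have "m_extension (Y (Suc j))" if "n \<le> j + k" for k j
    using that
  proof (induction k arbitrary: j)
    case 0
    then have "carrier (I (Suc j)) = {\<zero>\<^bsub>I (Suc j)\<^esub>}" using zero by (simp add: zero_module_def)
    then have "carrier (Y (Suc j)) \<subseteq> {\<zero>\<^bsub>Y (Suc j)\<^esub>}" by (auto simp: Y_def)
    then have c: "carrier (Y (Suc j)) = {\<zero>\<^bsub>Y (Suc j)\<^esub>}" using module_zero_closed[OF Y] by blast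
    show ?case unfolding m_extension_def
    proof
      fix f assume f: "f \<in> module_hom R (ring_module R\<lparr>carrier := \<mm>\<rparr>) (Y (Suc j))"
      have "f a = \<zero>\<^bsub>Y (Suc j)\<^esub>" if "a \<in> \<mm>" for a
        using hom_closed[OF f, of a] that c by simp
      then show "\<exists>y\<in>carrier (Y (Suc j)). \<forall>a\<in>\<mm>. f a = a \<odot>\<^bsub>Y (Suc j)\<^esub> y"
        using module.smult_r_null[OF Y] m_closed_R module_zero_closed[OF Y] by metis
    qed
  next
    case (Suc k)
    then have "m_extension (Y (Suc (Suc j)))" by simp
    then show ?case unfolding Y_def
      by (rule cosyzygy_m_extension_step[OF inj inj m m d d d ex ex])
  qed
  from this[of 0 n] have ext: "m_extension (Y 1)" by simp
  have dY: "d 0 \<in> module_hom R (I 0) (Y 1)"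
    using d[of 0] ex[of 0] unfolding module_hom_def Y_def by auto
  show thesis
  proof (rule that[OF m Y injective_m_extension[OF inj] ext _ _ dY])
    show "\<epsilon> \<in> module_hom R (ring_module R) (I 0)" "inj_on \<epsilon> (carrier R)"
      "{x \<in> carrier (I 0). d 0 x = \<zero>\<^bsub>Y 1\<^esub>} = \<epsilon> ` carrier R"
      using res by (simp_all add: injective_resolution_def ring_module_sel Y_def)
    show "d 0 ` carrier (I 0) = carrier (Y 1)" using ex[of 0] by (simp add: Y_def)
  qed
qed

section \<open>Extension to projective modules\<close>

lemma inj_hom_factor:
  assumes F: "module R F" and E: "e \<in> module_hom R F I" "inj_on e (carrier F)"
    and g: "g \<in> module_hom R B I" "g ` carrier B \<subseteq> e ` carrier F" and B: "module R B"
  obtains h where "h \<in> module_hom R B F" "\<And>y. y \<in> carrier B \<Longrightarrow> e (h y) = g y"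
proof -
  interpret F: module R F by (rule F)
  interpret B: module R B by (rule B)
  define h where "h y = inv_into (carrier F) e (g y)" for y
  have h: "h y \<in> carrier F" "e (h y) = g y" if "y \<in> carrier B" for y
  proof -
    have "g y \<in> e ` carrier F" using g(2) that by blast
    then show "h y \<in> carrier F" "e (h y) = g y"
      unfolding h_def by (rule inv_into_into, rule f_inv_into_f)
  qed
  have eq: "x = y" if "x \<in> carrier F" "y \<in> carrier F" "e x = e y" for x y
    using E(2) that by (auto simp: inj_on_def)
  have "h \<in> module_hom R B F"
  proof (rule homI)
    fix y assume y: "y \<in> carrier B"
    show "h y \<in> carrier F" by (rule h(1)[OF y])
    show "h (y \<oplus>\<^bsub>B\<^esub> z) = h y \<oplus>\<^bsub>F\<^esub> h z" if z: "z \<in> carrier B" for z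
      by (rule eq) (simp_all add: h y z hom_add[OF E(1)] hom_add[OF g(1)])
    show "h (r \<odot>\<^bsub>B\<^esub> y) = r \<odot>\<^bsub>F\<^esub> h y" if r: "r \<in> carrier R" for r
      by (rule eq) (simp_all add: h y r hom_smult[OF E(1)] hom_smult[OF g(1)])
  qed
  then show thesis using that h(2) by blast
qed

definition dsum_map :: "'s set \<Rightarrow> ('m \<Rightarrow> 'n) \<Rightarrow> ('s \<Rightarrow> 'm) \<Rightarrow> ('s \<Rightarrow> 'n)" where
  "dsum_map X f y = (\<lambda>s\<in>X. f (y s))"

lemma hom_dsum_map:
  assumes Y: "module R Y" and Z: "module R Z" and f: "f \<in> module_hom R Y Z"
  shows "dsum_map X f \<in> module_hom R (dsum Y X) (dsum Z X)"
  unfolding dsum_map_def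
proof (rule dsum_homI[OF Z hom_comp[OF hom_dsum_coord f]])
  fix y assume "y \<in> carrier (dsum Y X)"
  then show "finite {x \<in> X. f (y x) \<noteq> \<zero>\<^bsub>Z\<^esub>}"
    by (rule finite_subset[OF _ dsum_finite, rotated]) (auto simp: hom_zero[OF Y Z f])
qed

lemma dsum_map_image:
  assumes Y: "module R Y" and Z: "module R Z" and f: "f \<in> module_hom R Y Z"
    and z: "z \<in> carrier (dsum Z X)" and im: "\<And>x. x \<in> X \<Longrightarrow> z x \<in> f ` carrier Y"
  shows "z \<in> dsum_map X f ` carrier (dsum Y X)"
proof -
  interpret Y: module R Y by (rule Y)
  \<comment> \<open>A preimage of zero picked by \<open>inv_into\<close> might be nonzero; zero is
    prescribed there to keep the support finite.\<close>
  define y where "y = (\<lambda>x\<in>X. if z x = \<zero>\<^bsub>Z\<^esub> then \<zero>\<^bsub>Y\<^esub> else inv_into (carrier Y) f (z x))"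
  have "finite {x \<in> X. y x \<noteq> \<zero>\<^bsub>Y\<^esub>}"
    by (rule finite_subset[OF _ dsum_finite[OF z]]) (auto simp: y_def)
  then have y: "y \<in> carrier (dsum Y X)"
    using inv_into_into[OF im] by (auto simp: dsum_sel y_def)
  have "f (y x) = z x" if "x \<in> X" for x
    using f_inv_into_f[OF im[OF that]] that hom_zero[OF Y Z f] by (simp add: y_def)
  then have "dsum_map X f y = z"
    by (intro dsum_eqI[OF hom_closed[OF hom_dsum_map[OF Y Z f] y] z]) (simp add: dsum_map_def)
  then show ?thesis using y by blast
qed

text \<open>The obstruction to extending \<open>f\<close> lies in Ext^1(b(B), W), which the
  projective \<open>C\<close> identifies with Ext^2(C/b(B), W). It vanishes because \<open>W\<close>
  is a retract of a free module, and sums of the short resolution of the ring by \<open>I\<close>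
  and \<open>Y\<close> resolve that free module. Concretely, \<open>f\<close> is extended with
  values in the sum of copies of \<open>I\<close> and corrected by a map through \<open>C\<close> so
  that it falls back into the free module.\<close>

theorem (in dim_one_local) extension_to_projective:
  fixes A :: "('a, 'a1) module" and B :: "('a, 'b1) module" and C :: "('a, 'c1) module" and W :: "('a, 'w1) module"
  assumes fid: "finite_inj_dim TYPE('e) R (ring_module R)"
    and A: "module R A" and B: "module R B" and C: "dual_basis R C X' \<iota>'" and W: "dual_basis R W X \<iota>"
    and a: "a \<in> module_hom R A B" and b: "b \<in> module_hom R B C"
    and ba: "\<And>x. x \<in> carrier A \<Longrightarrow> b (a x) = \<zero>\<^bsub>C\<^esub>"
    and ex: "\<And>y. y \<in> carrier B \<Longrightarrow> b y = \<zero>\<^bsub>C\<^esub> \<Longrightarrow> y \<in> a ` carrier A"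
    and f: "f \<in> module_hom R A W" and ker: "\<And>x. x \<in> carrier A \<Longrightarrow> a x = \<zero>\<^bsub>B\<^esub> \<Longrightarrow> f x = \<zero>\<^bsub>W\<^esub>"
  obtains g where "g \<in> module_hom R B W" "\<And>x. x \<in> carrier A \<Longrightarrow> g (a x) = f x"
proof -
  let ?q = "free_lift R W X (\<lambda>x. x)"
  obtain \<epsilon> :: "'a \<Rightarrow> 'e" and I Y :: "('a, 'e) module" and d
    where I: "module R I" and Y: "module R Y" and ext: "m_extension I" "m_extension Y"
    and \<epsilon>: "\<epsilon> \<in> module_hom R (ring_module R) I" "inj_on \<epsilon> (carrier R)" and d: "d \<in> module_hom R I Y"
    and surj: "d ` carrier I = carrier Y" and kd: "{x \<in> carrier I. d x = \<zero>\<^bsub>Y\<^esub>} = \<epsilon> ` carrier R"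
    by (rule gorenstein_m_extension[OF fid]) blast
  let ?Z = "{x \<in> carrier I. d x = \<zero>\<^bsub>Y\<^esub>}"
  let ?I = "dsum I X" and ?Y = "dsum Y X" and ?F = "free_module R X"
  have Wm: "module R W" and XW: "X \<subseteq> carrier W" and \<iota>: "\<iota> \<in> module_hom R W ?F"
    and sec: "\<And>p. p \<in> carrier W \<Longrightarrow> ?q (\<iota> p) = p"
    using W by (auto simp: dual_basis_def)
  have Cm: "module R C" using C by (simp add: dual_basis_def)
  note Im = module_dsum[OF I] and Ym = module_dsum[OF Y] and R = module_ring_module[OF is_cring]
    and F = module_free[OF is_cring]
  let ?E = "dsum_map X \<epsilon>" and ?D = "dsum_map X d"
  have E: "?E \<in> module_hom R ?F ?I" unfolding free_module_eq by (rule hom_dsum_map[OF R I \<epsilon>(1)])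
  have D: "?D \<in> module_hom R ?I ?Y" by (rule hom_dsum_map[OF I Y d])
  have Einj: "inj_on ?E (carrier ?F)"
  proof (rule inj_onI)
    fix y z assume yz: "y \<in> carrier ?F" "z \<in> carrier ?F" and eq: "?E y = ?E z"
    have c: "y x \<in> carrier R" "z x \<in> carrier R" if "x \<in> X" for x
      using yz that by (auto simp: free_module_eq dsum_sel ring_module_sel)
    have "y x = z x" if "x \<in> X" for x
      using fun_cong[OF eq, of x] that inj_onD[OF \<epsilon>(2) _ c[OF that]] by (simp add: dsum_map_def)
    then show "y = z" by (rule dsum_eqI[OF yz[unfolded free_module_eq]])
  qed
  have DE: "?D (?E y) = \<zero>\<^bsub>?Y\<^esub>" if y: "y \<in> carrier ?F" for y
  proof (rule dsum_eqI[OF hom_closed[OF D hom_closed[OF E y]] module_zero_closed[OF Ym]])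
    fix x assume x: "x \<in> X"
    have "y x \<in> carrier R" using y x by (auto simp: free_module_eq dsum_sel ring_module_sel)
    then have "\<epsilon> (y x) \<in> ?Z" unfolding kd by blast
    then show "?D (?E y) x = \<zero>\<^bsub>?Y\<^esub> x" using x by (simp add: dsum_map_def dsum_sel(2))
  qed
  have kD: "z \<in> ?E ` carrier ?F" if z: "z \<in> carrier ?I" "?D z = \<zero>\<^bsub>?Y\<^esub>" for z
    unfolding free_module_eq
  proof (rule dsum_map_image[OF R I \<epsilon>(1) z(1)])
    fix x assume x: "x \<in> X"
    have "z x \<in> ?Z"
      using dsum_coord[OF z(1) x] fun_cong[OF z(2), of x] x by (simp add: dsum_map_def dsum_sel(2))
    then show "z x \<in> \<epsilon> ` carrier (ring_module R)" unfolding kd by (simp add: ring_module_sel)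
  qed
  have Dsurj: "z \<in> ?D ` carrier ?I" if z: "z \<in> carrier ?Y" for z
    by (rule dsum_map_image[OF I Y d z]) (use surj dsum_coord[OF z] in blast)
  define f1 where "f1 x = ?E (\<iota> (f x))" for x
  have f1: "f1 \<in> module_hom R A ?I"
    unfolding f1_def by (rule hom_comp[OF hom_comp[OF f \<iota>] E])
  obtain g1 where g1: "g1 \<in> module_hom R B ?I" and g1a: "\<And>u v. (u, v) \<in> {(a x, f1 x) | x. x \<in> carrier A} \<Longrightarrow> g1 u = v"
  proof (rule m_extension_linrel_extension[OF B Im m_extension_dsum[OF I ext(1)] linrel_image[OF A B Im a f1]])
    fix y assume "(\<zero>\<^bsub>B\<^esub>, y) \<in> {(a x, f1 x) | x. x \<in> carrier A}"
    then obtain x where x: "x \<in> carrier A" "a x = \<zero>\<^bsub>B\<^esub>" "y = f1 x" by auto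
    then show "y = \<zero>\<^bsub>?I\<^esub>"
      using ker[OF x(1,2)] hom_zero[OF Wm F \<iota>] hom_zero[OF F Im E] by (simp add: f1_def)
  qed blast
  have DE1: "?D (f1 x) = \<zero>\<^bsub>?Y\<^esub>" if "x \<in> carrier A" for x
    unfolding f1_def using that by (intro DE hom_closed[OF \<iota>] hom_closed[OF f])
  \<comment> \<open>\<open>?D\<close> after \<open>g1\<close> vanishes on the image of
    \<open>a\<close>, which contains the kernel of \<open>b\<close>. It is therefore well defined on
    the image of \<open>b\<close> and can be extended to \<open>C\<close>.\<close>
  note Dg1 = hom_comp[OF g1 D]
  obtain h where h: "h \<in> module_hom R C ?Y"
    and hb: "\<And>u v. (u, v) \<in> {(b y, ?D (g1 y)) | y. y \<in> carrier B} \<Longrightarrow> h u = v"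
  proof (rule m_extension_linrel_extension[OF Cm Ym m_extension_dsum[OF Y ext(2)] linrel_image[OF B Cm Ym b Dg1]])
    fix z assume "(\<zero>\<^bsub>C\<^esub>, z) \<in> {(b y, ?D (g1 y)) | y. y \<in> carrier B}"
    then obtain y where y: "y \<in> carrier B" "b y = \<zero>\<^bsub>C\<^esub>" "z = ?D (g1 y)" by auto
    then obtain x where x: "x \<in> carrier A" "y = a x" using ex by blast
    then have "g1 y = f1 x" using g1a by blast
    then show "z = \<zero>\<^bsub>?Y\<^esub>" using DE1[OF x(1)] y(3) by simp
  qed blast
  \<comment> \<open>Lifting \<open>h\<close> needs the projectivity of \<open>C\<close>. Subtracting
    \<open>k\<close> after \<open>b\<close> makes \<open>?D\<close> vanish and does not change the
    values on the image of \<open>a\<close>, which \<open>b\<close> kills.\<close>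
  obtain k where k: "k \<in> module_hom R C ?I" "\<And>c. c \<in> carrier C \<Longrightarrow> ?D (k c) = h c"
    by (rule dual_basis_lift[OF C Im Ym D h]) (use Dsurj hom_closed[OF h] in blast)+
  define g2 where "g2 y = g1 y \<ominus>\<^bsub>?I\<^esub> k (b y)" for y
  have g2: "g2 \<in> module_hom R B ?I" unfolding g2_def by (rule hom_diff[OF Im g1 hom_comp[OF b k(1)]])
  have "g2 y \<in> ?E ` carrier ?F" if y: "y \<in> carrier B" for y
  proof (rule kD[OF hom_closed[OF g2 y]])
    have "h (b y) = ?D (g1 y)" using hb y by blast
    then show "?D (g2 y) = \<zero>\<^bsub>?Y\<^esub>"
      using y k(2)[OF hom_closed[OF b y]] hom_closed[OF g1 y] hom_closed[OF k(1) hom_closed[OF b y]]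
      by (simp add: g2_def hom_minus[OF Im Ym D] module_diff_eq_zero[OF Ym] hom_closed[OF D])
  qed
  then have "g2 ` carrier B \<subseteq> ?E ` carrier ?F" by blast
  then obtain g3 where g3: "g3 \<in> module_hom R B ?F" "\<And>y. y \<in> carrier B \<Longrightarrow> ?E (g3 y) = g2 y"
    using inj_hom_factor[OF F E Einj g2 _ B] by blast
  have L: "?q \<in> module_hom R ?F W"
    by (rule hom_free_lift[OF Wm]) (use XW in blast)
  show thesis
  proof (rule that[OF hom_comp[OF g3(1) L]])
    fix x assume x: "x \<in> carrier A"
    note ax = hom_closed[OF a x] and fx = hom_closed[OF \<iota> hom_closed[OF f x]]
    have "g1 (a x) = f1 x" using g1a x by blast
    then have "g2 (a x) = ?E (\<iota> (f x))"
      using module_minus_zero[OF Im hom_closed[OF f1 x]]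
      by (simp add: g2_def ba[OF x] hom_zero[OF Cm Im k(1)] f1_def)
    then have "?E (g3 (a x)) = ?E (\<iota> (f x))" using g3(2)[OF ax] by simp
    then have "g3 (a x) = \<iota> (f x)" by (rule inj_onD[OF Einj _ hom_closed[OF g3(1) ax] fx])
    then show "?q (g3 (a x)) = f x" using sec[OF hom_closed[OF f x]] by simp
  qed
qed

text \<open>Over the fraction field \<open>q\<close> has a section on its image; \<open>e\<close> is
  this section after \<open>q\<close>, multiplied by a common denominator \<open>r\<close>. The
  section is obtained as a maximal partial one, and the finite generation of the image makes a
  single denominator suffice.\<close>

lemma (in domain) rational_section:
  fixes F :: "('a, 'f) module" and M :: "('a, 'm) module"
  assumes F: "module R F" and M: "module R M" and q: "q \<in> module_hom R F M"
    and S: "finite S" "S \<subseteq> carrier F" and gen: "q ` carrier F \<subseteq> module.span R M (q ` S)"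
  obtains r e where "r \<in> carrier R" "r \<noteq> \<zero>" "e \<in> module_hom R F F"
    "\<And>p. p \<in> carrier F \<Longrightarrow> q (e p) = r \<odot>\<^bsub>M\<^esub> q p"
    "\<And>p. p \<in> carrier F \<Longrightarrow> q p = \<zero>\<^bsub>M\<^esub> \<Longrightarrow> e p = \<zero>\<^bsub>F\<^esub>"
proof -
  interpret F: module R F by (rule F)
  interpret M: module R M by (rule M)
  \<comment> \<open>Pairs in the graph of a section, with zero as the only value at zero.\<close>
  let ?U = "{(m, p). q p = m \<and> (m = \<zero>\<^bsub>M\<^esub> \<longrightarrow> p = \<zero>\<^bsub>F\<^esub>)}"
  have "linrel R M F {(\<zero>\<^bsub>M\<^esub>, \<zero>\<^bsub>F\<^esub>)}" by (auto simp: linrel_def)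
  moreover have "{(\<zero>\<^bsub>M\<^esub>, \<zero>\<^bsub>F\<^esub>)} \<subseteq> ?U" using hom_zero[OF F M q] by simp
  ultimately obtain G where G: "linrel R M F G" "G \<subseteq> ?U"
    and max: "\<And>G'. linrel R M F G' \<Longrightarrow> G \<subseteq> G' \<Longrightarrow> G' \<subseteq> ?U \<Longrightarrow> G' = G"
    by (rule linrel_maximal) blast
  note Gd = linrelD[OF G(1)]
  have Gq: "q p = m" if "(m, p) \<in> G" for m p using that G(2) by blast
  have Gz: "p = \<zero>\<^bsub>F\<^esub>" if "(\<zero>\<^bsub>M\<^esub>, p) \<in> G" for p using that G(2) by blast
  have fn: "y = y'" if "(m, y) \<in> G" "(m, y') \<in> G" for m y y'
    by (rule linrel_functional[OF M F G(1) Gz that])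
  \<comment> \<open>If no nonzero multiple of \<open>q s\<close> were in the domain, the pair
    (\<open>q s\<close>, \<open>s\<close>) could be adjoined, against maximality.\<close>
  have tors: "\<exists>r\<in>carrier R. r \<noteq> \<zero> \<and> (\<exists>p. (r \<odot>\<^bsub>M\<^esub> q s, p) \<in> G)" if s: "s \<in> carrier F" for s
  proof (rule ccontr)
    assume no: "\<not> ?thesis"
    have qs: "q s \<in> carrier M" by (rule hom_closed[OF q s])
    have "linrel_extend R M F G (q s) s \<subseteq> ?U"
    proof
      fix t assume "t \<in> linrel_extend R M F G (q s) s"
      then obtain c z r where t: "t = (c \<oplus>\<^bsub>M\<^esub> r \<odot>\<^bsub>M\<^esub> q s, z \<oplus>\<^bsub>F\<^esub> r \<odot>\<^bsub>F\<^esub> s)" and cz: "(c, z) \<in> G"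
        and r: "r \<in> carrier R" unfolding linrel_extend_def by blast
      have cl: "c \<in> carrier M" "z \<in> carrier F" using Gd(1,2)[OF cz] .
      have "q (z \<oplus>\<^bsub>F\<^esub> r \<odot>\<^bsub>F\<^esub> s) = c \<oplus>\<^bsub>M\<^esub> r \<odot>\<^bsub>M\<^esub> q s"
        using cl r s Gq[OF cz] by (simp add: hom_add[OF q] hom_smult[OF q])
      moreover have "z \<oplus>\<^bsub>F\<^esub> r \<odot>\<^bsub>F\<^esub> s = \<zero>\<^bsub>F\<^esub>" if 0: "c \<oplus>\<^bsub>M\<^esub> r \<odot>\<^bsub>M\<^esub> q s = \<zero>\<^bsub>M\<^esub>"
      proof -
        have "r \<odot>\<^bsub>M\<^esub> q s = \<ominus>\<^bsub>M\<^esub> c"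
          using 0 cl r qs by (metis M.M.minus_equality M.M.minus_minus M.smult_closed)
        moreover have "(\<ominus>\<^bsub>M\<^esub> c, \<ominus>\<^bsub>F\<^esub> z) \<in> G"
          using Gd(5)[of "\<ominus> \<one>", OF _ cz] cl by (simp add: M.smult_l_minus F.smult_l_minus)
        ultimately have "r = \<zero>" using no r by metis
        then have "c = \<zero>\<^bsub>M\<^esub>" using 0 cl qs by simp
        then have "z = \<zero>\<^bsub>F\<^esub>" using cz Gz by blast
        then show ?thesis using \<open>r = \<zero>\<close> s by simp
      qed
      ultimately show "t \<in> ?U" unfolding t by blast
    qed
    then have "linrel_extend R M F G (q s) s = G"
      by (rule max[OF linrel_linrel_extend[OF M F G(1) qs s] linrel_extend_superset[OF M F G(1) qs s]])
    then have "(\<one> \<odot>\<^bsub>M\<^esub> q s, s) \<in> G" using linrel_extend_mem[OF M F G(1) qs s] qs by simp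
    then show False using no one_closed one_not_zero by blast
  qed
  have "\<exists>r\<in>carrier R. r \<noteq> \<zero> \<and> (\<forall>s\<in>S. \<exists>p. (r \<odot>\<^bsub>M\<^esub> q s, p) \<in> G)"
    using S
  proof (induction S rule: finite_induct)
    case empty
    then show ?case using one_closed one_not_zero by blast
  next
    case (insert s S)
    then obtain r where r: "r \<in> carrier R" "r \<noteq> \<zero>" "\<forall>s\<in>S. \<exists>p. (r \<odot>\<^bsub>M\<^esub> q s, p) \<in> G" by blast
    obtain r' p where r': "r' \<in> carrier R" "r' \<noteq> \<zero>" "(r' \<odot>\<^bsub>M\<^esub> q s, p) \<in> G"
      using tors insert.prems by blast
    have "\<exists>p. ((r \<otimes> r') \<odot>\<^bsub>M\<^esub> q s', p) \<in> G" if s': "s' \<in> insert s S" for s'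
    proof (cases "s' = s")
      case True
      then show ?thesis using Gd(5)[OF r(1) r'(3)] r r' insert.prems hom_closed[OF q]
        by (auto simp: M.smult_assoc1)
    next
      case False
      then obtain p' where "(r \<odot>\<^bsub>M\<^esub> q s', p') \<in> G" using r(3) s' by blast
      then have "(r' \<odot>\<^bsub>M\<^esub> (r \<odot>\<^bsub>M\<^esub> q s'), r' \<odot>\<^bsub>F\<^esub> p') \<in> G" using Gd(5) r'(1) by blast
      moreover have "q s' \<in> carrier M" using s' insert.prems hom_closed[OF q] by blast
      ultimately show ?thesis using r r' by (auto simp: m_comm[of r r'] M.smult_assoc1)
    qed
    moreover have "r \<otimes> r' \<noteq> \<zero>" using r r' integral by blast
    ultimately show ?case using r(1) r'(1) m_closed by blast
  qed
  then obtain r where r: "r \<in> carrier R" "r \<noteq> \<zero>" "\<And>s. s \<in> S \<Longrightarrow> \<exists>p. (r \<odot>\<^bsub>M\<^esub> q s, p) \<in> G" by blast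
  \<comment> \<open>The elements that \<open>r\<close> moves into the domain form a submodule. It
    contains the images of \<open>S\<close>, hence the whole image of \<open>q\<close>.\<close>
  let ?D = "{m \<in> carrier M. \<exists>p. (r \<odot>\<^bsub>M\<^esub> m, p) \<in> G}"
  have sub: "submodule R ?D M"
  proof (rule submodule_of_closed[OF M])
    show "\<zero>\<^bsub>M\<^esub> \<in> ?D" using Gd(3) r(1) by auto
    fix x y assume "x \<in> ?D" "y \<in> ?D"
    then show "x \<oplus>\<^bsub>M\<^esub> y \<in> ?D"
      using Gd(4) r(1) by (fastforce simp: M.smult_r_distr)
  next
    fix t x assume t: "t \<in> carrier R" and "x \<in> ?D"
    then obtain p where x: "x \<in> carrier M" "(r \<odot>\<^bsub>M\<^esub> x, p) \<in> G" by blast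
    have "t \<odot>\<^bsub>M\<^esub> (r \<odot>\<^bsub>M\<^esub> x) = r \<odot>\<^bsub>M\<^esub> (t \<odot>\<^bsub>M\<^esub> x)"
      using t x r(1) by (simp add: m_comm flip: M.smult_assoc1)
    then show "t \<odot>\<^bsub>M\<^esub> x \<in> ?D"
      using Gd(5)[OF t x(2)] t x(1) by auto
  qed auto
  have qS: "q ` S \<subseteq> ?D"
    using r(3) S(2) hom_closed[OF q] by blast
  have dom: "\<exists>z. (r \<odot>\<^bsub>M\<^esub> q p, z) \<in> G" if "p \<in> carrier F" for p
    using gen module.span_is_subset[OF M qS sub] that by blast
  define e where "e p = (SOME z. (r \<odot>\<^bsub>M\<^esub> q p, z) \<in> G)" for p
  have e: "(r \<odot>\<^bsub>M\<^esub> q p, e p) \<in> G" if "p \<in> carrier F" for p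
    unfolding e_def by (rule someI_ex[OF dom[OF that]])
  show thesis
  proof (rule that[OF r(1,2)])
    show "e \<in> module_hom R F F"
    proof (rule homI)
      fix p assume p: "p \<in> carrier F"
      note qp = hom_closed[OF q p]
      show "e p \<in> carrier F" using Gd(2)[OF e[OF p]] .
      show "e (p \<oplus>\<^bsub>F\<^esub> p') = e p \<oplus>\<^bsub>F\<^esub> e p'" if p': "p' \<in> carrier F" for p'
        using e[OF F.M.a_closed[OF p p']] Gd(4)[OF e[OF p] e[OF p']] p p' r(1) qp hom_closed[OF q p']
        by (intro fn) (auto simp: hom_add[OF q] M.smult_r_distr)
      show "e (t \<odot>\<^bsub>F\<^esub> p) = t \<odot>\<^bsub>F\<^esub> e p" if t: "t \<in> carrier R" for t
      proof (rule fn[OF e[OF F.smult_closed[OF t p]]])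
        have "t \<odot>\<^bsub>M\<^esub> (r \<odot>\<^bsub>M\<^esub> q p) = r \<odot>\<^bsub>M\<^esub> q (t \<odot>\<^bsub>F\<^esub> p)"
          using t p qp r(1) by (simp add: hom_smult[OF q] m_comm flip: M.smult_assoc1)
        then show "(r \<odot>\<^bsub>M\<^esub> q (t \<odot>\<^bsub>F\<^esub> p), t \<odot>\<^bsub>F\<^esub> e p) \<in> G" using Gd(5)[OF t e[OF p]] by simp
      qed
    qed
    show "q (e p) = r \<odot>\<^bsub>M\<^esub> q p" if "p \<in> carrier F" for p using Gq[OF e[OF that]] .
    show "e p = \<zero>\<^bsub>F\<^esub>" if "p \<in> carrier F" "q p = \<zero>\<^bsub>M\<^esub>" for p
      using Gz e[OF that(1)] that(2) r(1) by simp
  qed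
qed

section \<open>Complexes\<close>

lemma chain_complex_module: "chain_complex R C \<Longrightarrow> module R (obj C n)"
  by (simp add: chain_complex_def)

lemma chain_complex_hom:
  "chain_complex R C \<Longrightarrow> m = n - 1 \<Longrightarrow> diff C n \<in> module_hom R (obj C n) (obj C m)"
  by (simp add: chain_complex_def)

lemma chain_complex_comp:
  "chain_complex R C \<Longrightarrow> m = n - 1 \<Longrightarrow> l = m - 1 \<Longrightarrow> x \<in> carrier (obj C n) \<Longrightarrow>
   diff C m (diff C n x) = \<zero>\<^bsub>obj C l\<^esub>"
  by (simp add: chain_complex_def)

lemma zero_homology_iff:
  assumes C: "chain_complex R C"
  shows "zero_module (homology C n) \<longleftrightarrow> cycles C n \<subseteq> boundaries C n"
proof -
  note d = chain_complex_hom[OF C refl] and m = chain_complex_module[OF C]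
  have d1: "diff C (n + 1) \<in> module_hom R (obj C (n + 1)) (obj C n)"
    by (rule chain_complex_hom[OF C]) simp
  have B: "submodule R (boundaries C n) (obj C n)"
    unfolding boundaries_def by (rule submodule_image[OF m m d1])
  have Z: "submodule R (cycles C n) (obj C n)"
    unfolding cycles_def by (rule submodule_kernel[OF m m d])
  have BZ: "boundaries C n \<subseteq> cycles C n"
    using chain_complex_comp[OF C, of n "n + 1" "n - 1"] hom_closed[OF d1]
    by (auto simp: boundaries_def cycles_def)
  have "submodule R (boundaries C n) ((obj C n)\<lparr>carrier := cycles C n\<rparr>)"
    by (rule submodule_of_closed[OF submodule_module[OF Z]]) (use B BZ in \<open>auto simp: submodule_def\<close>)
  from zero_module_quot_iff[OF this] show ?thesis by (simp add: homology_def)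
qed

lemma chain_complex_exact:
  assumes C: "chain_complex R C" and "zero_module (homology C n)" "m = n - 1" "k = n + 1"
    and "x \<in> carrier (obj C n)" "diff C n x = \<zero>\<^bsub>obj C m\<^esub>"
  shows "x \<in> diff C k ` carrier (obj C k)"
  using assms zero_homology_iff[OF C, of n] by (auto simp: cycles_def boundaries_def)

lemma chain_complex_tensor:
  assumes C: "chain_complex R C" and N: "module R N"
  shows "chain_complex R (tensor_complex R C N)"
proof -
  let ?Ca = "\<lambda>n. obj C (n - 1)" and ?Cb = "\<lambda>n. obj C (n - 1 - 1)"
  note m = chain_complex_module[OF C] and d = chain_complex_hom[OF C refl]
  have "tensor_map R (?Ca n) (?Cb n) N (diff C (n - 1))
      (tensor_map R (obj C n) (?Ca n) N (diff C n) t) = \<zero>\<^bsub>tensor_product R (?Cb n) N\<^esub>"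
    if t: "t \<in> carrier (tensor_product R (obj C n) N)" for n t
  proof -
    have "tensor_map R (obj C n) (?Cb n) N (\<lambda>x. \<zero>\<^bsub>?Cb n\<^esub>) t =
        tensor_map R (?Ca n) (?Cb n) N (diff C (n - 1))
          (tensor_map R (obj C n) (?Ca n) N (diff C n) t)"
      by (rule tensor_map_comp[OF m m m N d d hom_const_zero[OF m] _ t])
        (simp add: chain_complex_comp[OF C])
    also have "tensor_map R (obj C n) (?Cb n) N (\<lambda>x. \<zero>\<^bsub>?Cb n\<^esub>) t =
        \<zero>\<^bsub>tensor_product R (?Cb n) N\<^esub>"
      by (rule tensor_map_zero[OF m m N hom_const_zero[OF m] _ t]) simp
    finally show ?thesis by simp
  qed
  then show ?thesis
    using module_tensor[OF m N] hom_tensor_map[OF m m N d]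
    by (simp add: chain_complex_def tensor_complex_def)
qed

lemma tensor_map_surj:
  assumes A: "module R A" and B: "module R B" and N: "module R N" and f: "f \<in> module_hom R A B"
    and surj: "f ` carrier A = carrier B" and t: "t \<in> carrier (tensor_product R B N)"
  shows "t \<in> tensor_map R A B N f ` carrier (tensor_product R A N)"
proof -
  let ?K = "tensor_map R A B N f ` carrier (tensor_product R A N)" and ?T = "tensor_product R B N"
  note T = module_tensor[OF B N]
  note K = submodule_image[OF module_tensor[OF A N] T hom_tensor_map[OF A B N f]]
  note Y = module_quot[OF K]
  have "?K +>\<^bsub>?T\<^esub> t = \<zero>\<^bsub>quot_module ?T ?K\<^esub>"
  proof (rule tensor_hom_eqI[OF B N Y hom_coset[OF K] hom_const_zero[OF Y] _ t])
    fix x y assume x: "x \<in> carrier B" and y: "y \<in> carrier N"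
    obtain x' where x': "x' \<in> carrier A" "f x' = x" using surj x by (metis imageE)
    have "pure_tensor R B N x y = tensor_map R A B N f (pure_tensor R A N x' y)"
      using x' y by (simp add: tensor_map_pure[OF A B N f])
    then have "pure_tensor R B N x y \<in> ?K" using pure_closed[OF A N x'(1) y] by blast
    then show "?K +>\<^bsub>?T\<^esub> pure_tensor R B N x y = \<zero>\<^bsub>quot_module ?T ?K\<^esub>"
      using coset_eq_zero_iff[OF K pure_closed[OF B N x y]] by blast
  qed
  then show ?thesis using coset_eq_zero_iff[OF K t] by blast
qed

text \<open>To apply \<open>extension_to_projective\<close>, a map from \<open>obj P j\<close> to a
  projective module is needed whose kernel is the image of \<open>diff P i\<close>. For
  \<open>j \<ge> 1\<close> the differential \<open>diff P j\<close> is such a map; in degree 0 a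
  substitute comes from \<open>rational_section\<close>.\<close>

lemma (in dim_one_local) projective_resolution_extension:
  fixes P :: "('a, 'p) cplx" and M :: "('a, 'm) module" and W :: "('a, 'w) module"
  assumes fid: "finite_inj_dim TYPE('e) R (ring_module R)"
    and M: "module R M" "fin_gen R M" "torsion_free R M"
    and res: "projective_resolution R P \<pi> M"
    and i: "i \<ge> 1" "j = i - 1" and W: "dual_basis R W X \<iota>"
    and f: "f \<in> module_hom R (obj P i) W"
    and ker: "\<And>x. x \<in> carrier (obj P i) \<Longrightarrow> diff P i x = \<zero>\<^bsub>obj P j\<^esub> \<Longrightarrow> f x = \<zero>\<^bsub>W\<^esub>"
  obtains g where "g \<in> module_hom R (obj P j) W" "\<And>x. x \<in> carrier (obj P i) \<Longrightarrow> g (diff P i x) = f x"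
proof -
  let ?Po = "obj P 0" and ?P = "obj P i" and ?Pj = "obj P j" and ?d = "diff P i"
  have P: "chain_complex R P" and proj: "\<And>n. n \<ge> 0 \<Longrightarrow> projective_module R (obj P n)"
    and ac: "\<And>n. n \<ge> 1 \<Longrightarrow> zero_module (homology P n)"
    and \<pi>: "\<pi> \<in> module_hom R ?Po M" and surj: "\<pi> ` carrier ?Po = carrier M"
    and ex0: "{x \<in> carrier ?Po. \<pi> x = \<zero>\<^bsub>M\<^esub>} = boundaries P 0"
    using res by (auto simp: projective_resolution_def)
  note m = chain_complex_module[OF P]
  have di: "?d \<in> module_hom R ?P ?Pj" by (rule chain_complex_hom[OF P i(2)])
  have "\<exists>(C :: ('a, 'p) module) Y \<kappa> b. dual_basis R C Y \<kappa> \<and> b \<in> module_hom R ?Pj C \<and>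
      (\<forall>x\<in>carrier ?P. b (?d x) = \<zero>\<^bsub>C\<^esub>) \<and>
      (\<forall>y\<in>carrier ?Pj. b y = \<zero>\<^bsub>C\<^esub> \<longrightarrow> y \<in> ?d ` carrier ?P)"
  proof (cases "i = 1")
    case True
    then have j: "j = 0" using i by simp
    obtain S0 where S0: "finite S0" "S0 \<subseteq> carrier M" "module.span R M S0 = carrier M"
      using M(2) by (auto simp: fin_gen_def)
    then obtain S where S: "finite S" "S \<subseteq> carrier ?Po" "\<pi> ` S = S0"
      using surj by (metis finite_subset_image)
    have "\<pi> ` carrier ?Po \<subseteq> module.span R M (\<pi> ` S)" using S S0 surj by simp
    \<comment> \<open>\<open>e\<close> acts as a differential leaving degree 0: it kills the kernel
      of \<open>\<pi>\<close>, and nothing else because \<open>r\<close> is nonzero and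
      \<open>M\<close> torsion-free.\<close>
    then obtain r e where r: "r \<in> carrier R" "r \<noteq> \<zero>" and e: "e \<in> module_hom R ?Po ?Po"
      and qe: "\<And>p. p \<in> carrier ?Po \<Longrightarrow> \<pi> (e p) = r \<odot>\<^bsub>M\<^esub> \<pi> p"
      and ke: "\<And>p. p \<in> carrier ?Po \<Longrightarrow> \<pi> p = \<zero>\<^bsub>M\<^esub> \<Longrightarrow> e p = \<zero>\<^bsub>?Po\<^esub>"
      using rational_section[OF m M(1) \<pi> S(1,2)] by blast
    obtain \<kappa> where \<kappa>: "dual_basis R ?Po (carrier ?Po) \<kappa>"
      using projective_dual_basis[OF proj[of 0]] by auto
    have d1: "diff P 1 x \<in> carrier ?Po" "\<pi> (diff P 1 x) = \<zero>\<^bsub>M\<^esub>" if "x \<in> carrier (obj P 1)" for x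
    proof -
      have "diff P 1 x \<in> boundaries P 0" using that by (simp add: boundaries_def)
      then show "diff P 1 x \<in> carrier ?Po" "\<pi> (diff P 1 x) = \<zero>\<^bsub>M\<^esub>" unfolding ex0[symmetric] by auto
    qed
    have "p \<in> diff P 1 ` carrier (obj P 1)" if p: "p \<in> carrier ?Po" "e p = \<zero>\<^bsub>?Po\<^esub>" for p
    proof -
      have "r \<odot>\<^bsub>M\<^esub> \<pi> p = \<zero>\<^bsub>M\<^esub>" using qe[OF p(1)] p(2) hom_zero[OF m M(1) \<pi>] by simp
      then have "\<pi> p = \<zero>\<^bsub>M\<^esub>" using M(3) r hom_closed[OF \<pi> p(1)] by (auto simp: torsion_free_def)
      then have "p \<in> boundaries P 0" using p(1) unfolding ex0[symmetric] by blast
      then show ?thesis by (simp add: boundaries_def)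
    qed
    then show ?thesis
      unfolding True j using \<kappa> e d1 ke
      by (intro exI[of _ "?Po"] exI[of _ "carrier ?Po"] exI[of _ \<kappa>] exI[of _ e]) auto
  next
    case False
    then have ge: "j \<ge> 1" using i by simp
    obtain \<kappa> where \<kappa>: "dual_basis R (obj P (j - 1)) (carrier (obj P (j - 1))) \<kappa>"
      using projective_dual_basis[OF proj[of "j - 1"]] ge by auto
    show ?thesis
      using \<kappa> chain_complex_hom[OF P refl, of j] chain_complex_comp[OF P i(2) refl]
        chain_complex_exact[OF P ac[OF ge] refl, of i] i(2)
      by (intro exI[of _ "obj P (j - 1)"] exI[of _ "carrier (obj P (j - 1))"] exI[of _ \<kappa>] exI[of _ "diff P j"]) auto
  qed
  then obtain C :: "('a, 'p) module" and Y \<kappa> b where C: "dual_basis R C Y \<kappa>" "b \<in> module_hom R ?Pj C"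
      "\<And>x. x \<in> carrier ?P \<Longrightarrow> b (?d x) = \<zero>\<^bsub>C\<^esub>"
      "\<And>y. y \<in> carrier ?Pj \<Longrightarrow> b y = \<zero>\<^bsub>C\<^esub> \<Longrightarrow> y \<in> ?d ` carrier ?P"
    by blast
  show thesis
    by (rule extension_to_projective[OF fid m m C(1) W di C(2-4) f ker]) (assumption | rule that)+
qed

text \<open>The complex continues below every degree, so \<open>diff T j\<close> always serves as
  the second map and degree 0 needs no separate treatment.\<close>

lemma (in dim_one_local) acyclic_extension:
  fixes T :: "('a, 't) cplx" and W :: "('a, 'w) module"
  assumes fid: "finite_inj_dim TYPE('e) R (ring_module R)"
    and T: "chain_complex R T" and ac: "\<And>n. zero_module (homology T n)" and fr: "\<And>n. fin_gen_free R (obj T n)"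
    and j: "j = i - 1" and W: "dual_basis R W X \<iota>"
    and f: "f \<in> module_hom R (obj T i) W"
    and ker: "\<And>x. x \<in> carrier (obj T i) \<Longrightarrow> diff T i x = \<zero>\<^bsub>obj T j\<^esub> \<Longrightarrow> f x = \<zero>\<^bsub>W\<^esub>"
  obtains g where "g \<in> module_hom R (obj T j) W" "\<And>x. x \<in> carrier (obj T i) \<Longrightarrow> g (diff T i x) = f x"
proof -
  note m = chain_complex_module[OF T]
  obtain Y \<kappa> where C: "dual_basis R (obj T (j - 1)) Y \<kappa>" by (rule fin_gen_free_dual_basis[OF m fr])
  have ex: "y \<in> diff T i ` carrier (obj T i)" if "y \<in> carrier (obj T j)" "diff T j y = \<zero>\<^bsub>obj T (j - 1)\<^esub>" for y
    by (rule chain_complex_exact[OF T ac refl _ that]) (simp add: j)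
  show thesis
    by (rule extension_to_projective[OF fid m m C W chain_complex_hom[OF T j] chain_complex_hom[OF T refl]
          chain_complex_comp[OF T j refl] ex f ker]) (assumption | rule that)+
qed

section \<open>Comparison of the complete resolution with the projective resolution\<close>

text \<open>The two homotopy identities are required on boundaries only, so \<open>\<phi>\<close> is inverse to \<open>\<theta>\<close> up to
  homotopy and maps that factor through the cokernel of the incoming differential.\<close>

definition tate_inverse where
  "tate_inverse R T \<theta> P i \<phi> \<phi>' h k \<longleftrightarrow>
     \<phi> \<in> module_hom R (obj P i) (obj T i) \<and> \<phi>' \<in> module_hom R (obj P (i + 1)) (obj T (i + 1)) \<and>
     h \<in> module_hom R (obj P i) (obj P (i + 1)) \<and> k \<in> module_hom R (obj T i) (obj T (i + 1)) \<and>
     (\<forall>x\<in>carrier (obj P (i + 1)). \<phi> (diff P (i + 1) x) = diff T (i + 1) (\<phi>' x)) \<and>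
     (\<forall>x\<in>carrier (obj P (i + 1)). diff P (i + 1) x =
        \<theta> i (\<phi> (diff P (i + 1) x)) \<oplus>\<^bsub>obj P i\<^esub> diff P (i + 1) (h (diff P (i + 1) x))) \<and>
     (\<forall>x\<in>carrier (obj T (i + 1)). diff T (i + 1) x =
        \<phi> (\<theta> i (diff T (i + 1) x)) \<oplus>\<^bsub>obj T i\<^esub> diff T (i + 1) (k (diff T (i + 1) x)))"

lemma module_add_diff_cancel:
  assumes "module R A" "a \<in> carrier A" "y \<in> carrier A"
  shows "a \<oplus>\<^bsub>A\<^esub> (y \<ominus>\<^bsub>A\<^esub> (a \<oplus>\<^bsub>A\<^esub> \<zero>\<^bsub>A\<^esub>)) = y"
proof -
  interpret A: module R A by fact
  have "a \<oplus>\<^bsub>A\<^esub> (y \<oplus>\<^bsub>A\<^esub> (\<ominus>\<^bsub>A\<^esub> a)) = y \<oplus>\<^bsub>A\<^esub> (a \<oplus>\<^bsub>A\<^esub> (\<ominus>\<^bsub>A\<^esub> a))"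
    using assms(2,3) by (intro A.M.a_lcomm) simp_all
  then show ?thesis using assms(2,3) by (simp add: A.M.minus_eq A.M.r_neg)
qed

lemma chain_map_hom: "chain_map R C D \<theta> \<Longrightarrow> \<theta> n \<in> module_hom R (obj C n) (obj D n)"
  by (simp add: chain_map_def)

lemma chain_map_comm:
  "chain_map R C D \<theta> \<Longrightarrow> m = n - 1 \<Longrightarrow> x \<in> carrier (obj C n) \<Longrightarrow> \<theta> m (diff C n x) = diff D n (\<theta> n x)"
  by (simp add: chain_map_def)

context dim_one_local
begin

context
  fixes M :: "('a, 'm) module" and T :: "('a, 't) cplx" and P :: "('a, 'p) cplx"
    and \<theta> :: "int \<Rightarrow> 't \<Rightarrow> 'p" and \<pi> :: "'p \<Rightarrow> 'm"
  assumes fid: "finite_inj_dim TYPE('e) R (ring_module R)"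
    and M: "module R M" "fin_gen R M" "torsion_free R M"
    and res: "complete_resolution R T \<theta> P \<pi> M"
begin

text \<open>Each new map is an extension along a differential leaving degree \<open>i\<close>: of
  \<open>diff T i\<close> after \<open>\<phi>\<close>, and of the defects of the two homotopy
  identities. All three kill cycles, since cycles in degree \<open>i\<close> are boundaries and the
  old identities hold on boundaries. The old \<open>\<phi>\<close> takes the place of
  \<open>\<phi>'\<close>.\<close>

lemma tate_inverse_step:
  assumes i: "j \<ge> 0" "i = j + 1" and inv: "tate_inverse R T \<theta> P i \<phi> \<phi>' h k"
  shows "\<exists>\<phi>n hn kn. tate_inverse R T \<theta> P j \<phi>n \<phi> hn kn"
proof -
  let ?P' = "obj P (i + 1)" and ?T' = "obj T (i + 1)" and ?P = "obj P i" and ?T = "obj T i" and ?Pj = "obj P j" and ?Tj = "obj T j"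
  have T: "chain_complex R T" and Tf: "\<And>n. fin_gen_free R (obj T n)"
    and Tac: "\<And>n. zero_module (homology T n)"
    and \<theta>: "chain_map R T P \<theta>" and Pres: "projective_resolution R P \<pi> M"
    using res by (simp_all add: complete_resolution_def totally_acyclic_def)
  have P: "chain_complex R P" and Pac: "\<And>n. n \<ge> 1 \<Longrightarrow> zero_module (homology P n)"
    and proj: "\<And>n. n \<ge> 0 \<Longrightarrow> projective_module R (obj P n)"
    using Pres by (simp_all add: projective_resolution_def)
  note Tm = chain_complex_module[OF T] and Pm = chain_complex_module[OF P]
  have j: "j = i - 1" and i1: "i \<ge> 1" using i by simp_all
  let ?dP = "diff P i" and ?dT = "diff T i" and ?dP' = "diff P (i + 1)" and ?dT' = "diff T (i + 1)"
  have dP: "?dP \<in> module_hom R ?P ?Pj" and dT: "?dT \<in> module_hom R ?T ?Tj"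
    by (rule chain_complex_hom[OF P j], rule chain_complex_hom[OF T j])
  have dP': "?dP' \<in> module_hom R ?P' ?P" and dT': "?dT' \<in> module_hom R ?T' ?T"
    by (rule chain_complex_hom[OF P], simp, rule chain_complex_hom[OF T], simp)
  have ddP: "?dP (?dP' x) = \<zero>\<^bsub>?Pj\<^esub>" if "x \<in> carrier ?P'" for x
    using that by (intro chain_complex_comp[OF P]) (simp_all add: j)
  have ddT: "?dT (?dT' x) = \<zero>\<^bsub>?Tj\<^esub>" if "x \<in> carrier ?T'" for x
    using that by (intro chain_complex_comp[OF T]) (simp_all add: j)
  have exP: "x \<in> ?dP' ` carrier ?P'" if "x \<in> carrier ?P" "?dP x = \<zero>\<^bsub>?Pj\<^esub>" for x
    by (rule chain_complex_exact[OF P Pac[OF i1] j refl that])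
  have exT: "x \<in> ?dT' ` carrier ?T'" if "x \<in> carrier ?T" "?dT x = \<zero>\<^bsub>?Tj\<^esub>" for x
    by (rule chain_complex_exact[OF T Tac j refl that])
  note \<theta>i = chain_map_hom[OF \<theta>, of i] and \<theta>j = chain_map_hom[OF \<theta>, of j]
  have \<phi>: "\<phi> \<in> module_hom R ?P ?T" and \<phi>': "\<phi>' \<in> module_hom R ?P' ?T'"
    and h: "h \<in> module_hom R ?P ?P'" and k: "k \<in> module_hom R ?T ?T'"
    and E1: "\<And>x. x \<in> carrier ?P' \<Longrightarrow> \<phi> (?dP' x) = ?dT' (\<phi>' x)"
    and E2: "\<And>x. x \<in> carrier ?P' \<Longrightarrow> ?dP' x = \<theta> i (\<phi> (?dP' x)) \<oplus>\<^bsub>?P\<^esub> ?dP' (h (?dP' x))"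
    and E3: "\<And>x. x \<in> carrier ?T' \<Longrightarrow> ?dT' x = \<phi> (\<theta> i (?dT' x)) \<oplus>\<^bsub>?T\<^esub> ?dT' (k (?dT' x))"
    using inv unfolding tate_inverse_def by blast+
  obtain X \<iota> where bT: "dual_basis R ?Tj X \<iota>" by (rule fin_gen_free_dual_basis[OF Tm Tf])
  obtain X2 \<iota>2 where bT2: "dual_basis R ?T X2 \<iota>2" by (rule fin_gen_free_dual_basis[OF Tm Tf])
  obtain \<kappa> where bP: "dual_basis R ?P (carrier ?P) \<kappa>"
    using projective_dual_basis[OF proj[of i]] i1 by auto
  have ker1: "?dT (\<phi> x) = \<zero>\<^bsub>?Tj\<^esub>" if x: "x \<in> carrier ?P" "?dP x = \<zero>\<^bsub>?Pj\<^esub>" for x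
  proof -
    obtain z where z: "z \<in> carrier ?P'" "x = ?dP' z" using exP[OF x] by blast
    then show ?thesis using E1 ddT hom_closed[OF \<phi>'] by simp
  qed
  obtain \<phi>n where \<phi>n: "\<phi>n \<in> module_hom R ?Pj ?Tj"
    "\<And>x. x \<in> carrier ?P \<Longrightarrow> \<phi>n (?dP x) = ?dT (\<phi> x)"
    by (rule projective_resolution_extension[OF fid M Pres i1 j bT hom_comp[OF \<phi> dT] ker1]) (assumption | blast)+
  \<comment> \<open>The defect of the homotopy identity in degree \<open>i\<close>. By
    \<open>E2\<close> it vanishes on boundaries, so it is some map after \<open>?dP\<close>; that
    map is the next homotopy.\<close>
  define v where "v x = x \<ominus>\<^bsub>?P\<^esub> (\<theta> i (\<phi> x) \<oplus>\<^bsub>?P\<^esub> ?dP' (h x))" for x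
  have v: "v \<in> module_hom R ?P ?P"
    unfolding v_def
    by (rule hom_diff[OF Pm hom_id hom_plus[OF Pm hom_comp[OF \<phi> \<theta>i] hom_comp[OF h dP']]])
  have ker2: "v x = \<zero>\<^bsub>?P\<^esub>" if x: "x \<in> carrier ?P" "?dP x = \<zero>\<^bsub>?Pj\<^esub>" for x
  proof -
    obtain z where z: "z \<in> carrier ?P'" "x = ?dP' z" using exP[OF x] by blast
    have "x = \<theta> i (\<phi> x) \<oplus>\<^bsub>?P\<^esub> ?dP' (h x)" using E2[OF z(1)] z(2) by simp
    then show ?thesis unfolding v_def using x(1) module_diff_eq_zero[OF Pm x(1)] by metis
  qed
  obtain hn where hn: "hn \<in> module_hom R ?Pj ?P"
    "\<And>x. x \<in> carrier ?P \<Longrightarrow> hn (?dP x) = v x"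
    by (rule projective_resolution_extension[OF fid M Pres i1 j bP v ker2]) (assumption | blast)+
  define w where "w x = x \<ominus>\<^bsub>?T\<^esub> (\<phi> (\<theta> i x) \<oplus>\<^bsub>?T\<^esub> ?dT' (k x))" for x
  have w: "w \<in> module_hom R ?T ?T"
    unfolding w_def
    by (rule hom_diff[OF Tm hom_id hom_plus[OF Tm hom_comp[OF \<theta>i \<phi>] hom_comp[OF k dT']]])
  have ker3: "w x = \<zero>\<^bsub>?T\<^esub>" if x: "x \<in> carrier ?T" "?dT x = \<zero>\<^bsub>?Tj\<^esub>" for x
  proof -
    obtain z where z: "z \<in> carrier ?T'" "x = ?dT' z" using exT[OF x] by blast
    have "x = \<phi> (\<theta> i x) \<oplus>\<^bsub>?T\<^esub> ?dT' (k x)" using E3[OF z(1)] z(2) by simp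
    then show ?thesis unfolding w_def using x(1) module_diff_eq_zero[OF Tm x(1)] by metis
  qed
  obtain kn where kn: "kn \<in> module_hom R ?Tj ?T"
    "\<And>x. x \<in> carrier ?T \<Longrightarrow> kn (?dT x) = w x"
    by (rule acyclic_extension[OF fid T Tac Tf j bT2 w ker3]) (assumption | blast)+
  have E2n: "?dP x = \<theta> j (\<phi>n (?dP x)) \<oplus>\<^bsub>?Pj\<^esub> ?dP (hn (?dP x))" if x: "x \<in> carrier ?P" for x
  proof -
    note \<phi>x = hom_closed[OF \<phi> x] and hx = hom_closed[OF h x]
    have 1: "\<theta> j (\<phi>n (?dP x)) = ?dP (\<theta> i (\<phi> x))"
      using \<phi>n(2)[OF x] chain_map_comm[OF \<theta> j \<phi>x] by simp
    \<comment> \<open>Applying the differential removes the old homotopy term, which is a boundary,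
      so only the new homotopy remains in degree \<open>j\<close>.\<close>
    have 2: "?dP (v x) = ?dP x \<ominus>\<^bsub>?Pj\<^esub> (?dP (\<theta> i (\<phi> x)) \<oplus>\<^bsub>?Pj\<^esub> \<zero>\<^bsub>?Pj\<^esub>)"
      unfolding v_def
      using x hom_closed[OF \<theta>i \<phi>x] hom_closed[OF dP' hx] ddP[OF hx]
      by (simp add: module_add_closed[OF Pm] hom_minus[OF Pm Pm dP] hom_add[OF dP])
    show ?thesis unfolding 1 hn(2)[OF x] 2
      by (rule module_add_diff_cancel[OF Pm, symmetric]) (rule hom_closed[OF dP hom_closed[OF \<theta>i \<phi>x]], rule hom_closed[OF dP x])
  qed
  have E3n: "?dT x = \<phi>n (\<theta> j (?dT x)) \<oplus>\<^bsub>?Tj\<^esub> ?dT (kn (?dT x))" if x: "x \<in> carrier ?T" for x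
  proof -
    note \<theta>x = hom_closed[OF \<theta>i x] and kx = hom_closed[OF k x]
    have 1: "\<phi>n (\<theta> j (?dT x)) = ?dT (\<phi> (\<theta> i x))"
      using \<phi>n(2)[OF \<theta>x] chain_map_comm[OF \<theta> j x] by simp
    have 2: "?dT (w x) = ?dT x \<ominus>\<^bsub>?Tj\<^esub> (?dT (\<phi> (\<theta> i x)) \<oplus>\<^bsub>?Tj\<^esub> \<zero>\<^bsub>?Tj\<^esub>)"
      unfolding w_def
      using x hom_closed[OF \<phi> \<theta>x] hom_closed[OF dT' kx] ddT[OF kx]
      by (simp add: module_add_closed[OF Tm] hom_minus[OF Tm Tm dT] hom_add[OF dT])
    show ?thesis unfolding 1 kn(2)[OF x] 2
      by (rule module_add_diff_cancel[OF Tm, symmetric]) (rule hom_closed[OF dT hom_closed[OF \<phi> \<theta>x]], rule hom_closed[OF dT x])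
  qed
  have "tate_inverse R T \<theta> P j \<phi>n \<phi> hn kn"
    unfolding tate_inverse_def i(2)[symmetric] using \<phi>n hn(1) kn(1) \<phi> E2n E3n by blast
  then show ?thesis by blast
qed

lemma tate_inverse_exists:
  obtains \<phi> \<phi>' h k where "tate_inverse R T \<theta> P 0 \<phi> \<phi>' h k"
proof -
  have T: "chain_complex R T" and \<theta>: "chain_map R T P \<theta>" and P: "chain_complex R P"
    and "\<exists>n. \<forall>i\<ge>n. bij_betw (\<theta> i) (carrier (obj T i)) (carrier (obj P i))"
    using res by (simp_all add: complete_resolution_def totally_acyclic_def projective_resolution_def)
  then obtain n where bij: "\<And>i. i \<ge> n \<Longrightarrow> bij_betw (\<theta> i) (carrier (obj T i)) (carrier (obj P i))" by blast
  note Tm = chain_complex_module[OF T] and Pm = chain_complex_module[OF P]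
  define \<psi> where "\<psi> i = inv_into (carrier (obj T i)) (\<theta> i)" for i
  have \<psi>: "\<psi> i \<in> module_hom R (obj P i) (obj T i)" if "i \<ge> n" for i
    unfolding \<psi>_def by (rule hom_inv_into[OF Tm chain_map_hom[OF \<theta>] bij[OF that]])
  have \<theta>\<psi>: "\<theta> i (\<psi> i x) = x" if "i \<ge> n" "x \<in> carrier (obj P i)" for i x
    unfolding \<psi>_def by (rule bij_betw_inv_into_right[OF bij[OF that(1)] that(2)])
  have \<psi>\<theta>: "\<psi> i (\<theta> i x) = x" if "i \<ge> n" "x \<in> carrier (obj T i)" for i x
    unfolding \<psi>_def by (rule bij_betw_inv_into_left[OF bij[OF that(1)] that(2)])
  have base: "\<exists>\<phi> \<phi>' h k. tate_inverse R T \<theta> P i \<phi> \<phi>' h k" if i: "i \<ge> n" for i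
  proof -
    let ?P' = "obj P (i + 1)" and ?T' = "obj T (i + 1)" and ?P = "obj P i" and ?T = "obj T i" and ?dP = "diff P (i + 1)" and ?dT = "diff T (i + 1)"
    have i': "i + 1 \<ge> n" using i by simp
    have dP: "?dP \<in> module_hom R ?P' ?P"
      and dT: "?dT \<in> module_hom R ?T' ?T"
      by (rule chain_complex_hom[OF P], simp, rule chain_complex_hom[OF T], simp)
    have zP: "x = x \<oplus>\<^bsub>?P\<^esub> \<zero>\<^bsub>?P\<^esub>" if "x \<in> carrier ?P" for x
      using abelian_monoid.r_zero[OF abelian_group.axioms(1)[OF module.axioms(2)[OF Pm]] that] by simp
    have zT: "x = x \<oplus>\<^bsub>?T\<^esub> \<zero>\<^bsub>?T\<^esub>" if "x \<in> carrier ?T" for x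
      using abelian_monoid.r_zero[OF abelian_group.axioms(1)[OF module.axioms(2)[OF Tm]] that] by simp
    have "tate_inverse R T \<theta> P i (\<psi> i) (\<psi> (i + 1)) (\<lambda>x. \<zero>\<^bsub>?P'\<^esub>) (\<lambda>x. \<zero>\<^bsub>?T'\<^esub>)"
      unfolding tate_inverse_def
    proof (intro conjI ballI)
      fix x assume x: "x \<in> carrier ?P'"
      note y = hom_closed[OF \<psi>[OF i'] x]
      have "\<theta> i (?dT (\<psi> (i + 1) x)) = ?dP (\<theta> (i + 1) (\<psi> (i + 1) x))"
        by (rule chain_map_comm[OF \<theta> _ y]) simp
      then have "?dP x = \<theta> i (?dT (\<psi> (i + 1) x))" using \<theta>\<psi>[OF i' x] by simp
      then show "\<psi> i (?dP x) = ?dT (\<psi> (i + 1) x)"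
        using \<psi>\<theta>[OF i hom_closed[OF dT y]] by simp
      show "?dP x = \<theta> i (\<psi> i (?dP x)) \<oplus>\<^bsub>?P\<^esub> ?dP \<zero>\<^bsub>?P'\<^esub>"
        unfolding hom_zero[OF Pm Pm dP] \<theta>\<psi>[OF i hom_closed[OF dP x]] by (rule zP[OF hom_closed[OF dP x]])
    next
      fix x assume x: "x \<in> carrier ?T'"
      show "?dT x = \<psi> i (\<theta> i (?dT x)) \<oplus>\<^bsub>?T\<^esub> ?dT \<zero>\<^bsub>?T'\<^esub>"
        unfolding hom_zero[OF Tm Tm dT] \<psi>\<theta>[OF i hom_closed[OF dT x]] by (rule zT[OF hom_closed[OF dT x]])
    qed (rule \<psi>[OF i] \<psi>[OF i'] hom_const_zero[OF Pm] hom_const_zero[OF Tm])+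
    then show ?thesis by blast
  qed
  have "\<exists>\<phi> \<phi>' h k. tate_inverse R T \<theta> P (int m) \<phi> \<phi>' h k \<Longrightarrow> \<exists>\<phi> \<phi>' h k. tate_inverse R T \<theta> P 0 \<phi> \<phi>' h k" for m
  proof (induction m)
    case (Suc m)
    then obtain \<phi> \<phi>' h k where "tate_inverse R T \<theta> P (int (Suc m)) \<phi> \<phi>' h k" by blast
    from tate_inverse_step[OF _ _ this, of "int m"] Suc.IH show ?case by auto
  qed simp
  \<comment> \<open>\<open>n\<close> may be negative; \<open>int (nat n)\<close> is the larger of
    \<open>n\<close> and 0 and hence a degree from which to descend.\<close>
  from this[of "nat n"] base[of "int (nat n)"] show thesis using that by auto
qed

end

end

section \<open>Tate homology in degree zero\<close>

lemma tensor_map_id_sum3: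
  assumes A: "module R A" and N: "module R N"
    and f: "f \<in> module_hom R A A" and g: "g \<in> module_hom R A A" and h: "h \<in> module_hom R A A"
    and eq: "\<And>x. x \<in> carrier A \<Longrightarrow> x = f x \<oplus>\<^bsub>A\<^esub> g x \<oplus>\<^bsub>A\<^esub> h x"
    and t: "t \<in> carrier (tensor_product R A N)"
  shows "t = tensor_map R A A N f t \<oplus>\<^bsub>tensor_product R A N\<^esub> tensor_map R A A N g t
    \<oplus>\<^bsub>tensor_product R A N\<^esub> tensor_map R A A N h t"
proof -
  note fg = hom_plus[OF A f g]
  have "t = tensor_map R A A N (\<lambda>x. x) t" by (rule tensor_map_id[OF A N hom_id _ t, symmetric]) simp
  also have "\<dots> = tensor_map R A A N (\<lambda>x. f x \<oplus>\<^bsub>A\<^esub> g x) t \<oplus>\<^bsub>tensor_product R A N\<^esub> tensor_map R A A N h t"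
    by (rule tensor_map_plus[OF A A N fg h hom_id eq t])
  also have "tensor_map R A A N (\<lambda>x. f x \<oplus>\<^bsub>A\<^esub> g x) t =
      tensor_map R A A N f t \<oplus>\<^bsub>tensor_product R A N\<^esub> tensor_map R A A N g t"
    by (rule tensor_map_plus[OF A A N f g fg refl t])
  finally show ?thesis .
qed

lemma module_sub_add_cancel:
  assumes "module R A" "x \<in> carrier A" "y \<in> carrier A"
  shows "y \<oplus>\<^bsub>A\<^esub> (x \<ominus>\<^bsub>A\<^esub> y) = x"
proof -
  interpret A: module R A by fact
  have "y \<oplus>\<^bsub>A\<^esub> (x \<oplus>\<^bsub>A\<^esub> (\<ominus>\<^bsub>A\<^esub> y)) = x \<oplus>\<^bsub>A\<^esub> (y \<oplus>\<^bsub>A\<^esub> (\<ominus>\<^bsub>A\<^esub> y))"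
    using assms(2,3) by (intro A.M.a_lcomm) simp_all
  then show ?thesis using assms(2,3) by (simp add: A.M.minus_eq A.M.r_neg)
qed

text \<open>Over the fraction field an exact complex of free modules is contractible; clearing
  denominators leaves a contraction of multiplication by some nonzero \<open>r\<close>.\<close>

lemma (in domain) rational_contraction:
  fixes T :: "('a, 't) cplx"
  assumes T: "chain_complex R T" and Tf: "\<And>n. fin_gen_free R (obj T n)"
    and Tac: "\<And>n. zero_module (homology T n)"
  obtains r l k where "r \<in> carrier R" "r \<noteq> \<zero>"
    "l \<in> module_hom R (obj T 0) (obj T 1)" "k \<in> module_hom R (obj T (- 1)) (obj T 0)"
    "\<And>x. x \<in> carrier (obj T 0) \<Longrightarrow> r \<odot>\<^bsub>obj T 0\<^esub> x = diff T 1 (l x) \<oplus>\<^bsub>obj T 0\<^esub> k (diff T 0 x)"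
proof -
  let ?C = "obj T (- 2)" and ?B = "obj T (- 1)" and ?A = "obj T 0" and ?At = "obj T 1"
  let ?d = "diff T (- 1)" and ?do = "diff T 0" and ?dt = "diff T 1"
  note m = chain_complex_module[OF T]
  have d1: "?dt \<in> module_hom R ?At ?A" by (rule chain_complex_hom[OF T]) simp
  have d0: "?do \<in> module_hom R ?A ?B" by (rule chain_complex_hom[OF T]) simp
  have dm: "?d \<in> module_hom R ?B ?C" by (rule chain_complex_hom[OF T]) simp
  obtain S where S: "finite S" "S \<subseteq> carrier ?B" "module.span R ?B S = carrier ?B"
    using Tf[of "- 1"] by (auto simp: fin_gen_free_def)
  \<comment> \<open>This submodule contains \<open>S\<close> and is therefore everything, which
    shows that the images of \<open>S\<close> generate the image of \<open>?d\<close>.\<close>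
  let ?V = "{x \<in> carrier ?B. ?d x \<in> module.span R ?C (?d ` S)}"
  have imS: "?d ` S \<subseteq> carrier ?C" using S(2) hom_closed[OF dm] by blast
  note sp = module.span_is_submodule[OF m imS]
  have V: "submodule R ?V ?B"
  proof (rule submodule_of_closed[OF m])
    show "\<zero>\<^bsub>?B\<^esub> \<in> ?V"
      using module_zero_closed[OF m] hom_zero[OF m m dm] submodule.zero_closed[OF sp] by simp
    show "x \<oplus>\<^bsub>?B\<^esub> y \<in> ?V" if "x \<in> ?V" "y \<in> ?V" for x y
      using that submodule.m_closed[OF sp] by (simp add: hom_add[OF dm] module_add_closed[OF m])
    show "r \<odot>\<^bsub>?B\<^esub> x \<in> ?V" if "r \<in> carrier R" "x \<in> ?V" for r x
      using that submodule.smult_closed[OF sp] module.smult_closed[OF m] by (simp add: hom_smult[OF dm])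
  qed blast
  have "S \<subseteq> ?V" using S(2) module.in_own_span[OF m imS] by blast
  from module.span_is_subset[OF m this V] have "carrier ?B \<subseteq> ?V" unfolding S(3) .
  then have gen: "?d ` carrier ?B \<subseteq> module.span R ?C (?d ` S)" by blast
  obtain r e where r: "r \<in> carrier R" "r \<noteq> \<zero>" and e: "e \<in> module_hom R ?B ?B"
    and de: "\<And>p. p \<in> carrier ?B \<Longrightarrow> ?d (e p) = r \<odot>\<^bsub>?C\<^esub> ?d p"
    and ke: "\<And>p. p \<in> carrier ?B \<Longrightarrow> ?d p = \<zero>\<^bsub>?C\<^esub> \<Longrightarrow> e p = \<zero>\<^bsub>?B\<^esub>"
    by (rule rational_section[OF m m dm S(1,2) gen]) blast
  have rs: "(\<lambda>x. r \<odot>\<^bsub>obj T n\<^esub> x) \<in> module_hom R (obj T n) (obj T n)" for n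
    by (rule hom_scale[OF m hom_id r(1)])
  \<comment> \<open>Multiplication by \<open>r\<close> minus \<open>e\<close> lands in the cycles,
    because \<open>?d\<close> after \<open>e\<close> is \<open>r\<close> times \<open>?d\<close>. By
    exactness its values are boundaries, and as \<open>?B\<close> is free it lifts along
    \<open>?do\<close> to \<open>k\<close>.\<close>
  note re = hom_diff[OF m rs e]
  have "r \<odot>\<^bsub>?B\<^esub> x \<ominus>\<^bsub>?B\<^esub> e x \<in> ?do ` carrier ?A" if x: "x \<in> carrier ?B" for x
  proof (rule chain_complex_exact[OF T Tac _ _ hom_closed[OF re x]])
    show "?d (r \<odot>\<^bsub>?B\<^esub> x \<ominus>\<^bsub>?B\<^esub> e x) = \<zero>\<^bsub>?C\<^esub>"
      using hom_closed[OF rs x] hom_closed[OF e x] hom_closed[OF dm x] x r(1) module.smult_closed[OF m r(1)]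
      by (simp add: hom_minus[OF m m dm] hom_smult[OF dm] de module_diff_eq_zero[OF m])
  qed simp_all
  then have im: "(\<lambda>x. r \<odot>\<^bsub>?B\<^esub> x \<ominus>\<^bsub>?B\<^esub> e x) ` carrier ?B \<subseteq> ?do ` carrier ?A" by blast
  obtain X \<iota> where b: "dual_basis R ?B X \<iota>" by (rule fin_gen_free_dual_basis[OF m Tf])
  obtain k where k: "k \<in> module_hom R ?B ?A"
    "\<And>x. x \<in> carrier ?B \<Longrightarrow> ?do (k x) = r \<odot>\<^bsub>?B\<^esub> x \<ominus>\<^bsub>?B\<^esub> e x"
    by (rule dual_basis_lift[OF b m m d0 re im]) blast
  note kd = hom_comp[OF d0 k(1)]
  \<comment> \<open>On the image of \<open>?do\<close> the map \<open>e\<close> vanishes, so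
    \<open>?do (k (?do x))\<close> is \<open>r\<close> times \<open>?do x\<close>. The remaining
    defect thus lands in the cycles of degree 0 and lifts along \<open>?dt\<close> to
    \<open>l\<close>.\<close>
  note rk = hom_diff[OF m rs kd]
  have "r \<odot>\<^bsub>?A\<^esub> x \<ominus>\<^bsub>?A\<^esub> k (?do x) \<in> ?dt ` carrier ?At" if x: "x \<in> carrier ?A" for x
  proof (rule chain_complex_exact[OF T Tac _ _ hom_closed[OF rk x]])
    note dx = hom_closed[OF d0 x]
    have "?d (?do x) = \<zero>\<^bsub>?C\<^esub>" by (rule chain_complex_comp[OF T _ _ x]) simp_all
    then have "e (?do x) = \<zero>\<^bsub>?B\<^esub>" by (rule ke[OF dx])
    then have "?do (k (?do x)) = r \<odot>\<^bsub>?B\<^esub> ?do x"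
      using k(2)[OF dx] module_minus_zero[OF m hom_closed[OF rs dx]] by simp
    then show "?do (r \<odot>\<^bsub>?A\<^esub> x \<ominus>\<^bsub>?A\<^esub> k (?do x)) = \<zero>\<^bsub>?B\<^esub>"
      using hom_closed[OF rs x] hom_closed[OF kd x] x r(1) hom_closed[OF rs dx]
      by (simp add: hom_minus[OF m m d0] hom_smult[OF d0] module_diff_eq_zero[OF m])
  qed simp_all
  then have im': "(\<lambda>x. r \<odot>\<^bsub>?A\<^esub> x \<ominus>\<^bsub>?A\<^esub> k (?do x)) ` carrier ?A \<subseteq> ?dt ` carrier ?At" by blast
  obtain X' \<iota>' where b': "dual_basis R ?A X' \<iota>'" by (rule fin_gen_free_dual_basis[OF m Tf])
  obtain l where l: "l \<in> module_hom R ?A ?At"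
    "\<And>x. x \<in> carrier ?A \<Longrightarrow> ?dt (l x) = r \<odot>\<^bsub>?A\<^esub> x \<ominus>\<^bsub>?A\<^esub> k (?do x)"
    by (rule dual_basis_lift[OF b' m m d1 rk im']) blast
  show thesis
  proof (rule that[OF r l(1) k(1)])
    fix x assume x: "x \<in> carrier ?A"
    show "r \<odot>\<^bsub>?A\<^esub> x = ?dt (l x) \<oplus>\<^bsub>?A\<^esub> k (?do x)"
      unfolding l(2)[OF x]
      using module_sub_add_cancel[OF m hom_closed[OF rs x] hom_closed[OF kd x]]
        abelian_monoid.a_comm[OF abelian_group.axioms(1)[OF module.axioms(2)[OF m]] hom_closed[OF rk x] hom_closed[OF kd x]]
      by simp
  qed
qed

theorem corollary2p11:
  fixes R :: "('a, 'r) ring_scheme"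
    and M :: "('a, 'm) module" and N :: "('a, 'n) module"
    and T :: "('a, 't) cplx" and P :: "('a, 'p) cplx"
    and \<theta> :: "int \<Rightarrow> 't \<Rightarrow> 'p" and \<pi> :: "'p \<Rightarrow> 'm"
  assumes "domain R"
    and "gorenstein_local_ring TYPE('e) R"
    and "krull_dim R = 1"
    and "module R M" and "fin_gen R M" and "torsion_free R M"
    and "module R N" and "fin_gen R N" and "torsion_free R N"
    and "complete_resolution R T \<theta> P \<pi> M"
  shows "torsion_free R (tensor_product R M N) \<longleftrightarrow> zero_module (tate_Tor R T N 0)"
proof -
  let ?B = "obj T (- 1)" and ?A = "obj T 0" and ?At = "obj T 1" and ?P = "obj P 0" and ?Pt = "obj P 1"
  let ?dt = "diff T 1" and ?do = "diff T 0" and ?et = "diff P 1"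
  interpret domain R by fact
  have fid: "finite_inj_dim TYPE('e) R (ring_module R)" and noeth: "noetherian_ring R" and loc: "local_ring R"
    using assms(2) by (simp_all add: gorenstein_local_ring_def)
  obtain \<mm> where "dim_one_local R \<mm>" by (rule krull_dim_one_local[OF noeth loc assms(3)])
  then interpret dim_one_local R \<mm> .
  note M = assms(4-6) and N = assms(7,9) and res = assms(10)
  have T: "chain_complex R T" and Tf: "\<And>n. fin_gen_free R (obj T n)"
    and Tac: "\<And>n. zero_module (homology T n)"
    and \<theta>: "chain_map R T P \<theta>" and Pres: "projective_resolution R P \<pi> M"
    using res by (simp_all add: complete_resolution_def totally_acyclic_def)
  have P: "chain_complex R P" and proj: "projective_module R ?P"
    and \<pi>: "\<pi> \<in> module_hom R ?P M" and surj: "\<pi> ` carrier ?P = carrier M"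
    and ex0: "{x \<in> carrier ?P. \<pi> x = \<zero>\<^bsub>M\<^esub>} = ?et ` carrier ?Pt"
    using Pres by (simp_all add: projective_resolution_def boundaries_def)
  note Tm = chain_complex_module[OF T] and Pm = chain_complex_module[OF P]
  have dT1: "?dt \<in> module_hom R ?At ?A" by (rule chain_complex_hom[OF T]) simp
  have dT0: "?do \<in> module_hom R ?A ?B" by (rule chain_complex_hom[OF T]) simp
  have dP1: "?et \<in> module_hom R ?Pt ?P" by (rule chain_complex_hom[OF P]) simp
  note \<theta>0 = chain_map_hom[OF \<theta>, of 0] and \<theta>1 = chain_map_hom[OF \<theta>, of 1]
  obtain \<phi> \<phi>' h k where inv: "tate_inverse R T \<theta> P 0 \<phi> \<phi>' h k"
    by (rule tate_inverse_exists[OF fid M res])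
  then have \<phi>: "\<phi> \<in> module_hom R ?P ?A" and \<phi>': "\<phi>' \<in> module_hom R ?Pt ?At"
    and h: "h \<in> module_hom R ?P ?Pt" and k: "k \<in> module_hom R ?A ?At"
    and E1: "\<And>x. x \<in> carrier ?Pt \<Longrightarrow> \<phi> (?et x) = ?dt (\<phi>' x)"
    and E2: "\<And>x. x \<in> carrier ?Pt \<Longrightarrow> ?et x = \<theta> 0 (\<phi> (?et x)) \<oplus>\<^bsub>?P\<^esub> ?et (h (?et x))"
    and E3: "\<And>x. x \<in> carrier ?At \<Longrightarrow> ?dt x = \<phi> (\<theta> 0 (?dt x)) \<oplus>\<^bsub>?A\<^esub> ?dt (k (?dt x))"
    unfolding tate_inverse_def by auto
  let ?MN = "tensor_product R M N"
  define TN where "TN n = tensor_product R (obj T n) N" for n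
  define PN where "PN n = tensor_product R (obj P n) N" for n
  define D1 where "D1 = tensor_map R ?At ?A N ?dt"
  define D0 where "D0 = tensor_map R ?A ?B N ?do"
  define Q1 where "Q1 = tensor_map R ?Pt ?P N ?et"
  define \<Lambda> where "\<Lambda> = tensor_map R ?P M N \<pi>"
  define \<Theta> where "\<Theta> = tensor_map R ?A ?P N (\<theta> 0)"
  define \<Phi> where "\<Phi> = tensor_map R ?P ?A N \<phi>"
  define \<Phi>' where "\<Phi>' = tensor_map R ?Pt ?At N \<phi>'"
  note MNm = module_tensor[OF M(1) N(1)]
  have TNm: "module R (TN n)" for n unfolding TN_def by (rule module_tensor[OF Tm N(1)])
  have PNm: "module R (PN n)" for n unfolding PN_def by (rule module_tensor[OF Pm N(1)])
  have D1: "D1 \<in> module_hom R (TN 1) (TN 0)" and D0: "D0 \<in> module_hom R (TN 0) (TN (- 1))"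
    unfolding D1_def D0_def TN_def by (rule hom_tensor_map[OF Tm Tm N(1)], fact)+
  have Q1: "Q1 \<in> module_hom R (PN 1) (PN 0)" unfolding Q1_def PN_def by (rule hom_tensor_map[OF Pm Pm N(1) dP1])
  have \<Lambda>: "\<Lambda> \<in> module_hom R (PN 0) ?MN" unfolding \<Lambda>_def PN_def by (rule hom_tensor_map[OF Pm M(1) N(1) \<pi>])
  have \<Theta>: "\<Theta> \<in> module_hom R (TN 0) (PN 0)" unfolding \<Theta>_def PN_def TN_def by (rule hom_tensor_map[OF Tm Pm N(1) \<theta>0])
  have \<Phi>: "\<Phi> \<in> module_hom R (PN 0) (TN 0)" unfolding \<Phi>_def PN_def TN_def by (rule hom_tensor_map[OF Pm Tm N(1) \<phi>])
  have \<Phi>': "\<Phi>' \<in> module_hom R (PN 1) (TN 1)" unfolding \<Phi>'_def PN_def TN_def by (rule hom_tensor_map[OF Pm Tm N(1) \<phi>'])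
  have homology: "zero_module (tate_Tor R T N 0) \<longleftrightarrow> (\<forall>t\<in>carrier (TN 0). D0 t = \<zero>\<^bsub>TN (- 1)\<^esub> \<longrightarrow> t \<in> D1 ` carrier (TN 1))"
    unfolding tate_Tor_def zero_homology_iff[OF chain_complex_tensor[OF T N(1)]]
    by (auto simp: cycles_def boundaries_def tensor_complex_def TN_def D1_def D0_def)
  have DD: "D0 (D1 t) = \<zero>\<^bsub>TN (- 1)\<^esub>" if t: "t \<in> carrier (TN 1)" for t
    using chain_complex_comp[OF chain_complex_tensor[OF T N(1)], of 0 1 "- 1" t] t
    by (simp add: tensor_complex_def TN_def D1_def D0_def)
  have \<Phi>Q: "\<Phi> (Q1 t) = D1 (\<Phi>' t)" if t: "t \<in> carrier (PN 1)" for t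
  proof -
    have "tensor_map R ?Pt ?A N (\<lambda>x. \<phi> (?et x)) t = \<Phi> (Q1 t)"
      unfolding \<Phi>_def Q1_def
      by (rule tensor_map_comp[OF Pm Pm Tm N(1) dP1 \<phi> hom_comp[OF dP1 \<phi>] refl t[unfolded PN_def]])
    moreover have "tensor_map R ?Pt ?A N (\<lambda>x. \<phi> (?et x)) t = D1 (\<Phi>' t)"
      unfolding \<Phi>'_def D1_def
      by (rule tensor_map_comp[OF Pm Tm Tm N(1) \<phi>' dT1 hom_comp[OF dP1 \<phi>] E1 t[unfolded PN_def]])
    ultimately show ?thesis by simp
  qed
  have \<Lambda>\<Theta>D: "\<Lambda> (\<Theta> (D1 t)) = \<zero>\<^bsub>?MN\<^esub>" if t: "t \<in> carrier (TN 1)" for t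
  proof -
    note c = hom_comp[OF dT1 \<theta>0]
    have "tensor_map R ?At ?P N (\<lambda>x. \<theta> 0 (?dt x)) t = \<Theta> (D1 t)"
      unfolding \<Theta>_def D1_def
      by (rule tensor_map_comp[OF Tm Tm Pm N(1) dT1 \<theta>0 c refl t[unfolded TN_def]])
    then have "\<Lambda> (\<Theta> (D1 t)) = tensor_map R ?At M N (\<lambda>x. \<pi> (\<theta> 0 (?dt x))) t"
      unfolding \<Lambda>_def
      using tensor_map_comp[OF Tm Pm M(1) N(1) c \<pi> hom_comp[OF c \<pi>] refl t[unfolded TN_def]] by simp
    also have "\<dots> = \<zero>\<^bsub>?MN\<^esub>"
    proof (rule tensor_map_zero[OF Tm M(1) N(1) hom_comp[OF c \<pi>] _ t[unfolded TN_def]])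
      fix x assume x: "x \<in> carrier ?At"
      have "\<theta> 0 (?dt x) = ?et (\<theta> 1 x)" by (rule chain_map_comm[OF \<theta> _ x]) simp
      then have "\<theta> 0 (?dt x) \<in> {x \<in> carrier ?P. \<pi> x = \<zero>\<^bsub>M\<^esub>}"
        unfolding ex0 using hom_closed[OF \<theta>1 x] by blast
      then show "\<pi> (\<theta> 0 (?dt x)) = \<zero>\<^bsub>M\<^esub>" by blast
    qed
    finally show ?thesis .
  qed
  have \<Lambda>exact: "t \<in> Q1 ` carrier (PN 1)" if "t \<in> carrier (PN 0)" "\<Lambda> t = \<zero>\<^bsub>?MN\<^esub>" for t
    unfolding Q1_def PN_def
    by (rule tensor_right_exact[OF Pm Pm M(1) N(1) dP1 \<pi> surj])
      (use ex0 that in \<open>auto simp: PN_def \<Lambda>_def\<close>)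
  have \<Lambda>Q: "\<Lambda> (Q1 t) = \<zero>\<^bsub>?MN\<^esub>" if t: "t \<in> carrier (PN 1)" for t
  proof -
    have "tensor_map R ?Pt M N (\<lambda>x. \<pi> (?et x)) t = \<Lambda> (Q1 t)"
      unfolding \<Lambda>_def Q1_def
      by (rule tensor_map_comp[OF Pm Pm M(1) N(1) dP1 \<pi> hom_comp[OF dP1 \<pi>] refl t[unfolded PN_def]])
    moreover have "tensor_map R ?Pt M N (\<lambda>x. \<pi> (?et x)) t = \<zero>\<^bsub>?MN\<^esub>"
      by (rule tensor_map_zero[OF Pm M(1) N(1) hom_comp[OF dP1 \<pi>] _ t[unfolded PN_def]])
        (use ex0 in blast)
    ultimately show ?thesis by simp
  qed
  interpret TN0: module R "TN 0" by (rule TNm)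
  interpret TN1: module R "TN 1" by (rule TNm)
  interpret PN0: module R "PN 0" by (rule PNm)
  interpret MN: module R ?MN by (rule MNm)
  show ?thesis
  proof
    assume tf: "torsion_free R ?MN"
    \<comment> \<open>After tensoring, the term with \<open>k0\<close> vanishes on cycles, so
      \<open>r\<close> times a cycle is a boundary. Hence cycles of degree 0 map to torsion elements
      of the tensor product of \<open>M\<close> and \<open>N\<close>.\<close>
    obtain r l k0 where r: "r \<in> carrier R" "r \<noteq> \<zero>\<^bsub>R\<^esub>"
      and l: "l \<in> module_hom R ?A ?At" and k0: "k0 \<in> module_hom R ?B ?A"
      and rc: "\<And>x. x \<in> carrier ?A \<Longrightarrow> r \<odot>\<^bsub>?A\<^esub> x = ?dt (l x) \<oplus>\<^bsub>?A\<^esub> k0 (?do x)"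
      by (rule rational_contraction[OF T Tf Tac]) blast
    \<comment> \<open>The defect of the homotopy identity on \<open>?A\<close>. It vanishes on
      cycles, and the extension property of \<open>T\<close> makes it equal to \<open>k1\<close>
      after \<open>?do\<close>, so that after tensoring it too vanishes on cycles.\<close>
    define w where "w x = x \<ominus>\<^bsub>?A\<^esub> (\<phi> (\<theta> 0 x) \<oplus>\<^bsub>?A\<^esub> ?dt (k x))" for x
    note \<phi>\<theta> = hom_comp[OF \<theta>0 \<phi>] and dk = hom_comp[OF k dT1]
    note s = hom_plus[OF Tm \<phi>\<theta> dk]
    have w: "w \<in> module_hom R ?A ?A" unfolding w_def by (rule hom_diff[OF Tm hom_id s])
    have wker: "w x = \<zero>\<^bsub>?A\<^esub>" if x: "x \<in> carrier ?A" "?do x = \<zero>\<^bsub>?B\<^esub>" for x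
    proof -
      have "x \<in> ?dt ` carrier ?At" by (rule chain_complex_exact[OF T Tac _ _ x]) simp_all
      then obtain z where z: "z \<in> carrier ?At" "x = ?dt z" by blast
      have "x = \<phi> (\<theta> 0 x) \<oplus>\<^bsub>?A\<^esub> ?dt (k x)" using E3[OF z(1)] z(2) by simp
      then show ?thesis unfolding w_def using module_diff_eq_zero[OF Tm x(1) x(1)] by metis
    qed
    have minus_one: "- 1 = 0 - (1 :: int)" by simp
    obtain X \<iota> where bT: "dual_basis R ?A X \<iota>" by (rule fin_gen_free_dual_basis[OF Tm Tf])
    obtain k1 where k1: "k1 \<in> module_hom R ?B ?A"
      "\<And>x. x \<in> carrier ?A \<Longrightarrow> k1 (?do x) = w x"
      by (rule acyclic_extension[OF fid T Tac Tf minus_one bT w wker]) (assumption | blast)+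
    note kd = hom_comp[OF dT0 k1(1)]
    have split: "x = \<phi> (\<theta> 0 x) \<oplus>\<^bsub>?A\<^esub> ?dt (k x) \<oplus>\<^bsub>?A\<^esub> k1 (?do x)" if x: "x \<in> carrier ?A" for x
      unfolding k1(2)[OF x] w_def
      using module_sub_add_cancel[OF Tm x hom_closed[OF s x]] by simp
    show "zero_module (tate_Tor R T N 0)"
      unfolding homology
    proof (intro ballI impI)
      fix t assume t: "t \<in> carrier (TN 0)" and t0: "D0 t = \<zero>\<^bsub>TN (- 1)\<^esub>"
      note t' = t[unfolded TN_def]
      have D0k: "tensor_map R ?A ?A N (\<lambda>x. g (?do x)) t = \<zero>\<^bsub>TN 0\<^esub>"
        if g: "g \<in> module_hom R ?B ?A" for g
      proof -
        have "tensor_map R ?A ?A N (\<lambda>x. g (?do x)) t = tensor_map R ?B ?A N g (D0 t)"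
          unfolding D0_def by (rule tensor_map_comp[OF Tm Tm Tm N(1) dT0 g hom_comp[OF dT0 g] refl t'])
        also have "\<dots> = \<zero>\<^bsub>TN 0\<^esub>"
          unfolding t0
          by (rule hom_zero[OF TNm TNm]) (use hom_tensor_map[OF Tm Tm N(1) g] in \<open>simp add: TN_def\<close>)
        finally show ?thesis .
      qed
      have D1g: "\<exists>u\<in>carrier (TN 1). tensor_map R ?A ?A N (\<lambda>x. ?dt (g x)) t = D1 u"
        if g: "g \<in> module_hom R ?A ?At" for g
        unfolding D1_def
        using tensor_map_comp[OF Tm Tm Tm N(1) g dT1 hom_comp[OF g dT1] refl t']
          hom_closed[OF hom_tensor_map[OF Tm Tm N(1) g] t'] by (auto simp: TN_def)
      note rs = hom_scale[OF Tm hom_id r(1)]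
      have "r \<odot>\<^bsub>TN 0\<^esub> t = r \<odot>\<^bsub>TN 0\<^esub> tensor_map R ?A ?A N (\<lambda>x. x) t"
        by (simp add: tensor_map_id[OF Tm N(1) hom_id refl t'])
      also have "\<dots> = tensor_map R ?A ?A N (\<lambda>x. r \<odot>\<^bsub>?A\<^esub> x) t"
        unfolding TN_def by (rule tensor_map_smult[OF Tm Tm N(1) hom_id rs r(1) refl t', symmetric])
      also have "\<dots> = tensor_map R ?A ?A N (\<lambda>x. ?dt (l x)) t \<oplus>\<^bsub>TN 0\<^esub>
          tensor_map R ?A ?A N (\<lambda>x. k0 (?do x)) t"
        unfolding TN_def by (rule tensor_map_plus[OF Tm Tm N(1) hom_comp[OF l dT1] hom_comp[OF dT0 k0] rs rc t'])
      finally obtain u where u: "u \<in> carrier (TN 1)" "r \<odot>\<^bsub>TN 0\<^esub> t = D1 u"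
        using D1g[OF l] hom_closed[OF D1] by (auto simp: D0k[OF k0])
      \<comment> \<open>\<open>\<Lambda>\<close> after \<open>\<Theta>\<close> kills boundaries, so
        \<open>r\<close> kills the image of \<open>t\<close>, which is zero by
        torsion-freeness.\<close>
      have "r \<odot>\<^bsub>?MN\<^esub> \<Lambda> (\<Theta> t) = \<Lambda> (\<Theta> (r \<odot>\<^bsub>TN 0\<^esub> t))"
        using r t hom_closed[OF \<Theta>] by (simp add: hom_smult[OF \<Lambda>] hom_smult[OF \<Theta>])
      then have "r \<odot>\<^bsub>?MN\<^esub> \<Lambda> (\<Theta> t) = \<zero>\<^bsub>?MN\<^esub>" using u \<Lambda>\<Theta>D by simp
      then have "\<Lambda> (\<Theta> t) = \<zero>\<^bsub>?MN\<^esub>"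
        using tf r hom_closed[OF \<Lambda> hom_closed[OF \<Theta> t]] unfolding torsion_free_def by blast
      then obtain q where q: "q \<in> carrier (PN 1)" "\<Theta> t = Q1 q" using \<Lambda>exact[OF hom_closed[OF \<Theta> t]] by blast
      obtain u' where u': "u' \<in> carrier (TN 1)" "tensor_map R ?A ?A N (\<lambda>x. ?dt (k x)) t = D1 u'"
        using D1g[OF k] by blast
      have "tensor_map R ?A ?A N (\<lambda>x. \<phi> (\<theta> 0 x)) t = \<Phi> (\<Theta> t)"
        unfolding \<Phi>_def \<Theta>_def by (rule tensor_map_comp[OF Tm Pm Tm N(1) \<theta>0 \<phi> \<phi>\<theta> refl t'])
      also have "\<dots> = D1 (\<Phi>' q)" using q \<Phi>Q by simp
      \<comment> \<open>All three summands are now boundaries: the first because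
        \<open>\<Theta> t\<close> comes from \<open>PN 1\<close>, the second because it passes
        through \<open>?dt\<close>, the third because it is zero on cycles.\<close>
      finally have "t = D1 (\<Phi>' q) \<oplus>\<^bsub>TN 0\<^esub> D1 u' \<oplus>\<^bsub>TN 0\<^esub> \<zero>\<^bsub>TN 0\<^esub>"
        using tensor_map_id_sum3[OF Tm N(1) \<phi>\<theta> dk kd split t'] u'(2) D0k[OF k1(1)] by (simp add: TN_def)
      also have "\<dots> = D1 (\<Phi>' q \<oplus>\<^bsub>TN 1\<^esub> u')"
        using hom_closed[OF \<Phi>' q(1)] u'(1) hom_closed[OF D1] by (simp add: hom_add[OF D1])
      finally show "t \<in> D1 ` carrier (TN 1)"
        using hom_closed[OF \<Phi>' q(1)] u'(1) by (metis TN1.M.a_closed imageI)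
    qed
  next
    assume "zero_module (tate_Tor R T N 0)"
    then have H0: "t \<in> D1 ` carrier (TN 1)" if "t \<in> carrier (TN 0)" "D0 t = \<zero>\<^bsub>TN (- 1)\<^esub>" for t
      using that unfolding homology by blast
    obtain X \<iota> where bT: "dual_basis R ?B X \<iota>" by (rule fin_gen_free_dual_basis[OF Tm Tf])
    obtain \<kappa> where bP: "dual_basis R ?P (carrier ?P) \<kappa>" by (rule projective_dual_basis[OF proj])
    have tfT: "torsion_free R (TN (- 1))" unfolding TN_def by (rule tensor_dual_basis_torsion_free[OF bT N])
    have tfP: "torsion_free R (PN 0)" unfolding PN_def by (rule tensor_dual_basis_torsion_free[OF bP N])
    \<comment> \<open>The error term in degree 0. It only has to kill the image of
      \<open>?et\<close>: if a nonzero multiple of an element comes from \<open>PN 1\<close>, the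
      error term of that element is torsion in the torsion-free \<open>PN 0\<close> and hence
      zero.\<close>
    define v where "v x = x \<ominus>\<^bsub>?P\<^esub> (\<theta> 0 (\<phi> x) \<oplus>\<^bsub>?P\<^esub> ?et (h x))" for x
    note \<theta>\<phi> = hom_comp[OF \<phi> \<theta>0] and dh = hom_comp[OF h dP1]
    note s = hom_plus[OF Pm \<theta>\<phi> dh]
    have v: "v \<in> module_hom R ?P ?P" unfolding v_def by (rule hom_diff[OF Pm hom_id s])
    have vd: "v (?et x) = \<zero>\<^bsub>?P\<^esub>" if x: "x \<in> carrier ?Pt" for x
    proof -
      note dx = hom_closed[OF dP1 x]
      show ?thesis unfolding v_def using module_diff_eq_zero[OF Pm dx dx] E2[OF x] by metis
    qed
    have split: "x = \<theta> 0 (\<phi> x) \<oplus>\<^bsub>?P\<^esub> ?et (h x) \<oplus>\<^bsub>?P\<^esub> v x" if x: "x \<in> carrier ?P" for x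
      unfolding v_def using module_sub_add_cancel[OF Pm x hom_closed[OF s x]] by simp
    define V where "V = tensor_map R ?P ?P N v"
    have V: "V \<in> module_hom R (PN 0) (PN 0)" unfolding V_def PN_def by (rule hom_tensor_map[OF Pm Pm N(1) v])
    have VQ: "V (Q1 t) = \<zero>\<^bsub>PN 0\<^esub>" if t: "t \<in> carrier (PN 1)" for t
    proof -
      have "tensor_map R ?Pt ?P N (\<lambda>x. v (?et x)) t = V (Q1 t)"
        unfolding V_def Q1_def
        by (rule tensor_map_comp[OF Pm Pm Pm N(1) dP1 v hom_comp[OF dP1 v] refl t[unfolded PN_def]])
      moreover have "tensor_map R ?Pt ?P N (\<lambda>x. v (?et x)) t = \<zero>\<^bsub>PN 0\<^esub>"
        unfolding PN_def by (rule tensor_map_zero[OF Pm Pm N(1) hom_comp[OF dP1 v] vd t[unfolded PN_def]])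
      ultimately show ?thesis by simp
    qed
    show "torsion_free R ?MN"
      unfolding torsion_free_def
    proof (intro ballI impI disjCI)
      fix r z assume r: "r \<in> carrier R" and z: "z \<in> carrier ?MN" and rz: "r \<odot>\<^bsub>?MN\<^esub> z = \<zero>\<^bsub>?MN\<^esub>" and "z \<noteq> \<zero>\<^bsub>?MN\<^esub>"
      show "r = \<zero>\<^bsub>R\<^esub>"
      proof (rule ccontr)
        assume r0: "r \<noteq> \<zero>\<^bsub>R\<^esub>"
        have "z \<in> \<Lambda> ` carrier (PN 0)" unfolding \<Lambda>_def PN_def by (rule tensor_map_surj[OF Pm M(1) N(1) \<pi> surj z])
        then obtain t where t: "t \<in> carrier (PN 0)" "z = \<Lambda> t" by blast
        note t' = t(1)[unfolded PN_def]
        have "\<Lambda> (r \<odot>\<^bsub>PN 0\<^esub> t) = \<zero>\<^bsub>?MN\<^esub>" using rz t r by (simp add: hom_smult[OF \<Lambda>])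
        then obtain q where q: "q \<in> carrier (PN 1)" "r \<odot>\<^bsub>PN 0\<^esub> t = Q1 q" using \<Lambda>exact r t(1) by blast
        \<comment> \<open>\<open>\<Phi>\<close> carries the image of \<open>Q1\<close> to
          boundaries, so \<open>r\<close> kills \<open>D0 (\<Phi> t)\<close>. As
          \<open>TN (- 1)\<close> is torsion-free, \<open>\<Phi> t\<close> is a cycle, and the
          vanishing of homology makes it a boundary.\<close>
        have "r \<odot>\<^bsub>TN (- 1)\<^esub> D0 (\<Phi> t) = D0 (\<Phi> (r \<odot>\<^bsub>PN 0\<^esub> t))"
          using r t(1) hom_closed[OF \<Phi>] by (simp add: hom_smult[OF D0] hom_smult[OF \<Phi>])
        also have "\<dots> = \<zero>\<^bsub>TN (- 1)\<^esub>" using q \<Phi>Q DD hom_closed[OF \<Phi>'] by simp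
        finally have "D0 (\<Phi> t) = \<zero>\<^bsub>TN (- 1)\<^esub>"
          using tfT r r0 hom_closed[OF D0 hom_closed[OF \<Phi> t(1)]] unfolding torsion_free_def by blast
        then obtain u where u: "u \<in> carrier (TN 1)" "\<Phi> t = D1 u" using H0 hom_closed[OF \<Phi> t(1)] by blast
        have "r \<odot>\<^bsub>PN 0\<^esub> V t = V (Q1 q)" using r t(1) q(2) by (simp flip: hom_smult[OF V])
        then have Vt: "V t = \<zero>\<^bsub>PN 0\<^esub>"
          using VQ[OF q(1)] tfP r r0 hom_closed[OF V t(1)] unfolding torsion_free_def by metis
        have 1: "tensor_map R ?P ?P N (\<lambda>x. \<theta> 0 (\<phi> x)) t = \<Theta> (\<Phi> t)"
          unfolding \<Phi>_def \<Theta>_def by (rule tensor_map_comp[OF Pm Tm Pm N(1) \<phi> \<theta>0 \<theta>\<phi> refl t'])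
        define c where "c = tensor_map R ?P ?Pt N h t"
        have c: "c \<in> carrier (PN 1)" unfolding c_def PN_def by (rule hom_closed[OF hom_tensor_map[OF Pm Pm N(1) h] t'])
        have 2: "tensor_map R ?P ?P N (\<lambda>x. ?et (h x)) t = Q1 c"
          unfolding Q1_def c_def by (rule tensor_map_comp[OF Pm Pm Pm N(1) h dP1 dh refl t'])
        \<comment> \<open>Of the three summands of \<open>t\<close> the error term is zero and
          \<open>\<Lambda>\<close> kills the other two, so \<open>z\<close> is zero.\<close>
        have "t = \<Theta> (D1 u) \<oplus>\<^bsub>PN 0\<^esub> Q1 c \<oplus>\<^bsub>PN 0\<^esub> \<zero>\<^bsub>PN 0\<^esub>"
          using tensor_map_id_sum3[OF Pm N(1) \<theta>\<phi> dh v split t'] 1 2 u(2) Vt by (simp add: PN_def V_def)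
        moreover have "\<Theta> (D1 u) \<in> carrier (PN 0)" "Q1 c \<in> carrier (PN 0)"
          using hom_closed[OF \<Theta> hom_closed[OF D1 u(1)]] hom_closed[OF Q1 c] .
        ultimately have "\<Lambda> t = \<Lambda> (\<Theta> (D1 u)) \<oplus>\<^bsub>?MN\<^esub> \<Lambda> (Q1 c)"
          using hom_add[OF \<Lambda>] by (metis PN0.M.a_closed PN0.M.r_zero)
        then have "z = \<zero>\<^bsub>?MN\<^esub>" using t(2) \<Lambda>\<Theta>D[OF u(1)] \<Lambda>Q[OF c] by simp
        then show False using \<open>z \<noteq> \<zero>\<^bsub>?MN\<^esub>\<close> by blast
      qed
    qed
  qed
qed

end
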